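(* Let $\chi_1$ and $\chi_2$ be two primitive Dirichlet characters with prime conductors $q_1$ and $q_2$ respectively, $q_1 \leqslant q_2$, let $T > 1$ and let $r\geqslant 2$ be an integer. Put $\nu_r := 1$ if $r = 2$ and $\nu_r := 0$ otherwise. Set $$T_r := q_1^{\frac{(r+1)^2}{4r}} q_2^{\frac{r+1}{4r}} (\log q_1)^{r+1} (\log q_2)^{\nu_r r (r+1) + r^2 + 1}.$$ Then $$\sum_{0 < xy \leqslant T}\chi_1(x)\chi_2(y) \ll \begin{cases} T^{1-\frac 1 r} (q_1q_2)^{\frac{r+1}{4r^2}} (\log q_1)^{\frac 1 r}(\log q_2)^{\frac 1 r+\nu_r + 1} & \text{if } (q_1q_2)^{\frac{r+1}{4r}} \leqslant T\leqslant T_r,\\ T^{\frac{r}{r+1}} q_2^{\frac 1 {4r}} (\log q_2)^{\frac{2}{r+1}} & \text{if } T_r \leqslant T, \end{cases}$$ with an implied constant depending at most on $r$.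
   Context: The sum $\sum_{0<xy\leqslant T}$ runs over all pairs $(x,y)$ of positive integers with $xy\leqslant T$; $T$ is a real number. The notation $A\ll B$ means $|A|\leqslant C B$ for some constant $C>0$; here $C$ may depend on $r$ but not on $\chi_1,\chi_2,q_1,q_2,T$. *)

theory Defs
  imports Complex_Main "HOL-Computational_Algebra.Primes"
begin

(* Complete multiplicativity together with chi 1 \<noteq> 0 gives chi 1 = 1. *)
definition dirichlet_character :: "nat \<Rightarrow> (int \<Rightarrow> complex) \<Rightarrow> bool" where
  "dirichlet_character q \<chi> \<longleftrightarrow>
     q > 0 \<and>
     (\<forall>a b. \<chi> (a * b) = \<chi> a * \<chi> b) \<and>
     (\<forall>a. \<chi> (a + int q) = \<chi> a) \<and>
     (\<forall>a. \<chi> a \<noteq> 0 \<longleftrightarrow> coprime a (int q))"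

definition induced_from :: "nat \<Rightarrow> (int \<Rightarrow> complex) \<Rightarrow> nat \<Rightarrow> bool" where
  "induced_from q \<chi> d \<longleftrightarrow>
     d dvd q \<and>
     (\<exists>\<psi>. dirichlet_character d \<psi> \<and> (\<forall>a. coprime a (int q) \<longrightarrow> \<chi> a = \<psi> a))"

(* Meaningful only if chi is a Dirichlet character modulo q; it is then induced from q itself,
   so the least element exists. *)
definition conductor :: "nat \<Rightarrow> (int \<Rightarrow> complex) \<Rightarrow> nat" where
  "conductor q \<chi> = (LEAST d. induced_from q \<chi> d)"

definition primitive_character :: "nat \<Rightarrow> (int \<Rightarrow> complex) \<Rightarrow> bool" where
  "primitive_character q \<chi> \<longleftrightarrow> dirichlet_character q \<chi> \<and> conductor q \<chi> = q"

definition nu :: "nat \<Rightarrow> nat" where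
  "nu r = (if r = 2 then 1 else 0)"

definition T_threshold :: "nat \<Rightarrow> nat \<Rightarrow> nat \<Rightarrow> real" where
  "T_threshold r q\<^sub>1 q\<^sub>2 =
     real q\<^sub>1 powr ((real r + 1)\<^sup>2 / (4 * real r)) *
     real q\<^sub>2 powr ((real r + 1) / (4 * real r)) *
     ln (real q\<^sub>1) ^ (r + 1) *
     ln (real q\<^sub>2) ^ (nu r * r * (r + 1) + r\<^sup>2 + 1)"

end

theory Submission
  imports Defs "Berlekamp_Zassenhaus.Finite_Field" "HOL-Algebra.Algebraic_Closure_Type"
    "HOL-Computational_Algebra.Fundamental_Theorem_Algebra" "HOL-Analysis.Convex"
begin

text \<open>
  Split the region \<open>xy \<le> T\<close> at \<open>x, y \<le> sqrt T\<close> and the first variable dyadically. Above a dyadic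
  block the region is a box and a curved triangle, and bisecting the block repeatedly exhausts the
  triangle by \<open>2^j\<close> boxes with sides \<open>2^j\<close> times shorter. On each box both character sums are bounded
  by Burgess, \<open>N powr (1 - 1/r) * q powr ((r+1)/(4r^2)) * (ln q) powr (1/r)\<close>; the levels \<open>j\<close> sum to a
  geometric series, except for \<open>r = 2\<close>, where all levels contribute equally and cost the additional
  logarithm. This gives the first bound whenever \<open>ln T\<close> is \<open>O(ln q2)\<close>. At \<open>T_threshold\<close> it crosses the
  second one, and for \<open>T \<ge> q2^6\<close> the second bound follows from the periodicity of the characters.

  Burgess's bound is proved by the standard induction on the length of the interval, from the moments
  of short character sums, and with a Polya-Vinogradov bound for long intervals. The moments need the Weil
  bound for the sums of \<open>\<psi>(x + c_1)^(e_1) * \<dots> * \<psi>(x + c_k)^(e_k)\<close> over \<open>GF(p)\<close> where some \<open>e_i\<close> is 1.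
  The function \<open>lam(g) = \<psi>(g(c_1))^(e_1) * \<dots> * \<psi>(g(c_k))^(e_k)\<close> of a monic polynomial \<open>g\<close> is completely
  multiplicative, and its sums over all monic \<open>g\<close> of a fixed degree vanish from degree \<open>k\<close> on. So its
  L-function is a polynomial of degree below \<open>k\<close>, and the logarithmic derivative has as coefficients the
  analogous character sums over \<open>GF(p^n)\<close>. These are \<open>O(p^(n/2))\<close> for even \<open>n\<close> with a constant that may
  depend on \<open>p\<close>, by Stepanov's method in the form of Bombieri: an auxiliary polynomial \<open>W\<close> is
  chosen such that \<open>W^s\<close>, with \<open>s = p^(n/2)\<close>, agrees up to a unit with the zero polynomial on the points in
  question. Hence the reciprocal roots of the L-function are at most \<open>sqrt p\<close> in absolute value.
\<close>


section \<open>Frobenius orbits in the algebraic closure of a prime field\<close>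

text \<open>Two obstacles shape the proof of the Weil bound. First, the fields
  \<open>GF(p^n)\<close> are required for infinitely many \<open>n\<close>; they are taken as fixed
  points of powers of Frobenius inside one algebraic closure, where the primes of
  \<open>GF(p)[X]\<close> correspond to the Frobenius orbits. Second, Stepanov's method wants an
  integral \<open>p^(n/2)\<close>, so only even \<open>n\<close> are treated. This loses nothing,
  because a reciprocal root that is too large already shows in the power sums of even order, and a
  constant depending on \<open>p\<close> is harmless, since \<open>p\<close> is fixed while
  \<open>n\<close> grows. The exponent 1 at some shift is used twice: it makes the L-function a
  polynomial, and it gives the polynomial \<open>f\<close> a simple root, at which the nonzero terms
  of the auxiliary polynomial vanish to different orders. The moments supply this exponent: tuples
  of shifts in which every value is repeated are few and are estimated trivially, and in every other
  tuple some shift stands alone.\<close>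

hide_const (open) Divisibility.prime Divisibility.irreducible Polynomials.lead_coeff
  Polynomials.degree Coset.order Module.smult

interpretation to_ac: map_poly_inj_idom_hom "to_ac :: 'a::field \<Rightarrow> _"
  by unfold_locales auto

abbreviation ac_eval :: "'a::field poly \<Rightarrow> 'a alg_closure \<Rightarrow> 'a alg_closure" where
  "ac_eval P x \<equiv> poly (map_poly to_ac P) x"

lemma frobenius_add:
  "(x + y :: 'p::prime_card mod_ring alg_closure) ^ (CARD('p) ^ n) = x ^ (CARD('p) ^ n) + y ^ (CARD('p) ^ n)"
  by (rule freshmans_dream'[of _ n]) (auto simp: prime_card)

lemma frobenius_sum:
  "(\<Sum>i\<in>A. f i :: 'p::prime_card mod_ring alg_closure) ^ (CARD('p) ^ n) = (\<Sum>i\<in>A. f i ^ (CARD('p) ^ n))"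
  by (rule freshmans_dream_sum'[of _ n]) (auto simp: prime_card)

lemma frobenius_to_ac: "to_ac (c :: 'p::prime_card mod_ring) ^ (CARD('p) ^ n) = to_ac c"
proof -
  have "c ^ (CARD('p) ^ n) = c"
    by (rule finite_field_power_card_power_eq_same[where n=n]) simp
  thus ?thesis by (simp flip: to_ac_power)
qed

lemma frobenius_minus:
  "(- x :: 'p::prime_card mod_ring alg_closure) ^ (CARD('p) ^ n) = - (x ^ (CARD('p) ^ n))"
proof -
  have "(x + (- x)) ^ (CARD('p) ^ n) = x ^ (CARD('p) ^ n) + (- x) ^ (CARD('p) ^ n)"
    by (rule frobenius_add)
  thus ?thesis by (simp add: add_eq_0_iff power_0_left)
qed

lemma frobenius_diff:
  "(x - y :: 'p::prime_card mod_ring alg_closure) ^ (CARD('p) ^ n) = x ^ (CARD('p) ^ n) - y ^ (CARD('p) ^ n)"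
  using frobenius_add[of x "-y" n] by (simp add: frobenius_minus)

lemma frobenius_inj:
  fixes x y :: "'p::prime_card mod_ring alg_closure"
  assumes "x ^ (CARD('p) ^ n) = y ^ (CARD('p) ^ n)" shows "x = y"
  using frobenius_diff[of x y n] assms by simp

text \<open>The coefficients of \<open>P\<close> lie in the prime field and are fixed by Frobenius.
  So Frobenius permutes the roots of \<open>P\<close>, and \<open>s\<close>-th powers can later be
  moved inside the auxiliary polynomial.\<close>

lemma frobenius_ac_eval:
  fixes P :: "'p::prime_card mod_ring poly"
  shows "ac_eval P x ^ (CARD('p) ^ n) = ac_eval P (x ^ (CARD('p) ^ n))"
  by (simp add: poly_altdef frobenius_sum power_mult_distrib frobenius_to_ac mult.commute flip: power_mult)

text \<open>The prime field already supplies \<open>p\<close> roots of \<open>X^p - X\<close>, as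
  many as its degree permits.\<close>

lemma frobenius_fixed_imp_base:
  fixes x :: "'p::prime_card mod_ring alg_closure"
  assumes "x ^ CARD('p) = x" shows "x \<in> range to_ac"
proof (rule ccontr)
  assume x: "x \<notin> range to_ac"
  define f :: "'p mod_ring alg_closure poly" where "f = monom 1 CARD('p) + [:0, -1:]"
  have p1: "CARD('p) > 1" using prime_card prime_gt_1_nat by auto
  have deg: "degree f = CARD('p)"
    unfolding f_def using p1 by (subst degree_add_eq_left) (auto simp: degree_monom_eq)
  have f0: "f \<noteq> 0" using deg p1 by force
  have ev: "poly f y = y ^ CARD('p) - y" for y by (simp add: f_def poly_monom)
  have "insert x (range to_ac) \<subseteq> {y. poly f y = 0}"
    using assms frobenius_to_ac[where n = 1] by (auto simp: ev)
  hence "card (insert x (range to_ac)) \<le> card {y. poly f y = 0}"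
    by (intro card_mono poly_roots_finite f0)
  also have "\<dots> \<le> CARD('p)" using card_poly_roots_bound[OF f0] deg by simp
  finally show False using x
    by (simp add: card_image inj_to_ac)
qed

lemma prime_monic:
  assumes "prime (P :: 'p::prime_card mod_ring poly)" shows "lead_coeff P = 1"
proof -
  have "P \<noteq> 0" "normalize P = P" using assms by auto
  hence "unit_factor P = 1" by (metis unit_factor_normalize)
  hence "unit_factor (lead_coeff P) = 1" by (simp add: unit_factor_poly_def one_pCons)
  thus ?thesis by simp
qed

lemma prime_degree_pos:
  assumes "prime (P :: 'p::prime_card mod_ring poly)" shows "degree P > 0"
  using assms by (metis bot_nat_0.not_eq_extremum is_unit_iff_degree not_prime_0 not_prime_unit)

lemma monic_normalize:
  assumes "lead_coeff (P :: 'p::prime_card mod_ring poly) = 1" shows "normalize P = P"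
proof -
  have "P \<noteq> 0" using assms by auto
  thus ?thesis using assms by (simp add: normalize_poly_eq_map_poly)
qed

lemma monic_irreducible_imp_prime:
  assumes "irreducible (P :: 'p::prime_card mod_ring poly)" "lead_coeff P = 1" shows "prime P"
  using assms by (intro Factorial_Ring.primeI) (auto simp: prime_elem_iff_irreducible monic_normalize)

text \<open>The minimal polynomial of \<open>x\<close> is constructed from its conjugates. The
  product over the Frobenius orbit has invariant coefficients and hence descends to the prime field;
  it is irreducible because a polynomial over the prime field that vanishes at \<open>x\<close>
  vanishes on the whole orbit.\<close>

lemma frobenius_orbit:
  fixes x :: "'p::prime_card mod_ring alg_closure"
  obtains D P where "D > 0" "x ^ (CARD('p) ^ D) = x" "inj_on (\<lambda>i. x ^ (CARD('p) ^ i)) {..<D}"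
    "prime P" "degree P = D" "map_poly to_ac P = (\<Prod>i<D. [:- (x ^ (CARD('p) ^ i)), 1:])"
proof -
  let ?p = "CARD('p)"
  let ?F = "\<lambda>i. x ^ (?p ^ i)"
  have F_F: "?F i ^ (?p ^ j) = ?F (i + j)" for i j by (simp add: power_add flip: power_mult)
  obtain R :: "'p mod_ring poly" where R: "R \<noteq> 0" "ac_eval R x = 0"
    using alg_closure_algebraic[of x] .
  have "ac_eval R (?F i) = 0" for i
    using frobenius_ac_eval[of R x i] R by (simp add: power_0_left)
  hence "range ?F \<subseteq> {y. ac_eval R y = 0}" by auto
  moreover have "finite {y. ac_eval R y = 0}"
    using R by (intro poly_roots_finite) simp
  ultimately have fin: "finite (range ?F)" by (rule finite_subset)
  \<comment> \<open>The orbit lies among the roots of \<open>R\<close>, so two iterates coincide;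
    injectivity of Frobenius turns this into a return to \<open>x\<close> itself.\<close>
  have "\<not> inj ?F"
    using fin finite_imageD infinite_UNIV_nat by blast
  then obtain i j where "i < j" "?F i = ?F j"
    unfolding inj_def by (metis linorder_neqE_nat)
  hence "?F (j - i) ^ (?p ^ i) = x ^ (?p ^ i)" by (simp add: F_F)
  hence "?F (j - i) = x" by (rule frobenius_inj)
  with \<open>i < j\<close> have ex: "\<exists>D. D > 0 \<and> ?F D = x" by (intro exI[of _ "j - i"]) auto
  define D where "D = (LEAST D. D > 0 \<and> ?F D = x)"
  have D: "D > 0" "?F D = x" using LeastI_ex[OF ex] by (auto simp: D_def)
  have D_min: "D \<le> k" if "k > 0" "?F k = x" for k
    unfolding D_def by (rule Least_le) (use that in auto)
  have inj: "inj_on ?F {..<D}"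
  proof (rule linorder_inj_onI')
    fix i j assume ij: "i \<in> {..<D}" "j \<in> {..<D}" "i < j"
    show "?F i \<noteq> ?F j"
    proof
      assume "?F i = ?F j"
      hence "?F (j - i) ^ (?p ^ i) = x ^ (?p ^ i)" using ij by (simp add: F_F)
      hence "?F (j - i) = x" by (rule frobenius_inj)
      from D_min[OF _ this] ij show False by auto
    qed
  qed
  define h where "h = (\<Prod>i<D. [:- ?F i, 1:])"
  interpret frob: map_poly_comm_ring_hom "\<lambda>c :: 'p mod_ring alg_closure. c ^ ?p"
    using frobenius_add[where n = 1] by unfold_locales (auto simp: power_mult_distrib power_0_left)
  have "map_poly (\<lambda>c. c ^ ?p) h = (\<Prod>i<D. [:- ?F (Suc i), 1:])"
    unfolding h_def frob.hom_prod
    using frobenius_minus[where n = 1 and 'p = 'p] F_F[of _ 1]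
    by (intro prod.cong refl) (simp add: frob.base.map_poly_pCons_hom mult.commute)
  \<comment> \<open>The shift of the indices is cyclic: the factor for index \<open>D\<close> is the
    one for index 0.\<close>
  also have "\<dots> = h"
  proof -
    obtain D' where D': "D = Suc D'" using D by (cases D) auto
    have "(\<Prod>i<D. [:- ?F (Suc i), 1:]) = (\<Prod>i<D'. [:- ?F (Suc i), 1:]) * [:- ?F D, 1:]"
      by (simp add: D')
    also have "\<dots> = h" unfolding h_def D' using D
      by (simp add: prod.lessThan_Suc_shift D' mult.commute del: prod.lessThan_Suc)
    finally show ?thesis .
  qed
  finally have "map_poly (\<lambda>c. c ^ ?p) h = h" .
  hence "coeff h i ^ ?p = coeff h i" for i
    by (metis frob.base.coeff_map_poly_hom)
  hence coeffs: "coeff h i \<in> range to_ac" for i by (rule frobenius_fixed_imp_base)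
  define P where "P = map_poly of_ac h"
  have hP: "map_poly to_ac P = h"
    by (rule poly_eqI) (simp add: P_def coeff_map_poly to_ac_of_ac[OF coeffs])
  have deg_h: "degree h = D"
    unfolding h_def by (subst degree_prod_sum_eq) auto
  hence degP: "degree P = D" by (metis hP to_ac.base.degree_map_poly_hom)
  have "lead_coeff h = 1" unfolding h_def by (simp add: lead_coeff_prod)
  hence "to_ac (lead_coeff P) = 1" using hP to_ac.base.hom_lead_coeff by metis
  hence monic: "lead_coeff P = 1" by (metis to_ac_1 to_ac_eq_iff)
  have "ac_eval P x = 0"
    unfolding hP h_def poly_prod using D by (intro prod_zero) (auto intro!: bexI[of _ 0])
  have small: "degree A \<ge> D" if "ac_eval A x = 0" "A \<noteq> 0" for A :: "'p mod_ring poly"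
  proof -
    have "?F ` {..<D} \<subseteq> {y. ac_eval A y = 0}"
      using frobenius_ac_eval[of A x] that by (auto simp: power_0_left)
    hence "card (?F ` {..<D}) \<le> card {y. ac_eval A y = 0}"
      using that by (intro card_mono poly_roots_finite) auto
    also have "\<dots> \<le> degree A" using card_poly_roots_bound[of "map_poly to_ac A"] that by auto
    finally show ?thesis using card_image[OF inj] by simp
  qed
  have "irreducible P"
  proof (rule Factorial_Ring.irreducibleI)
    show P0: "P \<noteq> 0" using degP D by auto
    show "\<not> P dvd 1" using degP D by (auto simp: is_unit_iff_degree P0)
    fix A B assume AB: "P = A * B"
    hence nz: "A \<noteq> 0" "B \<noteq> 0" using P0 by auto
    have "ac_eval A x = 0 \<or> ac_eval B x = 0"
      using \<open>ac_eval P x = 0\<close> by (simp add: AB to_ac.hom_mult)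
    moreover have "degree A + degree B = D" using degP nz by (simp add: AB degree_mult_eq)
    ultimately have "degree A = 0 \<or> degree B = 0" using small[of A] small[of B] nz by linarith
    thus "A dvd 1 \<or> B dvd 1" using nz by (auto simp: is_unit_iff_degree)
  qed
  hence "prime P" using monic by (rule monic_irreducible_imp_prime)
  with D inj degP hP show ?thesis by (intro that[of D P]) (auto simp: h_def)
qed

text \<open>Distinct primes satisfy a Bezout identity over the base field, which a common root in
  the closure would contradict.\<close>

lemma prime_common_root:
  fixes P Q :: "'p::prime_card mod_ring poly"
  assumes "prime P" "prime Q" "ac_eval P x = 0" "ac_eval Q x = 0"
  shows "P = Q"
proof (rule ccontr)
  assume "P \<noteq> Q"
  hence "coprime P Q" using assms by (intro primes_coprime) auto
  hence "fst (bezout_coefficients P Q) * P + snd (bezout_coefficients P Q) * Q = 1"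
    by (simp add: bezout_coefficients_fst_snd)
  hence "ac_eval (fst (bezout_coefficients P Q) * P + snd (bezout_coefficients P Q) * Q) x = 1"
    by simp
  thus False using assms by (simp add: to_ac.hom_mult to_ac.hom_add)
qed

lemma prime_roots:
  fixes P :: "'p::prime_card mod_ring poly"
  assumes "prime P" "ac_eval P x = 0"
  shows "x ^ (CARD('p) ^ degree P) = x"
    and "map_poly to_ac P = (\<Prod>i<degree P. [:- (x ^ (CARD('p) ^ i)), 1:])"
    and "inj_on (\<lambda>i. x ^ (CARD('p) ^ i)) {..<degree P}"
proof -
  obtain D Q where Q: "D > 0" "x ^ (CARD('p) ^ D) = x" "inj_on (\<lambda>i. x ^ (CARD('p) ^ i)) {..<D}"
    "prime Q" "degree Q = D" "map_poly to_ac Q = (\<Prod>i<D. [:- (x ^ (CARD('p) ^ i)), 1:])"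
    by (rule frobenius_orbit[of x])
  have "ac_eval Q x = 0"
    unfolding Q poly_prod using Q by (intro prod_zero) (auto intro!: bexI[of _ 0])
  hence "P = Q" using assms Q by (intro prime_common_root)
  thus "x ^ (CARD('p) ^ degree P) = x"
    and "map_poly to_ac P = (\<Prod>i<degree P. [:- (x ^ (CARD('p) ^ i)), 1:])"
    and "inj_on (\<lambda>i. x ^ (CARD('p) ^ i)) {..<degree P}"
    using Q by auto
qed

lemma card_roots_prime:
  fixes P :: "'p::prime_card mod_ring poly"
  assumes "prime P"
  shows "card {x. ac_eval P x = 0} = degree P"
proof -
  have "degree (map_poly to_ac P) > 0" using prime_degree_pos[OF assms] by simp
  then obtain x where x: "ac_eval P x = 0" using alg_closed_imp_poly_has_root by blast
  note r = prime_roots[OF assms x]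
  have "{y. ac_eval P y = 0} = (\<lambda>i. x ^ (CARD('p) ^ i)) ` {..<degree P}"
    unfolding r(2) poly_prod by auto
  thus ?thesis using card_image[OF r(3)] by simp
qed

lemma ex_prime_root:
  fixes x :: "'p::prime_card mod_ring alg_closure"
  obtains P :: "'p mod_ring poly" where "prime P" "ac_eval P x = 0"
proof -
  obtain D Q where Q: "D > 0" "x ^ (CARD('p) ^ D) = x" "inj_on (\<lambda>i. x ^ (CARD('p) ^ i)) {..<D}"
    "prime Q" "degree Q = D" "map_poly to_ac Q = (\<Prod>i<D. [:- (x ^ (CARD('p) ^ i)), 1:])"
    by (rule frobenius_orbit[of x])
  have "ac_eval Q x = 0"
    unfolding Q poly_prod using Q by (intro prod_zero) (auto intro!: bexI[of _ 0])
  thus ?thesis using Q that by blast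
qed

lemma frobenius_period:
  fixes P :: "'p::prime_card mod_ring poly"
  assumes "prime P" "ac_eval P x = 0"
  shows "x ^ (CARD('p) ^ n) = x ^ (CARD('p) ^ (n mod degree P))"
proof -
  have "x ^ (CARD('p) ^ (degree P * k)) = x" for k
    by (induction k) (simp_all add: power_add power_mult prime_roots(1)[OF assms])
  hence "(x ^ (CARD('p) ^ (degree P * (n div degree P)))) ^ (CARD('p) ^ (n mod degree P)) 
      = x ^ (CARD('p) ^ (n mod degree P))" by simp
  thus ?thesis by (simp flip: power_mult power_add)
qed

lemma frobenius_fixed_iff:
  fixes P :: "'p::prime_card mod_ring poly"
  assumes "prime P" "ac_eval P x = 0"
  shows "x ^ (CARD('p) ^ n) = x \<longleftrightarrow> degree P dvd n"
proof -
  have pos: "degree P > 0" using assms prime_degree_pos by blast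
  have "x ^ (CARD('p) ^ n) = x \<longleftrightarrow> x ^ (CARD('p) ^ (n mod degree P)) = x ^ (CARD('p) ^ 0)"
    by (subst frobenius_period[OF assms]) simp
  also have "\<dots> \<longleftrightarrow> n mod degree P = 0"
    using pos by (subst inj_on_eq_iff[OF prime_roots(3)[OF assms]]) auto
  finally show ?thesis by (simp add: dvd_eq_mod_eq_0)
qed

section \<open>Finite fields as fixed points of Frobenius, and their norm map\<close>

lemma card_simple_roots:
  fixes f :: "'a::alg_closed_field poly"
  assumes "f \<noteq> 0" "\<And>x. poly f x = 0 \<Longrightarrow> poly (pderiv f) x \<noteq> 0"
  shows "card {x. poly f x = 0} = degree f"
proof -
  obtain A where A: "size A = degree f" "f = smult (lead_coeff f) (\<Prod>x\<in>#A. [:- x, 1:])"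
    using alg_closed_imp_factorization[OF assms(1)] by blast
  have roots: "poly f x = 0 \<longleftrightarrow> x \<in># A" for x
    using assms(1) by (subst A(2)) (auto simp: poly_prod_mset)
  have "count A x \<le> 1" for x
  proof (rule ccontr)
    assume "\<not> count A x \<le> 1"
    hence "x \<in># A" "x \<in># A - {#x#}" by (auto simp: not_le simp flip: count_greater_zero_iff)
    then obtain B where B: "A = add_mset x (add_mset x B)" by (metis insert_DiffM)
    define g where "g = smult (lead_coeff f) (\<Prod>x\<in>#B. [:- x, 1:])"
    have f: "f = [:- x, 1:] * ([:- x, 1:] * g)" by (subst A(2)) (simp add: B g_def)
    have "poly f x = 0" by (subst f) simp
    moreover have "poly (pderiv f) x = 0" by (subst f) (simp add: pderiv_mult del: mult_pCons_left)
    ultimately show False using assms(2) by blast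
  qed
  hence count_le: "count A x \<le> 1" for x .
  have "A = mset_set (set_mset A)"
  proof (intro multiset_eqI)
    fix x show "count A x = count (mset_set (set_mset A)) x"
      using count_le[of x] by (cases "x \<in># A") (auto simp: not_in_iff intro!: le_antisym Suc_leI)
  qed
  hence "size A = card (set_mset A)" by (metis size_mset_set)
  thus ?thesis using A(1) roots by simp
qed

text \<open>For \<open>n > 0\<close> this is the field \<open>GF(p^n)\<close>, realised inside the
  algebraic closure.\<close>

definition frobenius_fixed :: "nat \<Rightarrow> 'p::prime_card mod_ring alg_closure set" where
  "frobenius_fixed n = {x. x ^ (CARD('p) ^ n) = x}"

lemma card_frobenius_fixed:
  assumes "n > 0"
  shows "card (frobenius_fixed n :: 'p::prime_card mod_ring alg_closure set) = CARD('p) ^ n"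
    and "finite (frobenius_fixed n :: 'p::prime_card mod_ring alg_closure set)"
proof -
  define q where "q = CARD('p) ^ n"
  have q1: "q > 1" unfolding q_def using prime_card assms prime_gt_1_nat one_less_power by blast
  define f :: "'p mod_ring alg_closure poly" where "f = monom 1 q + [:0, -1:]"
  have deg: "degree f = q"
    unfolding f_def using q1 by (subst degree_add_eq_left) (auto simp: degree_monom_eq)
  have f0: "f \<noteq> 0" using deg q1 by force
  have roots: "{x. poly f x = 0} = (frobenius_fixed n :: 'p mod_ring alg_closure set)"
    unfolding frobenius_fixed_def f_def by (auto simp: poly_monom q_def)
  have "of_nat q = (of_nat CARD('p) :: 'p mod_ring alg_closure) ^ n" by (simp add: q_def)
  also have "(of_nat CARD('p) :: 'p mod_ring alg_closure) = 0"
    by (subst of_nat_eq_0_iff_char_dvd) simp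
  finally have "of_nat q = (0 :: 'p mod_ring alg_closure)" using assms by simp
  hence "pderiv f = [:-1:]"
    by (simp add: f_def pderiv_add pderiv_monom pderiv_pCons)
  hence "card {x. poly f x = 0} = q" using card_simple_roots[OF f0] deg by simp
  thus "card (frobenius_fixed n :: 'p mod_ring alg_closure set) = CARD('p) ^ n"
    by (simp add: roots q_def)
  show "finite (frobenius_fixed n :: 'p mod_ring alg_closure set)"
    using poly_roots_finite[OF f0] by (simp add: roots)
qed

lemma finite_monic_degree: "finite {g :: 'a::{finite,comm_semiring_1} poly. degree g = k \<and> lead_coeff g = 1}"
  and finite_poly_degree_le: "finite {g :: 'a::{finite,comm_semiring_1} poly. degree g \<le> k}"
proof -
  have "{g :: 'a poly. degree g \<le> k} \<subseteq> Poly ` {xs. set xs \<subseteq> UNIV \<and> length xs \<le> Suc k}"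
  proof
    fix g :: "'a poly" assume "g \<in> {g. degree g \<le> k}"
    hence "g = Poly (coeffs g)" "length (coeffs g) \<le> Suc k" by (cases "g = 0"; auto simp: length_coeffs_degree)+
    thus "g \<in> Poly ` {xs. set xs \<subseteq> UNIV \<and> length xs \<le> Suc k}" by blast
  qed
  thus "finite {g :: 'a poly. degree g \<le> k}"
    by (rule finite_subset) (intro finite_imageI finite_lists_length_le finite)
  thus "finite {g :: 'a poly. degree g = k \<and> lead_coeff g = 1}"
    by (rule rev_finite_subset) auto
qed

lemma finite_primes_dvd:
  assumes "n > 0"
  shows "finite {P :: 'p::prime_card mod_ring poly. prime P \<and> degree P dvd n}"
  by (rule finite_subset[OF _ finite_poly_degree_le[of n]]) (use assms in \<open>auto dest: dvd_imp_le\<close>)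

text \<open>The points of \<open>GF(p^n)\<close> are grouped into Frobenius orbits. This is the
  bridge from sums over primes, as in a logarithmic derivative, to character sums over
  \<open>GF(p^n)\<close>.\<close>

lemma sum_frobenius_fixed:
  fixes h :: "'p::prime_card mod_ring alg_closure \<Rightarrow> complex"
  assumes "n > 0"
  shows "(\<Sum>x\<in>frobenius_fixed n. h x) =
    (\<Sum>P | prime P \<and> degree P dvd n. \<Sum>x | ac_eval P x = 0. h x)"
proof -
  have "frobenius_fixed n = (\<Union>P\<in>{P :: 'p mod_ring poly. prime P \<and> degree P dvd n}. {x. ac_eval P x = 0})"
  proof (intro equalityI subsetI)
    fix x :: "'p mod_ring alg_closure" assume x: "x \<in> frobenius_fixed n"
    obtain P :: "'p mod_ring poly" where "prime P" "ac_eval P x = 0" by (rule ex_prime_root)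
    thus "x \<in> (\<Union>P\<in>{P :: 'p mod_ring poly. prime P \<and> degree P dvd n}. {x. ac_eval P x = 0})"
      using x frobenius_fixed_iff[of P x n] by (auto simp: frobenius_fixed_def)
  qed (auto simp: frobenius_fixed_def frobenius_fixed_iff)
  also have "(\<Sum>x\<in>\<dots>. h x) = (\<Sum>P | prime P \<and> degree P dvd n. \<Sum>x | ac_eval P x = 0. h x)"
  proof (rule sum.UNION_disjoint)
    show "finite {P :: 'p mod_ring poly. prime P \<and> degree P dvd n}"
      by (rule finite_primes_dvd[OF assms])
    show "\<forall>P\<in>{P :: 'p mod_ring poly. prime P \<and> degree P dvd n}. finite {x. ac_eval P x = 0}"
      by (auto intro!: poly_roots_finite)
  next
    show "\<forall>P\<in>{P :: 'p mod_ring poly. prime P \<and> degree P dvd n}. \<forall>Q\<in>{P. prime P \<and> degree P dvd n}.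
      P \<noteq> Q \<longrightarrow> {x. ac_eval P x = 0} \<inter> {x. ac_eval Q x = 0} = {}"
      using prime_common_root by fast
  qed
  finally show ?thesis .
qed

text \<open>The exponent \<open>(p^n - 1) / (p - 1)\<close> of the norm map from
  \<open>GF(p^n)\<close> to \<open>GF(p)\<close>.\<close>

definition geo :: "nat \<Rightarrow> nat \<Rightarrow> nat" where "geo p n = (\<Sum>i<n. p ^ i)"

lemma geo_mult: "p > 0 \<Longrightarrow> (p - 1) * geo p n = p ^ n - 1"
proof -
  assume p: "p > 0"
  have "int ((p - 1) * geo p n) = (int p - 1) * (\<Sum>i<n. int p ^ i)"
    using p by (simp add: geo_def of_nat_diff)
  also have "\<dots> = int p ^ n - 1" by (rule power_diff_1_eq[symmetric])
  also have "\<dots> = int (p ^ n - 1)" using p by (simp add: of_nat_diff)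
  finally show ?thesis by (simp only: of_nat_eq_iff)
qed

lemma prod_mod_period:
  fixes g :: "nat \<Rightarrow> 'a::comm_monoid_mult"
  shows "(\<Prod>i<D * k. g (i mod D)) = (\<Prod>i<D. g i) ^ k"
proof (induction k)
  case (Suc k)
  have "(\<Prod>i<D * Suc k. g (i mod D)) = (\<Prod>i<D * k + D. g (i mod D))" by (simp add: add.commute)
  also have "\<dots> = (\<Prod>i<D * k. g (i mod D)) * (\<Prod>i<D. g ((D * k + i) mod D))"
  proof -
    have "(\<Prod>i<m + D. h i) = (\<Prod>i<m. h i) * (\<Prod>i<D. h (m + i))" for h :: "nat \<Rightarrow> 'a" and m
      by (induction D) (simp_all add: mult.assoc)
    thus ?thesis .
  qed
  also have "(\<Prod>i<D. g ((D * k + i) mod D)) = (\<Prod>i<D. g i)" by (intro prod.cong) auto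
  finally show ?case by (simp add: Suc mult.commute)
qed auto

text \<open>The conjugates of \<open>x - c\<close> run \<open>n div degree P\<close> times through
  the differences of the roots of \<open>P\<close> and \<open>c\<close>, so the norm is a power of
  \<open>P(c)\<close> up to the sign \<open>(-1)^n\<close>. Even \<open>n\<close> removes that
  sign.\<close>

lemma norm_linear:
  fixes P :: "'p::prime_card mod_ring poly"
  assumes "prime P" "ac_eval P x = 0" "degree P dvd n" "even n"
  shows "(x - to_ac c) ^ geo CARD('p) n = to_ac (poly P c ^ (n div degree P))"
proof -
  define D where "D = degree P"
  define k where "k = n div D"
  have n: "n = D * k" using assms by (simp add: k_def D_def)
  have "(x - to_ac c) ^ geo CARD('p) n = (\<Prod>i<n. (x - to_ac c) ^ (CARD('p) ^ i))"
    unfolding geo_def by (rule power_sum)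
  also have "\<dots> = (\<Prod>i<n. x ^ (CARD('p) ^ i) - to_ac c)"
    by (simp add: frobenius_diff frobenius_to_ac)
  also have "\<dots> = (\<Prod>i<D * k. x ^ (CARD('p) ^ (i mod D)) - to_ac c)"
    unfolding n D_def by (intro prod.cong refl arg_cong2[where f = minus] frobenius_period assms)
  also have "\<dots> = (\<Prod>i<D. x ^ (CARD('p) ^ i) - to_ac c) ^ k"
    by (rule prod_mod_period)
  also have "(\<Prod>i<D. x ^ (CARD('p) ^ i) - to_ac c) = (\<Prod>i<D. - 1 * (to_ac c - x ^ (CARD('p) ^ i)))"
    by simp
  also have "\<dots> = (- 1) ^ D * (\<Prod>i<D. to_ac c - x ^ (CARD('p) ^ i))"
    by (subst prod.distrib) simp
  also have "(\<Prod>i<D. to_ac c - x ^ (CARD('p) ^ i)) = ac_eval P (to_ac c)"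
    unfolding prime_roots(2)[OF assms(1,2)] D_def by (simp add: poly_prod)
  also have "\<dots> = to_ac (poly P c)" by simp
  also have "((- 1) ^ D * to_ac (poly P c)) ^ k = (- 1) ^ n * to_ac (poly P c ^ k)"
    unfolding n power_mult_distrib power_mult to_ac_power ..
  also have "(- 1 :: 'p mod_ring alg_closure) ^ n = 1" using \<open>even n\<close> by simp
  finally show ?thesis by (simp add: k_def D_def)
qed

section \<open>The L-function of a multiplicative function of polynomials\<close>

definition monics :: "nat \<Rightarrow> 'a::comm_ring_1 poly set" where
  "monics k = {g. degree g = k \<and> lead_coeff g = 1}"

lemma finite_monics: "finite (monics k :: 'a::{finite,comm_ring_1} poly set)"
  unfolding monics_def by (rule finite_monic_degree)

text \<open>The coefficient of \<open>u^k\<close> in the L-function of \<open>lam\<close>.\<close>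

definition euler_coeff :: "('p::prime_card mod_ring poly \<Rightarrow> complex) \<Rightarrow> nat \<Rightarrow> complex" where
  "euler_coeff lam k = (\<Sum>g\<in>monics k. lam g)"

text \<open>For a completely multiplicative \<open>lam\<close> with L-function \<open>L(u)\<close>
  this is the coefficient of \<open>u^j\<close> in \<open>u * L'(u) / L(u)\<close>, as read off from
  the Euler product.\<close>

definition euler_power_sum :: "('p::prime_card mod_ring poly \<Rightarrow> complex) \<Rightarrow> nat \<Rightarrow> complex" where
  "euler_power_sum lam j = (\<Sum>P | prime P \<and> degree P dvd j. of_nat (degree P) * lam P ^ (j div degree P))"

text \<open>The polynomial counterpart of writing \<open>log n\<close> as the sum of the von
  Mangoldt function over the divisors of \<open>n\<close>. The ranges of \<open>P\<close> and
  \<open>m\<close> do not depend on \<open>g\<close>, so that the sums can be interchanged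
  afterwards.\<close>

lemma degree_eq_sum_multiplicity:
  fixes g :: "'p::prime_card mod_ring poly"
  assumes "g \<in> monics k"
  shows "k = (\<Sum>P | prime P \<and> degree P \<le> k. \<Sum>m\<in>{1..k}. if P ^ m dvd g then degree P else 0)"
proof -
  have g0: "g \<noteq> 0" and gk: "degree g = k" using assms by (auto simp: monics_def)
  have "normalize g = (\<Prod>P\<in>prime_factors g. P ^ multiplicity P g)"
    using prod_prime_factors[OF g0] by simp
  hence "degree (normalize g) = (\<Sum>P\<in>prime_factors g. degree (P ^ multiplicity P g))"
    by (simp only:) (subst degree_prod_sum_eq, auto simp: in_prime_factors_iff)
  also have "\<dots> = (\<Sum>P\<in>prime_factors g. multiplicity P g * degree P)"
    by (intro sum.cong refl Polynomial.degree_power_eq) (auto simp: in_prime_factors_iff)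
  also have "degree (normalize g) = k" using gk assms by (simp add: monic_normalize monics_def)
  finally have "k = (\<Sum>P\<in>prime_factors g. multiplicity P g * degree P)" .
  also have "\<dots> = (\<Sum>P | prime P \<and> degree P \<le> k. multiplicity P g * degree P)"
  proof (rule sum.mono_neutral_left)
    show "finite {P :: 'p mod_ring poly. prime P \<and> degree P \<le> k}"
      by (rule finite_subset[OF _ finite_poly_degree_le[of k]]) auto
    show "prime_factors g \<subseteq> {P. prime P \<and> degree P \<le> k}"
      using gk g0 by (auto simp: in_prime_factors_iff dvd_imp_degree_le)
  qed (auto simp: in_prime_factors_iff g0 not_dvd_imp_multiplicity_0)
  also have "\<dots> = (\<Sum>P | prime P \<and> degree P \<le> k. \<Sum>m\<in>{1..k}. if P ^ m dvd g then degree P else 0)"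
  proof (rule sum.cong[OF refl])
    fix P :: "'p mod_ring poly" assume "P \<in> {P. prime P \<and> degree P \<le> k}"
    hence P: "prime P" by simp
    have iff: "P ^ m dvd g \<longleftrightarrow> m \<le> multiplicity P g" for m
      using P g0 prime_degree_pos[OF P] by (intro power_dvd_iff_le_multiplicity) auto
    have "multiplicity P g \<le> k"
    proof -
      have "P ^ multiplicity P g dvd g" by (rule multiplicity_dvd)
      hence "multiplicity P g * degree P \<le> k"
        using dvd_imp_degree_le[OF _ g0, of "P ^ multiplicity P g"] gk P by (auto simp: Polynomial.degree_power_eq)
      thus ?thesis using prime_degree_pos[OF P]
        using mult_le_mono2[of 1 "degree P" "multiplicity P g"] by linarith
    qed
    hence "{m\<in>{1..k}. P ^ m dvd g} = {1..multiplicity P g}" by (auto simp: iff)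
    thus "multiplicity P g * degree P = (\<Sum>m\<in>{1..k}. if P ^ m dvd g then degree P else 0)"
      by (simp flip: sum.inter_filter)
  qed
  finally show ?thesis .
qed

lemma sum_monics_dvd:
  fixes lam :: "'p::prime_card mod_ring poly \<Rightarrow> complex"
  assumes mult: "\<And>A B. lam (A * B) = lam A * lam B" and Q: "lead_coeff Q = 1"
  shows "(\<Sum>g\<in>monics k. if Q dvd g then lam g else 0) =
    (if degree Q \<le> k then lam Q * euler_coeff lam (k - degree Q) else 0)"
proof (cases "degree Q \<le> k")
  case False
  have "\<not> Q dvd g" if "g \<in> monics k" for g
    using that False dvd_imp_degree_le[of Q g] by (cases "g = 0") (auto simp: monics_def)
  thus ?thesis using False by (auto intro!: sum.neutral)
next
  case True
  have Q0: "Q \<noteq> 0" using Q by auto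
  have "(\<Sum>g\<in>monics k. if Q dvd g then lam g else 0) = (\<Sum>g | g \<in> monics k \<and> Q dvd g. lam g)"
    by (simp add: sum.inter_filter finite_monics)
  also have "\<dots> = (\<Sum>h\<in>monics (k - degree Q). lam Q * lam h)"
  proof (rule sum.reindex_bij_witness[of _ "\<lambda>h. Q * h" "\<lambda>g. g div Q"])
    fix h :: "'p mod_ring poly" assume "h \<in> monics (k - degree Q)"
    moreover from this have "h \<noteq> 0" by (auto simp: monics_def)
    ultimately show "Q * h \<in> {g \<in> monics k. Q dvd g}"
      using True Q Q0 lead_coeff_mult[of Q h] by (auto simp: monics_def degree_mult_eq)
  next
    fix g :: "'p mod_ring poly" assume g: "g \<in> {g \<in> monics k. Q dvd g}"
    then obtain h where h: "g = Q * h" unfolding dvd_def by blast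
    with g have h0: "h \<noteq> 0" by (auto simp: monics_def)
    have "lead_coeff h = 1" using g Q by (simp add: h monics_def lead_coeff_mult)
    moreover have "degree h = k - degree Q" using g Q0 h0 by (auto simp add: h monics_def degree_mult_eq)
    ultimately show "g div Q \<in> monics (k - degree Q)" using Q0 by (simp add: h monics_def)
  qed (use Q0 mult in \<open>auto\<close>)
  also have "\<dots> = lam Q * euler_coeff lam (k - degree Q)"
    by (simp add: euler_coeff_def sum_distrib_left)
  finally show ?thesis using True by simp
qed

text \<open>These are the coefficients of \<open>u L' = (u L'/L) L\<close>, obtained by finite sums:
  the weight \<open>k = degree g\<close> is distributed over the prime powers that divide
  \<open>g\<close>, and the multiples of each prime power are then summed.\<close>

lemma newton_euler:
  fixes lam :: "'p::prime_card mod_ring poly \<Rightarrow> complex"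
  assumes mult: "\<And>A B. lam (A * B) = lam A * lam B" and one: "lam 1 = 1"
  shows "of_nat k * euler_coeff lam k = (\<Sum>j\<in>{1..k}. euler_power_sum lam j * euler_coeff lam (k - j))"
proof -
  let ?Pr = "{P :: 'p mod_ring poly. prime P \<and> degree P \<le> k}"
  have fin: "finite ?Pr"
    by (rule finite_subset[OF _ finite_poly_degree_le[of k]]) auto
  have lam_pow: "lam (A ^ m) = lam A ^ m" for A m by (induction m) (auto simp: mult one)
  have "of_nat k * euler_coeff lam k = (\<Sum>g\<in>monics k. of_nat k * lam g)"
    by (simp add: euler_coeff_def sum_distrib_left)
  also have "\<dots> = (\<Sum>g\<in>monics k. \<Sum>P\<in>?Pr. \<Sum>m\<in>{1..k}. of_nat (degree P) * (if P ^ m dvd g then lam g else 0))"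
  proof (rule sum.cong[OF refl])
    fix g :: "'p mod_ring poly" assume g: "g \<in> monics k"
    have "(of_nat k :: complex) = of_nat (\<Sum>P\<in>?Pr. \<Sum>m\<in>{1..k}. if P ^ m dvd g then degree P else 0)"
      using degree_eq_sum_multiplicity[OF g] by (rule arg_cong)
    also have "\<dots> * lam g = (\<Sum>P\<in>?Pr. \<Sum>m\<in>{1..k}. of_nat (degree P) * (if P ^ m dvd g then lam g else 0))"
      unfolding of_nat_sum sum_distrib_right by (intro sum.cong refl) auto
    finally show "of_nat k * lam g = \<dots>" .
  qed
  also have "\<dots> = (\<Sum>P\<in>?Pr. \<Sum>m\<in>{1..k}. \<Sum>g\<in>monics k. of_nat (degree P) * (if P ^ m dvd g then lam g else 0))"
    by (subst sum.swap, intro sum.cong refl, rule sum.swap)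
  also have "\<dots> = (\<Sum>P\<in>?Pr. \<Sum>m\<in>{1..k}. of_nat (degree P) *
      (if m * degree P \<le> k then lam P ^ m * euler_coeff lam (k - m * degree P) else 0))"
  proof (intro sum.cong refl)
    fix P :: "'p mod_ring poly" and m assume "P \<in> ?Pr"
    hence P: "prime P" by simp
    have "degree (P ^ m) = m * degree P" using P by (subst Polynomial.degree_power_eq) auto
    moreover have "lead_coeff (P ^ m) = 1" by (simp add: lead_coeff_power prime_monic[OF P])
    ultimately show "(\<Sum>g\<in>monics k. of_nat (degree P) * (if P ^ m dvd g then lam g else 0)) =
      of_nat (degree P) * (if m * degree P \<le> k then lam P ^ m * euler_coeff lam (k - m * degree P) else 0)"
      using sum_monics_dvd[OF mult, of "P ^ m" k] by (simp add: lam_pow flip: sum_distrib_left)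
  qed
  also have "\<dots> = (\<Sum>(P, m)\<in>?Pr \<times> {1..k}. of_nat (degree P) *
      (if m * degree P \<le> k then lam P ^ m * euler_coeff lam (k - m * degree P) else 0))"
    by (rule sum.cartesian_product)
  also have "\<dots> = (\<Sum>(P, m)\<in>{(P, m). P \<in> ?Pr \<and> m \<in> {1..k} \<and> m * degree P \<le> k}. of_nat (degree P) *
      (lam P ^ m * euler_coeff lam (k - m * degree P)))"
    using fin by (intro sum.mono_neutral_cong_right) (auto split: if_splits)
  \<comment> \<open>Regrouping by \<open>j = m * degree P\<close>, the degree of the prime
    power.\<close>
  also have "\<dots> = (\<Sum>(j, P)\<in>(SIGMA j:{1..k}. {P. prime P \<and> degree P dvd j}).
      of_nat (degree P) * lam P ^ (j div degree P) * euler_coeff lam (k - j))"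
  proof (rule sum.reindex_bij_witness[of _ "\<lambda>(j, P). (P, j div degree P)" "\<lambda>(P, m). (m * degree P, P)"])
    fix a assume "a \<in> {(P, m). P \<in> ?Pr \<and> m \<in> {1..k} \<and> m * degree P \<le> k}"
    then obtain P m where a: "a = (P, m)" "prime P" "degree P \<le> k" "m \<in> {1..k}" "m * degree P \<le> k"
      by auto
    have "degree P > 0" using prime_degree_pos a by blast
    with a show "(case case a of (P, m) \<Rightarrow> (m * degree P, P) of (j, P) \<Rightarrow> (P, j div degree P)) = a"
      "(case a of (P, m) \<Rightarrow> (m * degree P, P)) \<in> (SIGMA j:{1..k}. {P. prime P \<and> degree P dvd j})"
      "(case case a of (P, m) \<Rightarrow> (m * degree P, P) of (j, P) \<Rightarrow>
        of_nat (degree P) * lam P ^ (j div degree P) * euler_coeff lam (k - j)) =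
       (case a of (P, m) \<Rightarrow> of_nat (degree P) * (lam P ^ m * euler_coeff lam (k - m * degree P)))"
      by auto
  next
    fix b assume "b \<in> (SIGMA j:{1..k}. {P :: 'p mod_ring poly. prime P \<and> degree P dvd j})"
    then obtain j and P :: "'p mod_ring poly" where b: "b = (j, P)" "prime P" "degree P dvd j" "1 \<le> j" "j \<le> k"
      by auto
    have "degree P > 0" using prime_degree_pos b by blast
    moreover have "degree P \<le> k" using b dvd_imp_le[of "degree P" j] by auto
    moreover have "j div degree P \<le> k" using b by (meson div_le_dividend le_trans)
    moreover have "j div degree P \<ge> 1" using b calculation by (auto simp: Suc_le_eq div_greater_zero_iff dvd_imp_le)
    ultimately show "(case case b of (j, P) \<Rightarrow> (P, j div degree P) of (P, m) \<Rightarrow> (m * degree P, P)) = b"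
      "(case b of (j, P) \<Rightarrow> (P, j div degree P)) \<in> {(P, m). P \<in> ?Pr \<and> m \<in> {1..k} \<and> m * degree P \<le> k}"
      using b by auto
  qed
  also have "\<dots> = (\<Sum>j\<in>{1..k}. \<Sum>P | prime P \<and> degree P dvd j.
      of_nat (degree P) * lam P ^ (j div degree P) * euler_coeff lam (k - j))"
    by (rule sum.Sigma[symmetric]) (auto intro: finite_primes_dvd)
  also have "\<dots> = (\<Sum>j\<in>{1..k}. euler_power_sum lam j * euler_coeff lam (k - j))"
    by (simp add: euler_power_sum_def sum_distrib_right)
  finally show ?thesis .
qed

section \<open>Newton's identities and the reciprocal roots of a complex polynomial\<close>

definition recip_poly :: "complex list \<Rightarrow> complex poly" where
  "recip_poly as = (\<Prod>\<alpha>\<leftarrow>as. [:1, -\<alpha>:])"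

text \<open>Logarithmic derivative, factor by factor: \<open>1 - \<alpha> X\<close> contributes
  minus the sum of \<open>\<alpha>^n X^n\<close> over \<open>n \<ge> 1\<close>.\<close>

lemma newton_recip_poly_fps:
  "fps_X * fps_deriv (fps_of_poly (recip_poly as)) =
     Abs_fps (\<lambda>n. if n = 0 then 0 else - (\<Sum>\<alpha>\<leftarrow>as. \<alpha> ^ n)) * fps_of_poly (recip_poly as)"
proof (induction as)
  case Nil
  have "Abs_fps (\<lambda>n. if n = 0 then 0 else - (\<Sum>\<alpha>\<leftarrow>[]. \<alpha> ^ n)) = (0 :: complex fps)"
    by (intro fps_ext) simp
  thus ?case by (simp add: recip_poly_def)
next
  case (Cons \<alpha> as)
  define B where "B = fps_of_poly (recip_poly as)"
  define G where "G = Abs_fps (\<lambda>n. if n = 0 then 0 else - (\<Sum>\<alpha>\<leftarrow>as. \<alpha> ^ n))"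
  define g where "g = Abs_fps (\<lambda>n. if n = 0 then 0 else \<alpha> ^ n)"
  define L where "L = 1 - fps_const \<alpha> * fps_X"
  have L: "fps_of_poly (recip_poly (\<alpha> # as)) = L * B"
    by (simp add: recip_poly_def fps_of_poly_mult fps_of_poly_pCons B_def L_def algebra_simps)
  have gL: "g * L = fps_const \<alpha> * fps_X"
  proof (rule fps_ext)
    fix n
    have "fps_nth (g * L) n = fps_nth (g - fps_const \<alpha> * (fps_X * g)) n"
      by (simp add: L_def algebra_simps)
    also have "\<dots> = fps_nth (fps_const \<alpha> * fps_X) n"
      by (cases n) (auto simp: g_def fps_X_nth)
    finally show "fps_nth (g * L) n = fps_nth (fps_const \<alpha> * fps_X) n" .
  qed
  have G': "Abs_fps (\<lambda>n. if n = 0 then 0 else - (\<Sum>\<alpha>\<leftarrow>\<alpha> # as. \<alpha> ^ n)) = G - g"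
    by (intro fps_ext) (simp add: G_def g_def)
  have "fps_X * fps_deriv (L * B) = - (fps_const \<alpha> * fps_X) * B + L * (fps_X * fps_deriv B)"
    by (simp add: L_def algebra_simps)
  also have "\<dots> = - (g * L) * B + L * (G * B)"
    unfolding gL using Cons by (simp add: B_def G_def)
  also have "\<dots> = (G - g) * (L * B)" by (simp add: algebra_simps)
  finally show ?case unfolding L G' .
qed

text \<open>The recursion of \<open>newton_euler\<close>, with minus the power sums of
  \<open>as\<close> in place of \<open>euler_power_sum\<close>; comparing the two recursions
  identifies these sequences.\<close>

lemma newton_recip_poly:
  "of_nat k * coeff (recip_poly as) k =
    (\<Sum>j\<in>{1..k}. - (\<Sum>\<alpha>\<leftarrow>as. \<alpha> ^ j) * coeff (recip_poly as) (k - j))"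
proof -
  have "of_nat k * coeff (recip_poly as) k = fps_nth (fps_X * fps_deriv (fps_of_poly (recip_poly as))) k"
    by (cases k) auto
  also have "\<dots> = (\<Sum>j=0..k. (if j = 0 then 0 else - (\<Sum>\<alpha>\<leftarrow>as. \<alpha> ^ j)) * coeff (recip_poly as) (k - j))"
    unfolding newton_recip_poly_fps by (simp add: fps_mult_nth)
  also have "\<dots> = (\<Sum>j\<in>{1..k}. - (\<Sum>\<alpha>\<leftarrow>as. \<alpha> ^ j) * coeff (recip_poly as) (k - j))"
    by (intro sum.mono_neutral_cong_right) auto
  finally show ?thesis .
qed

lemma recip_poly_exists:
  fixes p :: "complex poly"
  assumes "coeff p 0 = 1"
  obtains as where "length as = degree p" "p = recip_poly as"
proof -
  have p0: "p \<noteq> 0" using assms by auto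
  obtain A where A: "size A = degree p" "p = smult (lead_coeff p) (\<Prod>x\<in>#A. [:- x, 1:])"
    using alg_closed_imp_factorization[OF p0] by blast
  obtain xs where xs: "A = mset xs" by (metis ex_mset)
  have "poly p 0 = 1" using assms by (simp add: poly_0_coeff_0)
  hence "0 \<notin># A" by (subst (asm) A(2)) (auto simp: poly_prod_mset dest!: multi_member_split)
  hence nz: "0 \<notin> set xs" by (simp add: xs)
  have "\<exists>c. (\<Prod>x\<leftarrow>xs. [:- x, 1:]) = smult c (recip_poly (map inverse xs))"
    using nz
  proof (induction xs)
    case Nil
    show ?case by (auto simp: recip_poly_def intro!: exI[of _ 1])
  next
    case (Cons x xs)
    then obtain c where c: "(\<Prod>x\<leftarrow>xs. [:- x, 1:]) = smult c (recip_poly (map inverse xs))" by auto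
    have "[:- x, 1:] = smult (- x) [:1, - inverse x:]" using Cons by auto
    hence "(\<Prod>x\<leftarrow>x # xs. [:- x, 1:]) = smult (- x) [:1, - inverse x:] * smult c (recip_poly (map inverse xs))"
      using c by (simp only: list.map prod_list.Cons)
    also have "\<dots> = smult (- x * c) (recip_poly (map inverse (x # xs)))"
      unfolding recip_poly_def by (simp only: list.map prod_list.Cons mult_smult_left mult_smult_right smult_smult mult.commute)
    finally show ?case by blast
  qed
  then obtain c where "(\<Prod>x\<leftarrow>xs. [:- x, 1:]) = smult c (recip_poly (map inverse xs))" by blast
  hence p: "p = smult (lead_coeff p * c) (recip_poly (map inverse xs))"
    by (subst A(2)) (simp add: xs flip: prod_mset_prod_list)
  have "poly (recip_poly as) 0 = 1" for as by (induction as) (auto simp: recip_poly_def)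
  hence "lead_coeff p * c = 1" using \<open>poly p 0 = 1\<close> by (subst (asm) p) simp
  with p have "p = recip_poly (map inverse xs)" by simp
  moreover have "length (map inverse xs) = degree p" using A(1) xs by simp
  ultimately show ?thesis using that by blast
qed

text \<open>An entry \<open>u\<close> of the closed unit disc other than 1 has geometric partial
  sums of norm at most \<open>2 / norm (u - 1)\<close>, while each entry equal to 1 contributes
  exactly \<open>N\<close>.\<close>

lemma power_partial_sums_bounded:
  fixes us :: "complex list"
  assumes "\<And>u. u \<in> set us \<Longrightarrow> norm u \<le> 1"
  shows "\<exists>K. \<forall>N. norm ((\<Sum>n<N. \<Sum>u\<leftarrow>us. u ^ n) - of_nat N * of_nat (count_list us 1)) \<le> K"
  using assms
proof (induction us)
  case (Cons u us)
  then obtain K where K: "\<And>N. norm ((\<Sum>n<N. \<Sum>u\<leftarrow>us. u ^ n) - of_nat N * of_nat (count_list us 1)) \<le> K"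
    by auto
  show ?case
  proof (cases "u = 1")
    case True
    have "norm ((\<Sum>n<N. \<Sum>u\<leftarrow>u # us. u ^ n) - of_nat N * of_nat (count_list (u # us) 1)) \<le> K" for N
      using K[of N] True by (simp add: sum.distrib algebra_simps)
    thus ?thesis by blast
  next
    case False
    have "norm ((\<Sum>n<N. \<Sum>u\<leftarrow>u # us. u ^ n) - of_nat N * of_nat (count_list (u # us) 1)) \<le> 2 / norm (u - 1) + K" for N
    proof -
      have "norm (u ^ N - 1) \<le> norm (u ^ N) + norm (1 :: complex)" by (rule norm_triangle_ineq4)
      also have "\<dots> \<le> 2" using Cons.prems[of u] by (simp add: norm_power power_le_one)
      finally have "norm (\<Sum>n<N. u ^ n) \<le> 2 / norm (u - 1)"
        using False by (simp add: geometric_sum norm_divide divide_right_mono)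
      moreover have "(\<Sum>n<N. \<Sum>u\<leftarrow>u # us. u ^ n) - of_nat N * of_nat (count_list (u # us) 1) =
          (\<Sum>n<N. u ^ n) + ((\<Sum>n<N. \<Sum>u\<leftarrow>us. u ^ n) - of_nat N * of_nat (count_list us 1))"
        using False by (simp add: sum.distrib)
      ultimately show ?thesis using K[of N] norm_triangle_le add_mono by metis
    qed
    thus ?thesis by blast
  qed
qed (auto intro!: exI[of _ 0])

text \<open>Suppose the largest norm exceeds \<open>R\<close> and divide all entries by one that
  attains it, \<open>\<beta>\<close>. By hypothesis the resulting power sums are summable; but
  \<open>\<beta>\<close> has become 1, so by \<open>power_partial_sums_bounded\<close> their partial
  sums grow at least like \<open>N\<close>.\<close>

lemma power_sums_bound_imp_roots_bound:
  fixes as :: "complex list" and R C :: real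
  assumes R: "R > 0"
    and bound: "\<And>n. even n \<Longrightarrow> n \<ge> n0 \<Longrightarrow> norm (\<Sum>\<alpha>\<leftarrow>as. \<alpha> ^ n) \<le> C * R ^ n"
    and "\<alpha> \<in> set as"
  shows "norm \<alpha> \<le> R"
proof (rule ccontr)
  assume contra: "\<not> norm \<alpha> \<le> R"
  define M where "M = Max (norm ` set as)"
  have "M \<in> norm ` set as" unfolding M_def using assms(3) by (intro Max_in) auto
  then obtain \<beta> where \<beta>: "\<beta> \<in> set as" "norm \<beta> = M" by auto
  have le_M: "norm \<gamma> \<le> M" if "\<gamma> \<in> set as" for \<gamma> unfolding M_def using that by (intro Max_ge) auto
  have MR: "M > R" using le_M[OF assms(3)] contra by simp
  hence M0: "M > 0" "\<beta> \<noteq> 0" using R \<beta> by auto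
  \<comment> \<open>Squares, because the hypothesis covers even exponents only.\<close>
  define us where "us = map (\<lambda>\<gamma>. (\<gamma> / \<beta>) ^ 2) as"
  have "norm u \<le> 1" if u: "u \<in> set us" for u
  proof -
    obtain \<gamma> where \<gamma>: "\<gamma> \<in> set as" "u = (\<gamma> / \<beta>) ^ 2" using u by (auto simp: us_def)
    have "norm (\<gamma> / \<beta>) \<le> 1" using le_M[OF \<gamma>(1)] M0 \<beta> by (simp add: norm_divide)
    thus ?thesis by (simp add: \<gamma> norm_power power_le_one)
  qed
  then obtain K where K: "\<And>N. norm ((\<Sum>n<N. \<Sum>u\<leftarrow>us. u ^ n) - of_nat N * of_nat (count_list us 1)) \<le> K"
    using power_partial_sums_bounded by blast
  have "1 \<in> set us" using \<beta>(1) M0 by (force simp: us_def)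
  hence cnt: "count_list us 1 \<ge> 1" using count_notin by (metis One_nat_def Suc_leI count_list_0_iff gr0I)
  define T where "T n = (\<Sum>u\<leftarrow>us. u ^ n)" for n
  define \<rho> where "\<rho> = (R / M) ^ 2"
  have \<rho>: "0 \<le> \<rho>" "\<rho> < 1"
  proof -
    have "R / M < 1" "0 \<le> R / M" using MR R by auto
    thus "0 \<le> \<rho>" "\<rho> < 1" unfolding \<rho>_def by (auto simp: power_less_one_iff)
  qed
  have T: "T n = (\<Sum>\<alpha>\<leftarrow>as. \<alpha> ^ (2 * n)) / \<beta> ^ (2 * n)" for n
    unfolding T_def us_def by (induction as) (auto simp: power_divide add_divide_distrib power_mult)
  have T_le: "norm (T n) \<le> C * \<rho> ^ n" if "n \<ge> n0" for n
  proof -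
    have "norm (T n) \<le> C * R ^ (2 * n) / M ^ (2 * n)"
      unfolding T norm_divide norm_power \<beta>(2) using M0 that by (intro divide_right_mono bound) auto
    also have "\<dots> = C * \<rho> ^ n" by (simp add: \<rho>_def power_divide flip: power_mult)
    finally show ?thesis .
  qed
  have "summable (\<lambda>n. norm (T n))"
  proof (rule summable_comparison_test_ev)
    show "\<forall>\<^sub>F n in sequentially. norm (norm (T n)) \<le> C * \<rho> ^ n"
      using T_le by (auto intro: eventually_sequentiallyI)
    show "summable (\<lambda>n. C * \<rho> ^ n)" using \<rho> by (intro summable_mult summable_geometric) auto
  qed
  hence sumT: "norm (\<Sum>n<N. T n) \<le> (\<Sum>n. norm (T n))" for N
    using sum_le_suminf[of "\<lambda>n. norm (T n)" "{..<N}"] norm_sum[of T "{..<N}"] by fastforce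
  define Z where "Z = (\<Sum>n. norm (T n))"
  have "real N \<le> K + Z" for N
  proof -
    have "real N \<le> real N * real (count_list us 1)" using cnt by (simp add: mult_le_cancel_left1)
    also have "\<dots> = norm (of_nat N * of_nat (count_list us 1) :: complex)" by (simp add: norm_mult)
    also have "\<dots> \<le> norm ((\<Sum>n<N. T n) - of_nat N * of_nat (count_list us 1)) + norm (\<Sum>n<N. T n)"
      using norm_triangle_ineq4[of "\<Sum>n<N. T n" "(\<Sum>n<N. T n) - of_nat N * of_nat (count_list us 1)"] by (simp add: norm_minus_commute)
    also have "\<dots> \<le> K + Z" using K[of N] sumT[of N] by (simp add: T_def Z_def)
    finally show ?thesis .
  qed
  moreover obtain N :: nat where "real N > K + Z" using reals_Archimedean2 by blast
  ultimately show False by (meson not_le)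
qed

text \<open>With \<open>a 0 = 1\<close> the recursion determines \<open>s\<close> from
  \<open>a\<close>. So \<open>- s n\<close> is, for \<open>n \<ge> 1\<close>, the power sum of order
  \<open>n\<close> of the at most \<open>m\<close> reciprocal roots of the polynomial with
  coefficients \<open>a\<close>. The growth of \<open>s n\<close> along even \<open>n\<close> bounds
  every root, and thereby \<open>s 1\<close>.\<close>

theorem newton_power_sum_bound:
  fixes a s :: "nat \<Rightarrow> complex" and R C :: real and m :: nat
  assumes a0: "a 0 = 1" and az: "\<And>k. k > m \<Longrightarrow> a k = 0"
    and newton: "\<And>k. of_nat k * a k = (\<Sum>j\<in>{1..k}. s j * a (k - j))"
    and R: "R > 0" and bound: "\<And>n. even n \<Longrightarrow> n \<ge> n0 \<Longrightarrow> norm (s n) \<le> C * R ^ n"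
  shows "norm (s 1) \<le> real m * R"
proof -
  define p where "p = (\<Sum>k\<le>m. monom (a k) k)"
  have cp: "coeff p k = a k" for k
    by (cases "k \<le> m") (auto simp: p_def coeff_sum az)
  have dp: "degree p \<le> m" by (rule degree_le) (simp add: cp az)
  have "coeff p 0 = 1" by (simp add: cp a0)
  then obtain as where as: "length as = degree p" "p = recip_poly as" by (rule recip_poly_exists)
  have s: "s k = - (\<Sum>\<alpha>\<leftarrow>as. \<alpha> ^ k)" if "k \<ge> 1" for k
    using that
  proof (induction k rule: less_induct)
    case (less k)
    define \<sigma> where "\<sigma> j = - (\<Sum>\<alpha>\<leftarrow>as. \<alpha> ^ j)" for j
    have split: "{1..k} = insert k {1..<k}" using less by auto
    have "(\<Sum>j\<in>{1..k}. s j * a (k - j)) = (\<Sum>j\<in>{1..k}. \<sigma> j * a (k - j))"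
      using newton_recip_poly[of k as] newton[of k] by (simp add: cp \<sigma>_def flip: as(2))
    moreover have "(\<Sum>j\<in>{1..<k}. s j * a (k - j)) = (\<Sum>j\<in>{1..<k}. \<sigma> j * a (k - j))"
      by (intro sum.cong refl) (simp add: less \<sigma>_def)
    ultimately show ?case unfolding split \<sigma>_def by (simp add: a0)
  qed
  have root: "norm \<alpha> \<le> R" if "\<alpha> \<in> set as" for \<alpha>
  proof (rule power_sums_bound_imp_roots_bound[OF R _ that, of "max n0 1"])
    fix n assume "even n" "n \<ge> max n0 1"
    thus "norm (\<Sum>\<alpha>\<leftarrow>as. \<alpha> ^ n) \<le> C * R ^ n" using s[of n] bound[of n] by simp
  qed
  have "norm (\<Sum>\<alpha>\<leftarrow>as. \<alpha>) \<le> length as * R" using root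
  proof (induction as)
    case (Cons \<alpha> as)
    thus ?case using norm_triangle_ineq[of \<alpha> "sum_list as"] by (auto simp: algebra_simps) (smt (verit, best))
  qed simp
  also have "\<dots> \<le> real m * R" using dp R as(1) by (intro mult_right_mono) auto
  finally show ?thesis using s[of 1] by simp
qed

section \<open>The Stepanov--Bombieri bound\<close>

text \<open>Degree below \<open>n\<close>, stated through coefficients so that the zero polynomial
  belongs to it for \<open>n = 0\<close> too and the cardinality \<open>CARD('a) ^ n\<close> is
  right for every \<open>n\<close>.\<close>

definition polys_lt :: "nat \<Rightarrow> 'a::zero poly set" where
  "polys_lt n = {h. \<forall>i\<ge>n. coeff h i = 0}"

lemma polys_lt_Suc: "polys_lt (Suc n) = (\<lambda>(c, h). pCons c h) ` (UNIV \<times> polys_lt n)"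
proof (intro equalityI subsetI)
  fix h :: "'a poly" assume h: "h \<in> polys_lt (Suc n)"
  obtain c g where "h = pCons c g" by (cases h)
  moreover have "g \<in> polys_lt n"
    unfolding polys_lt_def
  proof safe
    fix i assume "n \<le> i"
    hence "coeff h (Suc i) = 0" using h by (simp add: polys_lt_def)
    thus "coeff g i = 0" using \<open>h = pCons c g\<close> by simp
  qed
  ultimately show "h \<in> (\<lambda>(c, h). pCons c h) ` (UNIV \<times> polys_lt n)" by auto
qed (auto simp: polys_lt_def coeff_pCons split: nat.splits)

lemma card_polys_lt: "finite (polys_lt n :: 'a::{finite,zero} poly set) \<and> card (polys_lt n :: 'a poly set) = CARD('a) ^ n"
proof (induction n)
  case 0
  have "polys_lt 0 = {0 :: 'a poly}" by (auto simp: polys_lt_def poly_eq_iff)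
  thus ?case by simp
next
  case (Suc n)
  have inj: "inj_on (\<lambda>(c, h). pCons c h :: 'a poly) A" for A by (auto simp: inj_on_def)
  show ?case unfolding polys_lt_Suc using Suc by (simp add: card_image[OF inj] card_cartesian_product)
qed

lemma polys_lt_degree: "h \<in> polys_lt n \<Longrightarrow> n > 0 \<Longrightarrow> degree h \<le> n - 1"
  by (intro degree_le) (auto simp: polys_lt_def)

lemma polys_ltI: "degree h < n \<Longrightarrow> h \<in> polys_lt n"
  by (auto simp: polys_lt_def coeff_eq_0)

lemma polys_lt_diff: "g \<in> polys_lt n \<Longrightarrow> h \<in> polys_lt n \<Longrightarrow> g - h \<in> (polys_lt n :: 'a::ab_group_add poly set)"
  by (auto simp: polys_lt_def)

lemma polys_lt_sum: "(\<And>i. i \<in> I \<Longrightarrow> h i \<in> polys_lt n) \<Longrightarrow> sum h I \<in> (polys_lt n :: 'a::comm_monoid_add poly set)"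
  by (auto simp: polys_lt_def coeff_sum)

lemma irreducible_linear: "irreducible ([:c, 1:] :: 'p::prime_card mod_ring poly)"
proof (rule Factorial_Ring.irreducibleI)
  show "\<not> [:c, 1:] dvd (1 :: 'p mod_ring poly)" by (subst is_unit_iff_degree) auto
next
  fix A B :: "'p mod_ring poly" assume AB: "[:c, 1:] = A * B"
  hence nz: "A \<noteq> 0" "B \<noteq> 0" by auto
  have "degree A + degree B = degree [:c, 1:]" unfolding AB using nz by (simp add: degree_mult_eq)
  hence "degree A = 0 \<or> degree B = 0" by auto
  thus "A dvd 1 \<or> B dvd 1" using nz by (auto simp: is_unit_iff_degree)
qed simp

text \<open>Here \<open>e * d = s - 1\<close>, and \<open>e * (s + 1)\<close> is the norm exponent
  for the field with \<open>s^2\<close> elements. \<open>K\<close> bounds the powers of the linear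
  factor in the auxiliary polynomial; its summand 3 lets the unknowns outnumber the equations in
  \<open>dimension_count\<close>.\<close>

locale stepanov =
  fixes f f1 :: "'p::prime_card mod_ring poly" and c1 a :: "'p mod_ring" and \<mu> m s e d K :: nat
  assumes f: "f = [:- c1, 1:] * f1" and f1: "poly f1 c1 \<noteq> 0"
    and a: "a \<noteq> 0" and p: "CARD('p) \<ge> 3" and \<mu>: "\<mu> > 0"
    and m: "m = degree f" and s: "s = CARD('p) ^ \<mu>" and e: "e = geo CARD('p) \<mu>"
    and d: "d = CARD('p) - 1" and K: "K = e + m + 3" and large: "s > m + 3"
begin

definition l :: "'p mod_ring poly" where "l = [:- c1, 1:]"

lemma f_l: "f = l * f1" by (simp only: f l_def)

lemma degree_l_power: "degree (l ^ n) = n"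
  by (simp add: l_def degree_linear_power)

text \<open>What \<open>aux_poly H\<close> turns into, at the points to be counted, when it is
  raised to the power \<open>s\<close> and multiplied by \<open>f ^ (e * (d - 1))\<close>: at such
  points \<open>H(x)^s = H(x^s)\<close>, \<open>l(x)^(s * s) = l(x)\<close> and
  \<open>f(x)^(e * (s + 1)) = a\<close>. The index \<open>i\<close> encodes the pair
  \<open>(i div d, i mod d)\<close>.\<close>

definition aux_rel :: "(nat \<Rightarrow> 'p mod_ring poly) \<Rightarrow> 'p mod_ring poly" where
  "aux_rel H = (\<Sum>i<d * K. smult (a ^ (i mod d))
     (pcompose (H i) (monom 1 s) * l ^ (i div d) * f ^ (e * (d - 1 - i mod d))))"

definition aux_poly :: "(nat \<Rightarrow> 'p mod_ring poly) \<Rightarrow> 'p mod_ring poly" where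
  "aux_poly H = (\<Sum>i<d * K. H i * l ^ (s * (i div d)) * f ^ (e * (i mod d)))"

lemma ed: "e * d = s - 1" "e * d + 1 = s"
proof -
  show "e * d = s - 1" using geo_mult[of "CARD('p)" \<mu>] p by (simp add: e d s mult.commute)
  thus "e * d + 1 = s" by (simp add: s)
qed

lemma e_pos: "e > 0" and d_ge: "d \<ge> 2"
proof -
  show "d \<ge> 2" using p by (simp add: d)
  show "e > 0" using ed(2) large by (cases e) auto
qed

lemma l_nz: "l \<noteq> 0" by (simp add: l_def)

lemma f_nz: "f \<noteq> 0" using f1 l_nz by (auto simp: f_l)

lemma aux_rel_polys_lt:
  assumes "\<And>i. i < d * K \<Longrightarrow> H i \<in> polys_lt e"
  shows "aux_rel H \<in> polys_lt (s * e + K + s * m)"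
  unfolding aux_rel_def
proof (rule polys_lt_sum)
  fix i assume i: "i \<in> {..<d * K}"
  have K0: "K > 0" by (simp add: K)
  have "i div d < K" using i by (simp add: mult.commute less_mult_imp_div_less)
  have "degree (H i) \<le> e - 1" using assms i e_pos by (intro polys_lt_degree) auto
  hence "degree (pcompose (H i) (monom 1 s)) \<le> (e - 1) * s"
    using degree_pcompose_le[of "H i" "monom 1 s"] mult_le_mono1[of "degree (H i)" "e - 1" s]
    by (simp add: degree_monom_eq)
  moreover have "degree (f ^ (e * (d - 1 - i mod d))) \<le> s * m"
  proof -
    have "e * (d - 1 - i mod d) \<le> e * d" by simp
    also have "\<dots> \<le> s" using ed(2) by simp
    finally show ?thesis by (simp add: Polynomial.degree_power_eq f_nz m)
  qed
  moreover have "degree (l ^ (i div d)) = i div d" by (simp add: degree_l_power)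
  moreover have "(e - 1) * s < s * e" using e_pos large by (cases e) auto
  ultimately have "degree (pcompose (H i) (monom 1 s)) + degree (l ^ (i div d)) + degree (f ^ (e * (d - 1 - i mod d)))
    < s * e + K + s * m"
    using \<open>i div d < K\<close> by linarith
  moreover have "degree (smult (a ^ (i mod d)) (pcompose (H i) (monom 1 s) * l ^ (i div d) * f ^ (e * (d - 1 - i mod d))))
    \<le> degree (pcompose (H i) (monom 1 s)) + degree (l ^ (i div d)) + degree (f ^ (e * (d - 1 - i mod d)))"
    by (rule order_trans[OF degree_smult_le], rule order_trans[OF degree_mult_le]) (intro add_mono degree_mult_le order_refl)
  ultimately show "smult (a ^ (i mod d)) (pcompose (H i) (monom 1 s) * l ^ (i div d) * f ^ (e * (d - 1 - i mod d)))
      \<in> polys_lt (s * e + K + s * m)"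
    by (intro polys_ltI) linarith
qed

lemma aux_rel_diff: "aux_rel (\<lambda>i. G i - H i) = aux_rel G - aux_rel H"
  by (simp add: aux_rel_def pcompose_diff algebra_simps smult_diff_right sum_subtractf)

text \<open>The left side is the dimension of a space containing every \<open>aux_rel H\<close>, the
  right side the number of free coefficients of \<open>H\<close>. By \<open>e * d = s - 1\<close>
  they differ by \<open>3 s - 6 - 2 e - 2 m\<close>, which is positive by
  \<open>2 e \<le> s - 1\<close> and \<open>s > m + 3\<close>.\<close>

lemma dimension_count: "s * e + K + s * m < e * (d * K)"
proof -
  have "2 * e \<le> e * d" using d_ge by simp
  hence "2 * e + 1 \<le> s" using ed(2) by linarith
  hence 1: "2 * int e \<le> int s - 1" by linarith
  have "int (e * (d * K)) = (int s - 1) * int K"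
    by (simp add: algebra_simps flip: ed(2))
  also have "\<dots> - int (s * e + K + s * m) = 3 * int s - 6 - 2 * int e - 2 * int m"
    by (simp add: K algebra_simps)
  also have "\<dots> > 0" using 1 large by linarith
  finally show ?thesis by linarith
qed

text \<open>Pigeonhole in place of linear algebra: over a finite field both spaces are finite sets,
  so \<open>aux_rel\<close> takes some value twice, and the difference of the two arguments lies in
  its kernel.\<close>

lemma ex_kernel:
  obtains H where "\<And>i. i < d * K \<Longrightarrow> H i \<in> polys_lt e" "\<exists>i<d * K. H i \<noteq> 0" "aux_rel H = 0"
proof -
  let ?D = "PiE {..<d * K} (\<lambda>_. polys_lt e :: 'p mod_ring poly set)"
  let ?R = "polys_lt (s * e + K + s * m) :: 'p mod_ring poly set"
  have "card ?R = CARD('p) ^ (s * e + K + s * m)" using card_polys_lt[where 'a = "'p mod_ring"] by simp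
  also have "\<dots> < CARD('p) ^ (e * (d * K))" using dimension_count p by (intro power_strict_increasing) auto
  also have "\<dots> = card ?D"
    using card_polys_lt[where 'a = "'p mod_ring"] by (simp add: card_PiE power_mult)
  finally have less: "card ?R < card ?D" .
  have "\<not> inj_on aux_rel ?D"
  proof
    assume "inj_on aux_rel ?D"
    moreover have "aux_rel ` ?D \<subseteq> ?R" by (auto intro!: aux_rel_polys_lt)
    ultimately have "card ?D \<le> card ?R"
      using card_polys_lt[where 'a = "'p mod_ring"] by (intro card_inj_on_le) auto
    thus False using less by simp
  qed
  then obtain G H where GH: "G \<in> ?D" "H \<in> ?D" "aux_rel G = aux_rel H" "G \<noteq> H"
    by (auto simp: inj_on_def)
  show ?thesis
  proof (rule that[of "\<lambda>i. G i - H i"])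
    show "G i - H i \<in> polys_lt e" if "i < d * K" for i
      using GH that by (intro polys_lt_diff) auto
    show "\<exists>i<d * K. G i - H i \<noteq> 0"
    proof (rule ccontr)
      assume "\<not> ?thesis"
      hence "G = H" using GH(1,2) by (intro PiE_ext[OF GH(1,2)]) auto
      thus False using GH by simp
    qed
    show "aux_rel (\<lambda>i. G i - H i) = 0" using GH by (simp add: aux_rel_diff)
  qed
qed

text \<open>The root \<open>c1\<close> of \<open>f\<close> is simple, so the term with index
  \<open>i\<close> is divisible by \<open>l\<close> to the power
  \<open>w i = e * i + i div d\<close>; if \<open>H i\<close> is nonzero, the exact power is below
  \<open>w i + e\<close>, since \<open>degree (H i) < e\<close>. As \<open>w\<close> grows by at
  least \<open>e\<close> from one index to the next, the first nonzero term cannot be cancelled by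
  later ones.\<close>

lemma aux_poly_nz:
  assumes H: "\<And>i. i < d * K \<Longrightarrow> H i \<in> polys_lt e" and ex: "\<exists>i<d * K. H i \<noteq> 0"
  shows "aux_poly H \<noteq> 0"
proof
  assume zero: "aux_poly H = 0"
  define w where "w i = e * i + i div d" for i
  define t where "t i = H i * l ^ (s * (i div d)) * f ^ (e * (i mod d))" for i
  have t: "t i = l ^ w i * (H i * f1 ^ (e * (i mod d)))" for i
  proof -
    have "s * (i div d) + e * (i mod d) = e * (d * (i div d) + i mod d) + i div d"
      unfolding ed(2)[symmetric] by (simp only: algebra_simps mult_1)
    hence "w i = s * (i div d) + e * (i mod d)" by (simp only: w_def mult_div_mod_eq)
    thus ?thesis by (simp add: t_def f_l power_mult_distrib power_add mult_ac)
  qed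
  define i0 where "i0 = (LEAST i. i < d * K \<and> H i \<noteq> 0)"
  have i0: "i0 < d * K" "H i0 \<noteq> 0" using LeastI_ex[of "\<lambda>i. i < d * K \<and> H i \<noteq> 0"] ex by (auto simp: i0_def)
  have least: "H i = 0" if "i < i0" for i
    using not_less_Least[of i "\<lambda>i. i < d * K \<and> H i \<noteq> 0"] that i0 by (auto simp: i0_def)
  have "aux_poly H = t i0 + (\<Sum>i\<in>{..<d * K} - {i0}. t i)"
    unfolding aux_poly_def t_def using i0 by (intro sum.remove) auto
  hence "t i0 = - (\<Sum>i\<in>{..<d * K} - {i0}. t i)" using zero by (simp add: eq_neg_iff_add_eq_0)
  moreover have "l ^ (w i0 + e) dvd (\<Sum>i\<in>{..<d * K} - {i0}. t i)"
  proof (rule dvd_sum)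
    fix i assume i: "i \<in> {..<d * K} - {i0}"
    show "l ^ (w i0 + e) dvd t i"
    proof (cases "i < i0")
      case False
      hence "Suc i0 \<le> i" using i by auto
      hence "e * Suc i0 \<le> e * i" "i0 div d \<le> i div d" by (auto intro: div_le_mono simp del: mult_Suc_right)
      hence "w i0 + e \<le> w i" by (simp add: w_def)
      hence "l ^ (w i0 + e) dvd l ^ w i" by (rule le_imp_power_dvd)
      thus ?thesis unfolding t by (rule dvd_mult2)
    qed (simp add: t least)
  qed
  ultimately have "l ^ w i0 * l ^ e dvd l ^ w i0 * (H i0 * f1 ^ (e * (i0 mod d)))"
    by (simp add: t power_add)
  hence dvd: "l ^ e dvd H i0 * f1 ^ (e * (i0 mod d))" using l_nz by (subst (asm) dvd_mult_cancel_left) auto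
  have "coprime l f1"
  proof (rule prime_imp_coprime)
    show "prime l" by (intro monic_irreducible_imp_prime) (auto simp: l_def irreducible_linear)
    show "\<not> l dvd f1" using f1 by (simp add: poly_eq_0_iff_dvd l_def)
  qed
  hence "coprime (l ^ e) (f1 ^ (e * (i0 mod d)))" by simp
  with dvd have "l ^ e dvd H i0" by (simp add: coprime_dvd_mult_left_iff)
  hence "degree (l ^ e) \<le> degree (H i0)" using i0 by (intro dvd_imp_degree_le)
  moreover have "degree (H i0) \<le> e - 1" using H[OF i0(1)] e_pos by (rule polys_lt_degree)
  ultimately show False using e_pos by (simp add: degree_l_power)
qed

text \<open>The main term \<open>e * (s + 1)\<close> is the size of a fibre of the norm map over a
  nonzero element, hence the expected number of points; the rest is an error of order
  \<open>s\<close>.\<close>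

lemma degree_aux_poly:
  assumes H: "\<And>i. i < d * K \<Longrightarrow> H i \<in> polys_lt e"
  shows "degree (aux_poly H) \<le> e * (s + 1) + s * (2 * m + 3)"
  unfolding aux_poly_def
proof (rule degree_sum_le)
  fix i assume i: "i \<in> {..<d * K}"
  have "i div d \<le> K" using i by (simp add: mult.commute less_mult_imp_div_less less_imp_le)
  hence "s * (i div d) \<le> s * K" by simp
  moreover have "degree (H i) \<le> e - 1" using H i e_pos by (intro polys_lt_degree) auto
  moreover have "degree (f ^ (e * (i mod d))) \<le> s * m"
  proof -
    have "e * (i mod d) \<le> e * d" using d_ge by (intro mult_le_mono2) (auto intro: less_imp_le)
    also have "\<dots> \<le> s" using ed(2) by simp
    finally show ?thesis by (simp add: Polynomial.degree_power_eq f_nz m)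
  qed
  moreover have "degree (l ^ (s * (i div d))) = s * (i div d)" by (simp add: degree_l_power)
  moreover have "degree (H i * l ^ (s * (i div d)) * f ^ (e * (i mod d))) \<le>
      degree (H i) + degree (l ^ (s * (i div d))) + degree (f ^ (e * (i mod d)))"
    by (rule order_trans[OF degree_mult_le]) (intro add_mono degree_mult_le order_refl)
  ultimately have "degree (H i * l ^ (s * (i div d)) * f ^ (e * (i mod d))) \<le> e + s * K + s * m" by linarith
  also have "\<dots> = e * (s + 1) + s * (2 * m + 3)" by (simp add: K algebra_simps)
  finally show "degree (H i * l ^ (s * (i div d)) * f ^ (e * (i mod d))) \<le> e * (s + 1) + s * (2 * m + 3)" .
qed auto

lemma geo_2: "geo CARD('p) (2 * \<mu>) = e * (s + 1)"
proof -
  have "geo CARD('p) (\<mu> + k) = geo CARD('p) \<mu> + s * geo CARD('p) k" for k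
    by (induction k) (simp_all add: geo_def s power_add algebra_simps)
  from this[of \<mu>] show ?thesis by (simp only: e mult_2) (simp add: algebra_simps)
qed

lemma aux_poly_root:
  assumes rel: "aux_rel H = 0"
    and x: "x \<in> frobenius_fixed (2 * \<mu>)" "ac_eval f x ^ geo CARD('p) (2 * \<mu>) = to_ac a"
  shows "ac_eval (aux_poly H) x = 0"
proof -
  define y where "y = ac_eval f x"
  define z where "z = x - to_ac c1"
  have ya: "y ^ (e * (s + 1)) = to_ac a" using x(2) by (simp add: geo_2 y_def)
  hence y0: "y \<noteq> 0" using a e_pos by (auto simp: power_0_left)
  have ss: "s * s = CARD('p) ^ (2 * \<mu>)" by (simp add: s mult_2 power_add)
  have z: "z ^ (s * s) = z"
    using x(1) unfolding ss z_def frobenius_diff frobenius_to_ac by (simp add: frobenius_fixed_def)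
  have ev_l: "ac_eval l x = z" by (simp add: z_def l_def to_ac.base.map_poly_pCons_hom)
  have frob: "(\<Sum>i\<in>I. g i) ^ s = (\<Sum>i\<in>I. g i ^ s)" for I :: "nat set" and g :: "_ \<Rightarrow> 'p mod_ring alg_closure"
    unfolding s by (rule frobenius_sum)
  have "y ^ (e * (d - 1)) * ac_eval (aux_poly H) x ^ s =
     (\<Sum>i<d * K. y ^ (e * (d - 1)) * (ac_eval (H i) x * z ^ (s * (i div d)) * y ^ (e * (i mod d))) ^ s)"
    by (simp add: aux_poly_def to_ac.hom_sum to_ac.hom_mult to_ac.hom_power poly_sum ev_l frob
        sum_distrib_left flip: y_def)
  also have "\<dots> = (\<Sum>i<d * K. to_ac (a ^ (i mod d)) * (ac_eval (H i) (x ^ s) * z ^ (i div d) * y ^ (e * (d - 1 - i mod d))))"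
  proof (rule sum.cong[OF refl])
    fix i assume "i \<in> {..<d * K}"
    define j where "j = i mod d"
    have j: "j \<le> d - 1" using mod_less_divisor[of d i] d_ge unfolding j_def by linarith
    have "(z ^ (s * (i div d))) ^ s = (z ^ (s * s)) ^ (i div d)" by (simp add: mult_ac flip: power_mult)
    hence z': "(z ^ (s * (i div d))) ^ s = z ^ (i div d)" by (simp add: z)
    \<comment> \<open>The exponents of \<open>y\<close> are regrouped around the norm
      \<open>y ^ (e * (s + 1)) = a\<close>.\<close>
    have "e * (d - 1) + e * j * s = e * (d - 1 - j) + e * (s + 1) * j"
    proof -
      obtain k where "d - 1 = j + k" using j le_Suc_ex by blast
      thus ?thesis by (simp add: algebra_simps)
    qed
    hence "y ^ (e * (d - 1)) * (y ^ (e * j)) ^ s = y ^ (e * (d - 1 - j)) * (y ^ (e * (s + 1))) ^ j"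
      by (simp flip: power_mult power_add)
    hence y': "y ^ (e * (d - 1)) * (y ^ (e * j)) ^ s = y ^ (e * (d - 1 - j)) * to_ac (a ^ j)"
      by (simp only: ya to_ac_power)
    have H': "ac_eval (H i) x ^ s = ac_eval (H i) (x ^ s)" unfolding s by (rule frobenius_ac_eval)
    have "y ^ (e * (d - 1)) * (ac_eval (H i) x * z ^ (s * (i div d)) * y ^ (e * j)) ^ s =
      ac_eval (H i) x ^ s * (z ^ (s * (i div d))) ^ s * (y ^ (e * (d - 1)) * (y ^ (e * j)) ^ s)"
      by (simp only: power_mult_distrib mult_ac)
    also have "\<dots> = to_ac (a ^ j) * (ac_eval (H i) (x ^ s) * z ^ (i div d) * y ^ (e * (d - 1 - j)))"
      unfolding H' z' y' by (simp only: mult_ac)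
    finally show "y ^ (e * (d - 1)) * (ac_eval (H i) x * z ^ (s * (i div d)) * y ^ (e * (i mod d))) ^ s =
      to_ac (a ^ (i mod d)) * (ac_eval (H i) (x ^ s) * z ^ (i div d) * y ^ (e * (d - 1 - i mod d)))"
      by (simp only: j_def)
  qed
  also have "\<dots> = ac_eval (aux_rel H) x"
    by (simp add: aux_rel_def to_ac.hom_sum to_ac.hom_mult to_ac.hom_power poly_sum ev_l
        to_ac.base.map_poly_hom_smult to_ac.base.map_poly_pcompose poly_pcompose poly_monom flip: y_def)
  also have "\<dots> = 0" by (simp add: rel)
  finally show ?thesis using y0 by (simp add: power_eq_0_iff)
qed

theorem card_bound:
  "card {x \<in> frobenius_fixed (2 * \<mu>). ac_eval f x ^ geo CARD('p) (2 * \<mu>) = to_ac a}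
     \<le> geo CARD('p) (2 * \<mu>) + s * (2 * m + 3)"
proof -
  obtain H where H: "\<And>i. i < d * K \<Longrightarrow> H i \<in> polys_lt e" "\<exists>i<d * K. H i \<noteq> 0" "aux_rel H = 0"
    by (rule ex_kernel) blast
  let ?W = "map_poly to_ac (aux_poly H)"
  have W0: "?W \<noteq> 0" using aux_poly_nz[OF H(1,2)] by simp
  have "card {x \<in> frobenius_fixed (2 * \<mu>). ac_eval f x ^ geo CARD('p) (2 * \<mu>) = to_ac a} \<le> card {x. poly ?W x = 0}"
    using aux_poly_root[OF H(3)] by (intro card_mono poly_roots_finite W0) auto
  also have "\<dots> \<le> degree (aux_poly H)" using card_poly_roots_bound[OF W0] by simp
  also have "\<dots> \<le> geo CARD('p) (2 * \<mu>) + s * (2 * m + 3)"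
    using degree_aux_poly[OF H(1)] by (simp add: geo_2)
  finally show ?thesis .
qed

end

section \<open>The Weil bound for character sums\<close>

locale weil_sum =
  fixes \<psi> :: "'p::prime_card mod_ring \<Rightarrow> complex" and I :: "'p mod_ring set"
    and ex :: "'p mod_ring \<Rightarrow> nat" and c1 u :: "'p mod_ring"
  assumes \<psi>_mult: "\<And>a b. \<psi> (a * b) = \<psi> a * \<psi> b" and \<psi>_0: "\<psi> 0 = 0" and \<psi>_1: "\<psi> 1 = 1"
    and u: "u \<noteq> 0" "\<psi> u \<noteq> 1" and p3: "CARD('p) \<ge> 3"
    and c1: "c1 \<in> I" "ex c1 = 1" and ex: "\<And>c. c \<in> I \<Longrightarrow> ex c \<ge> 1"
begin

definition lam :: "'p mod_ring poly \<Rightarrow> complex" where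
  "lam g = (\<Prod>c\<in>I. \<psi> (poly g c) ^ ex c)"

text \<open>The values of a prime \<open>P\<close> at the points \<open>c\<close>, which enter
  \<open>lam P\<close>, are norms of \<open>x - c\<close> at a root \<open>x\<close> of
  \<open>P\<close>; \<open>f\<close> collects these linear factors with their exponents.\<close>

definition f :: "'p mod_ring poly" where
  "f = (\<Prod>c\<in>I. [:- c, 1:] ^ ex c)"

definition f1 :: "'p mod_ring poly" where
  "f1 = (\<Prod>c\<in>I - {c1}. [:- c, 1:] ^ ex c)"

lemma fin_I [simp]: "finite I" by (rule finite)

lemma lam_mult: "lam (A * B) = lam A * lam B"
  by (simp add: lam_def \<psi>_mult power_mult_distrib prod.distrib)

lemma lam_1: "lam 1 = 1" by (simp add: lam_def \<psi>_1)

lemma \<psi>_power: "\<psi> (a ^ n) = \<psi> a ^ n"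
  by (induction n) (simp_all add: \<psi>_1 \<psi>_mult)

lemma \<psi>_prod: "finite J \<Longrightarrow> \<psi> (\<Prod>j\<in>J. h j) = (\<Prod>j\<in>J. \<psi> (h j))"
  by (induction J rule: finite_induct) (simp_all add: \<psi>_1 \<psi>_mult)

lemma norm_\<psi>: "norm (\<psi> a) \<le> 1"
proof (cases "a = 0")
  case False
  have "a * a ^ (CARD('p) - 1) = a * 1"
    using finite_field_power_card_eq_same[of a] p3 by (simp flip: power_Suc)
  hence "a ^ (CARD('p) - 1) = 1" using False by (metis mult_left_cancel)
  hence "\<psi> a ^ (CARD('p) - 1) = 1" by (metis \<psi>_1 \<psi>_power)
  hence "norm (\<psi> a) ^ (CARD('p) - 1) = 1" by (metis norm_one norm_power)
  thus ?thesis using p3 power_eq_1_iff[of "norm (\<psi> a)"] by fastforce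
qed (simp add: \<psi>_0)

lemma sum_\<psi>: "(\<Sum>a\<in>UNIV - {0}. \<psi> a) = 0"
proof -
  have "(\<Sum>a\<in>UNIV - {0}. \<psi> a) = (\<Sum>a\<in>UNIV - {0}. \<psi> (u * a))"
    by (rule sum.reindex_bij_witness[of _ "\<lambda>a. u * a" "\<lambda>a. a / u"]) (use u in auto)
  also have "\<dots> = \<psi> u * (\<Sum>a\<in>UNIV - {0}. \<psi> a)" by (simp add: \<psi>_mult sum_distrib_left)
  finally show ?thesis using u by (simp add: algebra_simps)
qed

lemma euler_coeff_lam_0: "euler_coeff lam 0 = 1"
proof -
  have "monics 0 = {1 :: 'p mod_ring poly}"
    by (auto simp: monics_def elim!: degree_eq_zeroE)
  thus ?thesis by (simp add: euler_coeff_def lam_1)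
qed

text \<open>Multiplying the value at \<open>c1\<close> by \<open>u\<close> while keeping the other values permutes the monic
  polynomials of degree at least \<open>card I\<close>.\<close>
lemma euler_coeff_lam_eq_0:
  assumes "k \<ge> card I"
  shows "euler_coeff lam k = 0"
proof -
  \<comment> \<open>\<open>L\<close> becomes the Lagrange basis polynomial of \<open>c1\<close> on
    \<open>I\<close>. Its degree \<open>card I - 1\<close> is below \<open>k\<close>, so adding
    multiples of it keeps \<open>g\<close> monic of degree \<open>k\<close>.\<close>
  define L0 where "L0 = (\<Prod>c\<in>I - {c1}. [:- c, 1:])"
  define L where "L = smult (inverse (poly L0 c1)) L0"
  have nz: "poly L0 c1 \<noteq> 0" by (simp add: L0_def poly_prod)
  have L1: "poly L c1 = 1" using nz by (simp add: L_def)
  have L2: "poly L c = 0" if "c \<in> I" "c \<noteq> c1" for c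
    using that by (auto simp: L_def L0_def poly_prod)
  have "card I > 0" using c1 by (auto simp: card_gt_0_iff)
  have "degree L0 = card I - 1"
    unfolding L0_def using c1 by (subst degree_prod_sum_eq) auto
  hence dL: "degree L < k" using assms nz \<open>card I > 0\<close> by (simp add: L_def)
  define T where "T v g = g + smult ((v - 1) * poly g c1) L" for v g
  have T_monics: "T v g \<in> monics k" if "g \<in> monics k" for v g
  proof -
    have "degree (smult ((v - 1) * poly g c1) L) < degree g"
      using dL that degree_smult_le[of "(v - 1) * poly g c1" L] by (simp add: monics_def)
    moreover have "coeff L k = 0" using dL by (rule coeff_eq_0)
    ultimately show ?thesis using that unfolding T_def monics_def
      by (auto simp add: degree_add_eq_left)
  qed
  have T_val: "poly (T v g) c1 = v * poly g c1" for v g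
    by (simp add: T_def L1 algebra_simps)
  have T_T: "T (inverse v) (T v g) = g" if "v \<noteq> 0" for v g
  proof -
    have "T (inverse v) (T v g) = g + smult ((v - 1) * poly g c1 + (inverse v - 1) * (v * poly g c1)) L"
      unfolding T_def[of "inverse v"] T_val by (simp add: T_def smult_add_left)
    also have "(v - 1) * poly g c1 + (inverse v - 1) * (v * poly g c1) = 0"
      using that by (simp add: field_simps)
    finally show ?thesis by simp
  qed
  have T_lam: "lam (T u g) = \<psi> u * lam g" for g
  proof -
    have "lam (T u g) = \<psi> (poly (T u g) c1) ^ ex c1 * (\<Prod>c\<in>I - {c1}. \<psi> (poly (T u g) c) ^ ex c)"
      unfolding lam_def using c1 by (intro prod.remove) auto
    also have "(\<Prod>c\<in>I - {c1}. \<psi> (poly (T u g) c) ^ ex c) = (\<Prod>c\<in>I - {c1}. \<psi> (poly g c) ^ ex c)"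
      by (intro prod.cong refl) (simp add: T_def L2)
    also have "\<psi> (poly (T u g) c1) ^ ex c1 * \<dots> = \<psi> u * (\<psi> (poly g c1) ^ ex c1 * \<dots>)"
      by (simp add: T_val \<psi>_mult c1)
    also have "\<psi> (poly g c1) ^ ex c1 * (\<Prod>c\<in>I - {c1}. \<psi> (poly g c) ^ ex c) = lam g"
      unfolding lam_def using c1 by (intro prod.remove[symmetric]) auto
    finally show ?thesis .
  qed
  have "euler_coeff lam k = (\<Sum>g\<in>monics k. lam (T u g))"
    unfolding euler_coeff_def
    by (rule sum.reindex_bij_witness[of _ "T u" "T (inverse u)"])
       (use u T_monics T_T[of u] T_T[of "inverse u"] in auto)
  also have "\<dots> = \<psi> u * euler_coeff lam k"
    by (simp add: T_lam euler_coeff_def sum_distrib_left)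
  finally show ?thesis using u by (simp add: algebra_simps)
qed

lemma ac_eval_f: "ac_eval f x = (\<Prod>c\<in>I. (x - to_ac c) ^ ex c)"
  by (simp add: f_def to_ac.hom_prod to_ac.hom_power poly_prod to_ac.base.map_poly_pCons_hom)

lemma ac_eval_f_geo:
  assumes P: "prime P" "ac_eval P x = 0" "degree P dvd n" "even n"
  shows "ac_eval f x ^ geo CARD('p) n = to_ac (\<Prod>c\<in>I. (poly P c ^ (n div degree P)) ^ ex c)"
proof -
  have "ac_eval f x ^ geo CARD('p) n = (\<Prod>c\<in>I. ((x - to_ac c) ^ geo CARD('p) n) ^ ex c)"
    by (simp add: ac_eval_f prod_power_distrib mult.commute flip: power_mult)
  also have "\<dots> = to_ac (\<Prod>c\<in>I. (poly P c ^ (n div degree P)) ^ ex c)"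
    unfolding norm_linear[OF P] by (simp add: to_ac_prod)
  finally show ?thesis .
qed

text \<open>Each of the \<open>degree P\<close> roots of a prime \<open>P\<close> contributes
  \<open>lam P ^ (n div degree P)\<close>. The norm of \<open>f(x)\<close> lies in the prime field,
  where \<open>of_ac\<close> inverts \<open>to_ac\<close>.\<close>

lemma euler_power_sum_eq:
  assumes "even n" "n > 0"
  shows "euler_power_sum lam n =
    (\<Sum>x\<in>frobenius_fixed n. \<psi> (of_ac (ac_eval f x ^ geo CARD('p) n)))"
  unfolding sum_frobenius_fixed[OF \<open>n > 0\<close>] euler_power_sum_def
proof (rule sum.cong[OF refl])
  fix P :: "'p mod_ring poly" assume "P \<in> {P. prime P \<and> degree P dvd n}"
  hence P: "prime P" "degree P dvd n" by auto
  have "(\<Sum>x | ac_eval P x = 0. \<psi> (of_ac (ac_eval f x ^ geo CARD('p) n))) =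
    (\<Sum>x | ac_eval P x = 0. lam P ^ (n div degree P))"
  proof (rule sum.cong[OF refl])
    fix x assume "x \<in> {x. ac_eval P x = 0}"
    hence x: "ac_eval P x = 0" by simp
    show "\<psi> (of_ac (ac_eval f x ^ geo CARD('p) n)) = lam P ^ (n div degree P)"
      unfolding ac_eval_f_geo[OF P(1) x P(2) \<open>even n\<close>] of_ac_to_ac
      by (simp add: \<psi>_prod \<psi>_power lam_def prod_power_distrib mult.commute flip: power_mult)
  qed
  thus "of_nat (degree P) * lam P ^ (n div degree P) =
      (\<Sum>x | ac_eval P x = 0. \<psi> (of_ac (ac_eval f x ^ geo CARD('p) n)))"
    by (simp add: card_roots_prime[OF P(1)])
qed

lemma f_eq: "f = [:- c1, 1:] * f1"
  unfolding f_def f1_def using c1 by (subst prod.remove[of I c1]) auto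

lemma f1_c1: "poly f1 c1 \<noteq> 0"
  by (auto simp: f1_def poly_prod)

lemma f_nz: "f \<noteq> 0"
  by (simp add: f_def)

definition fibre :: "nat \<Rightarrow> 'p mod_ring \<Rightarrow> 'p mod_ring alg_closure set" where
  "fibre n a = {x \<in> frobenius_fixed n. ac_eval f x ^ geo CARD('p) n = to_ac a}"

lemma fibre_bound:
  assumes "a \<noteq> 0" "\<mu> > 0" "CARD('p) ^ \<mu> > degree f + 3"
  shows "card (fibre (2 * \<mu>) a) \<le> geo CARD('p) (2 * \<mu>) + CARD('p) ^ \<mu> * (2 * degree f + 3)"
proof -
  interpret stepanov f f1 c1 a \<mu> "degree f" "CARD('p) ^ \<mu>" "geo CARD('p) \<mu>" "CARD('p) - 1"
    "geo CARD('p) \<mu> + degree f + 3"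
    by unfold_locales (use assms f_eq f1_c1 p3 in auto)
  show ?thesis unfolding fibre_def by (rule card_bound)
qed

text \<open>Stepanov's method bounds the fibres of the norm of \<open>f\<close> from above only. But
  the fibres partition \<open>GF(p^n)\<close>, whose size is known, so the excesses
  \<open>y a\<close> over the mean \<open>G\<close> almost cancel, and the upper bounds control the
  sum of their absolute values.\<close>

lemma euler_power_sum_bound:
  assumes \<mu>: "\<mu> > 0" "CARD('p) ^ \<mu> > degree f + 3"
  shows "norm (euler_power_sum lam (2 * \<mu>)) \<le>
    real (2 * (2 * degree f + 3) * (CARD('p) - 1) + degree f) * sqrt (CARD('p)) ^ (2 * \<mu>)"
proof -
  define n where "n = 2 * \<mu>"
  define G where "G = geo CARD('p) n"
  define B where "B = CARD('p) ^ \<mu> * (2 * degree f + 3)"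
  define y where "y a = real (card (fibre n a)) - real G" for a
  have n: "n > 0" "even n" using \<mu> by (auto simp: n_def)
  have fin: "finite (frobenius_fixed n :: 'p mod_ring alg_closure set)"
    using card_frobenius_fixed(2)[OF n(1)] .
  have fin': "finite (fibre n a)" for a unfolding fibre_def using fin by simp
  have union: "frobenius_fixed n = (\<Union>a. fibre n a)"
  proof (intro equalityI subsetI)
    fix x :: "'p mod_ring alg_closure" assume x: "x \<in> frobenius_fixed n"
    obtain P :: "'p mod_ring poly" where P: "prime P" "ac_eval P x = 0" by (rule ex_prime_root)
    have "degree P dvd n" using frobenius_fixed_iff[OF P, of n] x by (simp add: frobenius_fixed_def)
    from ac_eval_f_geo[OF P this n(2)] x show "x \<in> (\<Union>a. fibre n a)" by (auto simp: fibre_def)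
  qed (auto simp: fibre_def)
  have disj: "fibre n a \<inter> fibre n b = {}" if "a \<noteq> b" for a b
    using that by (auto simp: fibre_def)
  have y_le: "y a \<le> real B" if "a \<noteq> 0" for a
    using fibre_bound[OF that \<mu>] unfolding y_def G_def B_def n_def[symmetric]
    by (simp add: algebra_simps flip: of_nat_add of_nat_mult of_nat_power)
  have "real (CARD('p) ^ n) = real (card (frobenius_fixed n :: 'p mod_ring alg_closure set))"
    using card_frobenius_fixed(1)[OF n(1), where 'p = 'p] by simp
  also have "\<dots> = (\<Sum>a\<in>UNIV. real (card (fibre n a)))"
    unfolding union by (subst card_UN_disjoint) (use fin' disj in auto)
  also have "\<dots> = real (card (fibre n 0)) + (\<Sum>a\<in>UNIV - {0}. real (card (fibre n a)))"
    by (rule sum.remove) auto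
  also have "(\<Sum>a\<in>UNIV - {0}. real (card (fibre n a))) = (\<Sum>a\<in>UNIV - {0}. y a) + real (CARD('p) - 1) * real G"
    by (simp add: y_def sum_subtractf)
  also have "real (CARD('p) - 1) * real G = real (CARD('p) ^ n) - 1"
  proof -
    have "real (CARD('p) - 1) * real G = real (CARD('p) ^ n - 1)"
      using geo_mult[of "CARD('p)" n] p3 unfolding G_def by (simp only: flip: of_nat_mult)
    thus ?thesis by (simp add: of_nat_diff)
  qed
  finally have sum_y: "(\<Sum>a\<in>UNIV - {0}. y a) = 1 - real (card (fibre n 0))" by simp
  have "card (fibre n 0) \<le> card {x. ac_eval f x = 0}"
    by (intro card_mono poly_roots_finite) (auto simp: fibre_def f_nz)
  also have "\<dots> \<le> degree f" using card_poly_roots_bound[of "map_poly to_ac f"] f_nz by simp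
  finally have fib0: "card (fibre n 0) \<le> degree f" .
  have "euler_power_sum lam n = (\<Sum>a\<in>UNIV. \<Sum>x\<in>fibre n a. \<psi> (of_ac (ac_eval f x ^ geo CARD('p) n)))"
    unfolding euler_power_sum_eq[OF n(2,1)] union
    by (rule sum.UNION_disjoint) (use fin' disj in auto)
  also have "\<dots> = (\<Sum>a\<in>UNIV. \<psi> a * of_nat (card (fibre n a)))"
    by (intro sum.cong refl) (simp add: fibre_def)
  also have "\<dots> = (\<Sum>a\<in>UNIV - {0}. \<psi> a * of_nat (card (fibre n a)))"
    by (rule sum.mono_neutral_right) (auto simp: \<psi>_0)
  \<comment> \<open>The mean \<open>G\<close> drops out because \<open>\<psi>\<close> sums to
    zero.\<close>
  also have "\<dots> = (\<Sum>a\<in>UNIV - {0}. \<psi> a * of_real (y a)) + of_nat G * (\<Sum>a\<in>UNIV - {0}. \<psi> a)"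
    by (simp add: y_def algebra_simps sum_subtractf sum_distrib_left)
  also have "\<dots> = (\<Sum>a\<in>UNIV - {0}. \<psi> a * of_real (y a))" by (simp add: sum_\<psi>)
  finally have "norm (euler_power_sum lam n) \<le> (\<Sum>a\<in>UNIV - {0}. norm (\<psi> a * of_real (y a)))"
    by (simp only: norm_sum)
  \<comment> \<open>From \<open>y \<le> B\<close> and \<open>B \<ge> 0\<close> follows that the
    absolute value of \<open>y\<close> is at most \<open>2 * B - y\<close>, whose sum over
    \<open>a\<close> is known.\<close>
  also have "\<dots> \<le> (\<Sum>a\<in>UNIV - {0}. 2 * real B - y a)"
  proof (rule sum_mono)
    fix a :: "'p mod_ring" assume "a \<in> UNIV - {0}"
    hence "y a \<le> real B" using y_le by simp
    have "norm (\<psi> a * of_real (y a)) \<le> 1 * \<bar>y a\<bar>"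
      unfolding norm_mult norm_of_real by (intro mult_right_mono norm_\<psi>) auto
    also have "\<dots> \<le> 2 * real B - y a" using \<open>y a \<le> real B\<close> by linarith
    finally show "norm (\<psi> a * of_real (y a)) \<le> 2 * real B - y a" .
  qed
  also have "\<dots> = 2 * real B * real (CARD('p) - 1) + real (card (fibre n 0)) - 1"
    by (simp add: sum_subtractf sum_y)
  also have "\<dots> \<le> 2 * real B * real (CARD('p) - 1) + real (degree f) * real (CARD('p) ^ \<mu>)"
  proof -
    have "real (degree f) * 1 \<le> real (degree f) * real (CARD('p) ^ \<mu>)"
      using \<mu> by (intro mult_left_mono) auto
    thus ?thesis using fib0 by simp
  qed
  also have "\<dots> = real (2 * (2 * degree f + 3) * (CARD('p) - 1) + degree f) * real (CARD('p) ^ \<mu>)"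
    unfolding B_def of_nat_mult of_nat_add by (simp only: algebra_simps)
  also have "real (CARD('p) ^ \<mu>) = sqrt (CARD('p)) ^ (2 * \<mu>)" by (simp add: power_mult)
  finally show ?thesis by (simp only: n_def)
qed

lemma euler_power_sum_1: "euler_power_sum lam 1 = (\<Sum>a\<in>UNIV. \<Prod>c\<in>I. \<psi> (a + c) ^ ex c)"
proof -
  have eq: "{P :: 'p mod_ring poly. prime P \<and> degree P dvd 1} = (\<lambda>a. [:a, 1:]) ` UNIV"
  proof (intro equalityI subsetI)
    fix P :: "'p mod_ring poly" assume "P \<in> {P. prime P \<and> degree P dvd 1}"
    hence P: "degree P = 1" "lead_coeff P = 1" using prime_monic[of P] by auto
    obtain a b where "P = [:a, b:]" using P(1) by (metis degree1_coeffs)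
    thus "P \<in> (\<lambda>a. [:a, 1:]) ` UNIV" using P by (auto split: if_splits)
  qed (auto intro!: monic_irreducible_imp_prime irreducible_linear)
  have "euler_power_sum lam 1 = (\<Sum>P\<in>(\<lambda>a. [:a, 1:]) ` UNIV. of_nat (degree P) * lam P ^ (1 div degree P))"
    unfolding euler_power_sum_def eq ..
  also have "\<dots> = (\<Sum>a\<in>UNIV. lam [:a, 1:])"
    by (subst sum.reindex) (auto simp: inj_on_def)
  finally show ?thesis by (simp add: lam_def)
qed

theorem weil_bound:
  "norm (\<Sum>a\<in>UNIV. \<Prod>c\<in>I. \<psi> (a + c) ^ ex c) \<le> real (card I - 1) * sqrt (CARD('p))"
proof -
  have "norm (euler_power_sum lam 1) \<le> real (card I - 1) * sqrt (CARD('p))"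
  proof (rule newton_power_sum_bound[of "euler_coeff lam"])
    \<comment> \<open>For such \<open>n\<close> the crude inequality
      \<open>\<mu> < 2^\<mu> \<le> p^\<mu>\<close> makes \<open>p^\<mu>\<close> as large as
      Stepanov's method demands.\<close>
    fix n assume n: "even n" "n \<ge> 2 * (degree f + 4)"
    then obtain \<mu> where \<mu>: "n = 2 * \<mu>" by auto
    have "degree f + 3 < \<mu>" using n \<mu> by simp
    also have "\<mu> < 2 ^ \<mu>" by (rule less_exp)
    also have "\<dots> \<le> CARD('p) ^ \<mu>" using p3 by (intro power_mono) auto
    finally show "norm (euler_power_sum lam n) \<le>
      real (2 * (2 * degree f + 3) * (CARD('p) - 1) + degree f) * sqrt (CARD('p)) ^ n"
      unfolding \<mu> using n \<mu> by (intro euler_power_sum_bound) auto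
  next
    show "of_nat k * euler_coeff lam k = (\<Sum>j = 1..k. euler_power_sum lam j * euler_coeff lam (k - j))" for k
      by (rule newton_euler[OF lam_mult lam_1])
  qed (use p3 in \<open>auto simp: euler_coeff_lam_0 intro!: euler_coeff_lam_eq_0\<close>)
  thus ?thesis by (simp only: euler_power_sum_1)
qed

end

section \<open>Transfer of the Weil bound to Dirichlet characters on the integers\<close>

lemma dirichlet_character_mult: "dirichlet_character q \<psi> \<Longrightarrow> \<psi> (a * b) = \<psi> a * \<psi> b"
  and dirichlet_character_nz_iff: "dirichlet_character q \<psi> \<Longrightarrow> \<psi> a \<noteq> 0 \<longleftrightarrow> coprime a (int q)"
  by (auto simp: dirichlet_character_def)

lemma dirichlet_character_1: "dirichlet_character q \<psi> \<Longrightarrow> \<psi> 1 = 1"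
  using dirichlet_character_mult[of q \<psi> 1 1] dirichlet_character_nz_iff[of q \<psi> 1] by simp

lemma dirichlet_character_add_mult:
  assumes "dirichlet_character q \<psi>"
  shows "\<psi> (a + int q * k) = \<psi> a"
proof -
  have per: "\<psi> (b + int q) = \<psi> b" for b using assms by (auto simp: dirichlet_character_def)
  have nat: "\<psi> (b + int q * int n) = \<psi> b" for b n
  proof (induction n)
    case (Suc n)
    show ?case using per[of "b + int q * int n"] Suc by (simp add: algebra_simps)
  qed simp
  show ?thesis
  proof (cases k)
    case (nonneg n)
    thus ?thesis using nat by simp
  next
    case (neg n)
    have "\<psi> a = \<psi> (a + int q * k + int q * int (Suc n))" by (simp add: neg algebra_simps)
    also have "\<dots> = \<psi> (a + int q * k)" by (rule nat)
    finally show ?thesis ..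
  qed
qed

lemma dirichlet_character_mod:
  assumes "dirichlet_character q \<psi>"
  shows "\<psi> (a mod int q) = \<psi> a"
  using dirichlet_character_add_mult[OF assms, of "a mod int q" "a div int q"] by simp

lemma dirichlet_character_cong:
  assumes "dirichlet_character q \<psi>" "a mod int q = b mod int q"
  shows "\<psi> a = \<psi> b"
  using dirichlet_character_mod[OF assms(1)] assms(2) by metis

definition nonprincipal :: "nat \<Rightarrow> (int \<Rightarrow> complex) \<Rightarrow> bool" where
  "nonprincipal q \<psi> \<longleftrightarrow> dirichlet_character q \<psi> \<and> (\<exists>a. coprime a (int q) \<and> \<psi> a \<noteq> 1)"

text \<open>The bound as a property of the number \<open>p\<close> alone, so that a prime violating
  it can be selected before the type is introduced.\<close>

definition weil_holds :: "nat \<Rightarrow> bool" where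
  "weil_holds p \<longleftrightarrow> (\<forall>\<psi> I ex c1. nonprincipal p \<psi> \<longrightarrow> I \<subseteq> {0..<int p} \<longrightarrow> c1 \<in> I \<longrightarrow> ex c1 = 1 \<longrightarrow>
     (\<forall>c\<in>I. (1::nat) \<le> ex c) \<longrightarrow>
     norm (\<Sum>a\<in>{0..<int p}. \<Prod>c\<in>I. \<psi> (a + c) ^ ex c) \<le> real (card I - 1) * sqrt (real p))"

text \<open>The Weil bound was proved over a type with \<open>p\<close> elements, but \<open>p\<close> is a bound variable of the
  theorem. So one type is built from a prime that violates the bound, if there is such a prime.\<close>
definition weil_prime :: nat where
  "weil_prime = (SOME p. prime p \<and> 3 \<le> p \<and> ((\<exists>q. prime q \<and> 3 \<le> q \<and> \<not> weil_holds q) \<longrightarrow> \<not> weil_holds p))"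

lemma weil_prime: "prime weil_prime" "weil_prime \<ge> 3"
  and weil_prime_least: "prime q \<Longrightarrow> 3 \<le> q \<Longrightarrow> \<not> weil_holds q \<Longrightarrow> \<not> weil_holds weil_prime"
proof -
  let ?P = "\<lambda>p. prime p \<and> 3 \<le> p \<and> ((\<exists>q. prime q \<and> 3 \<le> q \<and> \<not> weil_holds q) \<longrightarrow> \<not> weil_holds p)"
  have "prime (3 :: nat)" by simp
  hence "\<exists>p. ?P p" by (metis order_refl)
  hence "?P weil_prime" unfolding weil_prime_def by (rule someI_ex)
  thus "prime weil_prime" "weil_prime \<ge> 3"
    and "prime q \<Longrightarrow> 3 \<le> q \<Longrightarrow> \<not> weil_holds q \<Longrightarrow> \<not> weil_holds weil_prime" by auto
qed

typedef weil_index = "{..<weil_prime}"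
  using weil_prime(2) by (intro exI[of _ 0]) auto

lemma card_weil_index: "CARD(weil_index) = weil_prime"
  using type_definition.card[OF type_definition_weil_index] by simp

instance weil_index :: finite
proof
  have "CARD(weil_index) > 0" using card_weil_index weil_prime(2) by simp
  thus "finite (UNIV :: weil_index set)" using card_ge_0_finite by blast
qed

instance weil_index :: prime_card
  by standard (simp add: card_weil_index weil_prime)

text \<open>\<open>to\<close> and \<open>fr\<close> identify \<open>weil_index mod_ring\<close> with
  the residues from 0 to \<open>weil_prime - 1\<close>, and \<open>\<psi>\<close> depends on
  residues only, so \<open>weil_bound\<close> carries over.\<close>

lemma weil_holds_weil_prime: "weil_holds weil_prime"
  unfolding weil_holds_def
proof (intro allI impI)
  fix \<psi> I ex c1
  assume np: "nonprincipal weil_prime \<psi>" and I: "I \<subseteq> {0..<int weil_prime}" and c1: "c1 \<in> I" "ex c1 = 1"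
    and ex: "\<forall>c\<in>I. (1::nat) \<le> ex c"
  let ?p = "weil_prime"
  from np have \<psi>: "dirichlet_character ?p \<psi>" by (simp add: nonprincipal_def)
  obtain u where u: "coprime u (int ?p)" "\<psi> u \<noteq> 1" using np by (auto simp: nonprincipal_def)
  define to :: "weil_index mod_ring \<Rightarrow> int" where "to = to_int_mod_ring"
  define fr :: "int \<Rightarrow> weil_index mod_ring" where "fr = of_int"
  have p0: "\<psi> 0 = 0"
    using dirichlet_character_nz_iff[OF \<psi>, of 0] weil_prime(2) by (auto simp: coprime_commute)
  have to_fr: "to (fr a) = a mod int ?p" for a
    unfolding to_def fr_def by (simp add: of_int_of_int_mod_ring to_int_mod_ring.rep_eq of_int_mod_ring.rep_eq card_weil_index)
  have fr_to: "fr (to x) = x" for x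
    unfolding to_def fr_def by (simp add: of_int_of_int_mod_ring)
  have \<psi>_to_fr: "\<psi> (to (fr a)) = \<psi> a" for a unfolding to_fr by (rule dirichlet_character_mod[OF \<psi>])
  have to_range: "to x \<in> {0..<int ?p}" for x
    using range_to_int_mod_ring[where 'a = weil_index] card_weil_index unfolding to_def by auto
  have to_mult: "\<psi> (to (x * y)) = \<psi> (to x) * \<psi> (to y)" for x y
    unfolding dirichlet_character_mult[OF \<psi>, symmetric]
    by (metis \<psi>_to_fr fr_to fr_def of_int_mult)
  have to_add: "\<psi> (to (x + fr c)) = \<psi> (to x + c)" for x c
    by (metis \<psi>_to_fr fr_to fr_def of_int_add)
  have fr_inj: "inj_on fr I"
    by (rule inj_on_inverseI[of _ to]) (use I to_fr in auto)
  interpret weil_sum "\<lambda>x. \<psi> (to x)" "fr ` I" "\<lambda>x. ex (to x)" "fr c1" "fr u"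
  proof
    show "\<psi> (to (a * b)) = \<psi> (to a) * \<psi> (to b)" for a b by (rule to_mult)
    show "\<psi> (to 0) = 0" using \<psi>_to_fr[of 0] p0 by (simp add: fr_def)
    show "\<psi> (to 1) = 1" using \<psi>_to_fr[of 1] dirichlet_character_1[OF \<psi>] by (simp add: fr_def)
    show "\<psi> (to (fr u)) \<noteq> 1" using u \<psi>_to_fr by simp
    show "fr u \<noteq> 0"
    proof
      assume "fr u = 0"
      hence "\<psi> u = \<psi> (to (fr 0))" using \<psi>_to_fr[of u] by (simp add: fr_def)
      thus False using u(1) p0 \<psi>_to_fr dirichlet_character_nz_iff[OF \<psi>] by metis
    qed
    show "CARD(weil_index) \<ge> 3" using card_weil_index weil_prime by simp
    show "fr c1 \<in> fr ` I" using c1 by simp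
    have to_I: "to (fr c) = c" if "c \<in> I" for c using that I to_fr by auto
    show "ex (to (fr c1)) = 1" using c1 to_I by simp
    show "1 \<le> ex (to c)" if "c \<in> fr ` I" for c using that ex to_I by auto
  qed
  have to_I: "to (fr c) = c" if "c \<in> I" for c using that I to_fr by auto
  have "(\<Sum>a\<in>{0..<int ?p}. \<Prod>c\<in>I. \<psi> (a + c) ^ ex c) = (\<Sum>x\<in>UNIV. \<Prod>c\<in>I. \<psi> (to x + c) ^ ex c)"
    by (rule sum.reindex_bij_witness[of _ to fr]) (use to_range to_fr fr_to in auto)
  also have "\<dots> = (\<Sum>x\<in>UNIV. \<Prod>c\<in>fr ` I. \<psi> (to (x + c)) ^ ex (to c))"
    by (subst prod.reindex[OF fr_inj]) (simp add: to_add to_I)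
  also have "norm \<dots> \<le> real (card (fr ` I) - 1) * sqrt (CARD(weil_index))" by (rule weil_bound)
  also have "\<dots> = real (card I - 1) * sqrt (real ?p)" by (simp add: card_image[OF fr_inj] card_weil_index)
  finally show "norm (\<Sum>a\<in>{0..<int ?p}. \<Prod>c\<in>I. \<psi> (a + c) ^ ex c) \<le> real (card I - 1) * sqrt (real ?p)" .
qed

text \<open>If any prime \<open>p \<ge> 3\<close> violated the bound, \<open>weil_prime\<close>
  would violate it by its choice, against \<open>weil_holds_weil_prime\<close>.\<close>

theorem weil_character_sum:
  assumes "prime p" "p \<ge> 3" "nonprincipal p \<psi>" "I \<subseteq> {0..<int p}" "c1 \<in> I" "ex c1 = 1"
    "\<And>c. c \<in> I \<Longrightarrow> 1 \<le> ex c"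
  shows "norm (\<Sum>a\<in>{0..<int p}. \<Prod>c\<in>I. \<psi> (a + c) ^ ex c) \<le> real (card I - 1) * sqrt (real p)"
proof -
  have "weil_holds p" using weil_prime_least[OF assms(1,2)] weil_holds_weil_prime by blast
  thus ?thesis using assms unfolding weil_holds_def by auto
qed

section \<open>Moments of short character sums\<close>

lemma sum_residues_shift:
  fixes F :: "int \<Rightarrow> 'a::comm_monoid_add" and p :: nat
  assumes "\<And>x. F (x mod int p) = F x" "p > 0"
  shows "(\<Sum>x\<in>{0..<int p}. F (x + c)) = (\<Sum>x\<in>{0..<int p}. F x)"
proof (rule sum.reindex_bij_witness[of _ "\<lambda>x. (x - c) mod int p" "\<lambda>x. (x + c) mod int p"])
  show "F ((x + c) mod int p) = F (x + c)" for x by (rule assms(1))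
  show "((x + c) mod int p - c) mod int p = x" if "x \<in> {0..<int p}" for x
    using that by (simp add: mod_diff_left_eq)
  show "((x - c) mod int p + c) mod int p = x" if "x \<in> {0..<int p}" for x
    using that by (simp add: mod_add_left_eq)
qed (use assms(2) in auto)

lemma sum_residues_mult:
  fixes F :: "int \<Rightarrow> 'a::comm_monoid_add" and p :: nat
  assumes "\<And>x. F (x mod int p) = F x" "p > 0" "coprime u (int p)"
  shows "(\<Sum>x\<in>{0..<int p}. F (u * x)) = (\<Sum>x\<in>{0..<int p}. F x)"
proof -
  obtain v where v: "[u * v = 1] (mod int p)" using cong_solve_coprime_int[OF assms(3)] by blast
  have inv: "(u * (v * x)) mod int p = x mod int p" "(v * (u * x)) mod int p = x mod int p" for x
    using cong_scalar_right[OF v, of x] by (simp_all add: unique_euclidean_semiring_class.cong_def mult_ac)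
  show ?thesis
  proof (rule sum.reindex_bij_witness[of _ "\<lambda>x. (v * x) mod int p" "\<lambda>x. (u * x) mod int p"])
    show "F ((u * x) mod int p) = F (u * x)" for x by (rule assms(1))
    show "(v * ((u * x) mod int p)) mod int p = x" if "x \<in> {0..<int p}" for x
      using that inv(2)[of x] by (simp add: mod_mult_right_eq)
    show "(u * ((v * x) mod int p)) mod int p = x" if "x \<in> {0..<int p}" for x
      using that inv(1)[of x] by (simp add: mod_mult_right_eq)
  qed (use assms(2) in auto)
qed

locale np_character =
  fixes p :: nat and \<psi> :: "int \<Rightarrow> complex"
  assumes prime_p: "prime p" and p3: "p \<ge> 3" and np: "nonprincipal p \<psi>"
begin

lemma dirichlet: "dirichlet_character p \<psi>" using np by (simp add: nonprincipal_def)

lemmas \<psi>_mult = dirichlet_character_mult[OF dirichlet]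
  and \<psi>_nz_iff = dirichlet_character_nz_iff[OF dirichlet]
  and \<psi>_1 = dirichlet_character_1[OF dirichlet]
  and \<psi>_mod = dirichlet_character_mod[OF dirichlet]
  and \<psi>_cong = dirichlet_character_cong[OF dirichlet]

lemma p_pos: "p > 0" using p3 by simp

lemma \<psi>_power: "\<psi> (a ^ n) = \<psi> a ^ n"
  by (induction n) (simp_all add: \<psi>_1 \<psi>_mult)

lemma \<psi>_power_p1:
  assumes "coprime a (int p)" shows "\<psi> a ^ (p - 1) = 1"
proof -
  define b where "b = nat (a mod int p)"
  have ib: "int b = a mod int p" using p_pos by (simp add: b_def)
  have "coprime (a mod int p) (int p)" using assms p_pos by simp
  hence "coprime b p" by (simp flip: ib add: coprime_int_iff)
  hence "\<not> p dvd b" using prime_p by (metis coprime_absorb_right not_prime_unit)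
  hence "[b ^ (p - 1) = 1] (mod p)" by (rule fermat_theorem[OF prime_p])
  hence "[int b ^ (p - 1) = 1] (mod int p)" using cong_int_iff[of "b ^ (p - 1)" 1 p] by simp
  hence "\<psi> (int b ^ (p - 1)) = \<psi> 1" unfolding unique_euclidean_semiring_class.cong_def by (rule \<psi>_cong)
  thus ?thesis by (simp add: \<psi>_power \<psi>_1 ib \<psi>_mod)
qed

lemma norm_\<psi>_coprime: "coprime a (int p) \<Longrightarrow> norm (\<psi> a) = 1"
proof -
  assume "coprime a (int p)"
  hence "norm (\<psi> a) ^ (p - 1) = 1" using \<psi>_power_p1 by (metis norm_one norm_power)
  thus ?thesis using p3 power_eq_1_iff[of "norm (\<psi> a)"] by fastforce
qed

lemma norm_\<psi>: "norm (\<psi> a) \<le> 1"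
  using norm_\<psi>_coprime[of a] \<psi>_nz_iff[of a] by (cases "coprime a (int p)") auto

text \<open>On units the values are roots of unity of order dividing \<open>p - 1\<close>.
  Conjugates thus become powers with natural exponents, the form in which the Weil bound is stated;
  for \<open>a\<close> divisible by \<open>p\<close> both sides vanish, as
  \<open>p - 2 > 0\<close>.\<close>

lemma cnj_\<psi>: "cnj (\<psi> a) = \<psi> a ^ (p - 2)"
proof (cases "coprime a (int p)")
  case True
  have "p - 1 = Suc (p - 2)" using p3 by simp
  hence "\<psi> a * \<psi> a ^ (p - 2) = 1" using \<psi>_power_p1[OF True] by simp
  moreover have "\<psi> a * cnj (\<psi> a) = 1" using norm_\<psi>_coprime[OF True] by (simp add: complex_norm_square[symmetric])
  ultimately show ?thesis using \<psi>_nz_iff[of a] True by (metis mult_left_cancel)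
next
  case False
  hence "\<psi> a = 0" using \<psi>_nz_iff by blast
  thus ?thesis using p3 by (simp add: power_0_left)
qed

lemma sum_\<psi>: "(\<Sum>x\<in>{0..<int p}. \<psi> x) = 0"
proof -
  obtain u where u: "coprime u (int p)" "\<psi> u \<noteq> 1" using np by (auto simp: nonprincipal_def)
  have "(\<Sum>x\<in>{0..<int p}. \<psi> x) = (\<Sum>x\<in>{0..<int p}. \<psi> (u * x))"
    by (rule sum_residues_mult[symmetric]) (use \<psi>_mod p_pos u in auto)
  also have "\<dots> = \<psi> u * (\<Sum>x\<in>{0..<int p}. \<psi> x)" by (simp add: \<psi>_mult sum_distrib_left)
  finally show ?thesis using u by (simp add: algebra_simps)
qed

lemma coprime_residue: "x \<in> {0..<int p} \<Longrightarrow> coprime x (int p) \<longleftrightarrow> x \<noteq> 0"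
proof -
  assume x: "x \<in> {0..<int p}"
  have "coprime x (int p)" if "x \<noteq> 0"
  proof -
    have "\<not> int p dvd x" using x that zdvd_not_zless[of x "int p"] by auto
    hence "coprime (int p) x" using prime_p by (intro prime_imp_coprime) auto
    thus ?thesis by (rule coprime_imp_coprime) auto
  qed
  thus ?thesis using p3 by auto
qed

definition correl :: "int \<Rightarrow> complex" where
  "correl t = (\<Sum>x\<in>{0..<int p}. \<psi> (x + t) * cnj (\<psi> x))"

lemma correl_0: "correl 0 = of_nat (p - 1)"
proof -
  have "correl 0 = (\<Sum>x\<in>{0..<int p}. if x = 0 then 0 else 1)"
    unfolding correl_def
  proof (rule sum.cong[OF refl])
    fix x assume "x \<in> {0..<int p}"
    thus "\<psi> (x + 0) * cnj (\<psi> x) = (if x = 0 then 0 else 1)"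
      using coprime_residue[of x] norm_\<psi>_coprime[of x] \<psi>_nz_iff[of x]
      by (auto simp: complex_norm_square[symmetric])
  qed
  also have "\<dots> = (\<Sum>x\<in>{0..<int p} - {0}. 1)" by (rule sum.mono_neutral_cong_right) auto
  also have "\<dots> = of_nat (p - 1)" using p_pos by (simp add: card_Diff_singleton)
  finally show ?thesis .
qed

lemma correl_mult:
  assumes "coprime t (int p)" shows "correl t = correl 1"
proof -
  have "correl t = (\<Sum>x\<in>{0..<int p}. \<psi> (t * x + t) * cnj (\<psi> (t * x)))"
    unfolding correl_def
  proof (rule sum_residues_mult[symmetric])
    show "\<psi> (x mod int p + t) * cnj (\<psi> (x mod int p)) = \<psi> (x + t) * cnj (\<psi> x)" for x
      using \<psi>_cong[of "x mod int p + t" "x + t"] by (simp add: \<psi>_mod mod_add_left_eq)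
  qed (use p_pos assms in auto)
  also have "\<dots> = (\<Sum>x\<in>{0..<int p}. (\<psi> t * cnj (\<psi> t)) * (\<psi> (x + 1) * cnj (\<psi> x)))"
  proof (rule sum.cong[OF refl])
    fix x
    have "t * x + t = t * (x + 1)" by (simp add: algebra_simps)
    thus "\<psi> (t * x + t) * cnj (\<psi> (t * x)) = (\<psi> t * cnj (\<psi> t)) * (\<psi> (x + 1) * cnj (\<psi> x))"
      by (simp add: \<psi>_mult mult_ac)
  qed
  also have "\<psi> t * cnj (\<psi> t) = 1" using norm_\<psi>_coprime[OF assms] by (simp add: complex_norm_square[symmetric])
  finally show ?thesis by (simp add: correl_def)
qed

text \<open>Over all residues \<open>t\<close> the correlations sum to zero. \<open>correl 0\<close>
  is \<open>p - 1\<close>, and the \<open>p - 1\<close> nonzero residues share one value by the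
  substitution \<open>x -> t * x\<close>, so this value is -1.\<close>

lemma correl_nz:
  assumes "\<not> int p dvd t" shows "correl t = -1"
proof -
  have cop: "coprime t (int p)" if "\<not> int p dvd t" for t
  proof -
    have "coprime (int p) t" using prime_p that by (intro prime_imp_coprime) auto
    thus ?thesis by (rule coprime_imp_coprime) auto
  qed
  have "(\<Sum>t\<in>{0..<int p}. correl t) = (\<Sum>x\<in>{0..<int p}. (\<Sum>t\<in>{0..<int p}. \<psi> (t + x)) * cnj (\<psi> x))"
    unfolding correl_def sum_distrib_right by (subst sum.swap) (simp add: add.commute)
  also have "\<dots> = 0"
    by (intro sum.neutral ballI) (subst sum_residues_shift, use \<psi>_mod p_pos sum_\<psi> in auto)
  finally have "0 = (\<Sum>t\<in>{0..<int p}. correl t)" ..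
  also have "\<dots> = correl 0 + (\<Sum>t\<in>{0..<int p} - {0}. correl t)" using p_pos by (intro sum.remove) auto
  also have "(\<Sum>t\<in>{0..<int p} - {0}. correl t) = (\<Sum>t\<in>{0..<int p} - {0}. correl 1)"
    using coprime_residue by (intro sum.cong refl correl_mult) auto
  also have "\<dots> = of_nat (p - 1) * correl 1" using p_pos by (simp add: card_Diff_singleton)
  also have "correl 0 = of_nat (p - 1)" by (rule correl_0)
  finally have "of_nat (p - 1) * (correl 1 + 1) = 0" by (simp add: algebra_simps)
  hence "correl 1 + 1 = 0" using p3 by (simp only: mult_eq_0_iff of_nat_eq_0_iff) auto
  hence "correl 1 = -1" by (rule add.inverse_unique[symmetric, OF trans[OF add.commute]])
  thus ?thesis using correl_mult[OF cop[OF assms]] by simp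
qed

text \<open>The off-diagonal terms of the second moment sum to a negative number.\<close>
lemma second_moment:
  assumes "H \<le> p"
  shows "(\<Sum>x\<in>{0..<int p}. (norm (\<Sum>b\<in>{0..<int H}. \<psi> (x + b)))\<^sup>2) \<le> real p * real H"
proof -
  let ?B = "{0..<int H}"
  have "of_real (\<Sum>x\<in>{0..<int p}. (norm (\<Sum>b\<in>?B. \<psi> (x + b)))\<^sup>2) =
      (\<Sum>x\<in>{0..<int p}. \<Sum>b\<in>?B. \<Sum>c\<in>?B. \<psi> (x + b) * cnj (\<psi> (x + c)))"
    by (simp only: of_real_sum complex_norm_square cnj_sum sum_product)
  also have "\<dots> = (\<Sum>b\<in>?B. \<Sum>c\<in>?B. \<Sum>x\<in>{0..<int p}. \<psi> (x + b) * cnj (\<psi> (x + c)))"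
  proof -
    have swap: "(\<Sum>x\<in>r. \<Sum>b\<in>s. \<Sum>c\<in>t. g x b c) = (\<Sum>b\<in>s. \<Sum>c\<in>t. \<Sum>x\<in>r. g x b c)"
      for g :: "int \<Rightarrow> int \<Rightarrow> int \<Rightarrow> complex" and r s t
      by (rule trans[OF sum.swap sum.cong[OF refl sum.swap]])
    show ?thesis by (rule swap)
  qed
  also have "\<dots> = (\<Sum>b\<in>?B. \<Sum>c\<in>?B. correl (b - c))"
  proof (intro sum.cong refl)
    fix b c :: int
    have "(\<Sum>x\<in>{0..<int p}. \<psi> (x + b) * cnj (\<psi> (x + c))) =
      (\<Sum>x\<in>{0..<int p}. (\<lambda>x. \<psi> (x + (b - c)) * cnj (\<psi> x)) (x + c))" by (simp add: algebra_simps)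
    also have "\<dots> = correl (b - c)" unfolding correl_def
    proof (rule sum_residues_shift)
      show "\<psi> (x mod int p + (b - c)) * cnj (\<psi> (x mod int p)) = \<psi> (x + (b - c)) * cnj (\<psi> x)" for x
        using \<psi>_cong[of "x mod int p + (b - c)" "x + (b - c)"] by (simp add: \<psi>_mod mod_add_left_eq)
    qed (rule p_pos)
    finally show "(\<Sum>x\<in>{0..<int p}. \<psi> (x + b) * cnj (\<psi> (x + c))) = correl (b - c)" .
  qed
  also have "\<dots> = of_real (\<Sum>b\<in>?B. \<Sum>c\<in>?B. if b = c then real (p - 1) else -1)"
    unfolding of_real_sum
  proof (intro sum.cong refl)
    fix b c assume bc: "b \<in> ?B" "c \<in> ?B"
    have "\<not> int p dvd b - c" if "b \<noteq> c"
      using bc that assms zdvd_imp_le[of "int p" "\<bar>b - c\<bar>"] by auto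
    thus "correl (b - c) = of_real (if b = c then real (p - 1) else - 1)"
      using correl_0 correl_nz by auto
  qed
  finally have "(\<Sum>x\<in>{0..<int p}. (norm (\<Sum>b\<in>?B. \<psi> (x + b)))\<^sup>2) =
     (\<Sum>b\<in>?B. \<Sum>c\<in>?B. if b = c then real (p - 1) else -1)" by (simp only: of_real_eq_iff)
  also have "\<dots> \<le> (\<Sum>b\<in>?B. \<Sum>c\<in>?B. if b = c then real p else 0)"
    by (intro sum_mono) auto
  also have "\<dots> = real p * real H" by simp
  finally show ?thesis .
qed

end

lemma card_image_repeating:
  assumes "\<And>i. i < n \<Longrightarrow> \<exists>j<n. j \<noteq> i \<and> g j = g i"
  shows "2 * card (g ` {..<n}) \<le> (n :: nat)"
proof -
  have "2 * card (g ` {..<n}) = (\<Sum>c\<in>g ` {..<n}. 2)" by simp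
  also have "\<dots> \<le> (\<Sum>c\<in>g ` {..<n}. card {i \<in> {..<n}. g i = c})"
  proof (rule sum_mono)
    fix c assume "c \<in> g ` {..<n}"
    then obtain i where i: "i < n" "c = g i" by auto
    from assms[OF i(1)] obtain j where j: "j < n" "j \<noteq> i" "g j = g i" by auto
    have "card {i, j} \<le> card {i \<in> {..<n}. g i = c}" using i j by (intro card_mono) auto
    thus "2 \<le> card {i \<in> {..<n}. g i = c}" using j by simp
  qed
  also have "\<dots> = card {..<n}"
    unfolding card_eq_sum by (rule sum.image_gen[symmetric]) simp
  finally show ?thesis by simp
qed

text \<open>A tuple in which no entry stands alone has at most \<open>r\<close> distinct values. It
  can be read off from a list of \<open>r\<close> values and an assignment of the
  \<open>2 * r\<close> positions to places in that list.\<close>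

lemma card_repeating_tuples:
  fixes B r :: nat
  assumes "r > 0"
  shows "card {g \<in> PiE {..<2 * r} (\<lambda>_. {0..<int B}). \<forall>i<2 * r. \<exists>j<2 * r. j \<noteq> i \<and> g j = g i} \<le> r ^ (2 * r) * B ^ r"
proof -
  let ?J = "{..<2 * r}" and ?B = "{0..<int B}"
  let ?bad = "{g \<in> PiE ?J (\<lambda>_. ?B). \<forall>i<2 * r. \<exists>j<2 * r. j \<noteq> i \<and> g j = g i}"
  define F :: "(nat \<Rightarrow> int) \<times> (nat \<Rightarrow> nat) \<Rightarrow> nat \<Rightarrow> int" where
    "F = (\<lambda>z. restrict (\<lambda>i. fst z (snd z i)) ?J)"
  have "?bad \<subseteq> F ` (PiE {..<r} (\<lambda>_. ?B) \<times> PiE ?J (\<lambda>_. {..<r}))"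
  proof
    fix g assume g: "g \<in> ?bad"
    have "2 * card (g ` ?J) \<le> 2 * r"
    proof (rule card_image_repeating)
      fix i assume "i < 2 * r"
      moreover from CollectD[OF g] have "\<forall>i<2 * r. \<exists>j<2 * r. j \<noteq> i \<and> g j = g i" ..
      ultimately show "\<exists>j<2 * r. j \<noteq> i \<and> g j = g i" by (elim allE impE)
    qed
    hence card_le: "card (g ` ?J) \<le> r" by simp
    define N where "N = card (g ` ?J)"
    obtain h0 where "bij_betw h0 {0..<N} (g ` ?J)"
      using ex_bij_betw_nat_finite[of "g ` ?J"] unfolding N_def by blast
    hence h0: "h0 ` {0..<N} = g ` ?J" by (rule bij_betw_imp_surj_on)
    have "0 \<in> ?J" using assms by simp
    \<comment> \<open>The list of distinct values is padded to length \<open>r\<close> with the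
      entry \<open>g 0\<close>.\<close>
    define h where "h = (\<lambda>t\<in>{..<r}. if t < N then h0 t else g 0)"
    have ex_t: "\<forall>i\<in>?J. \<exists>t. t < r \<and> h t = g i"
    proof
      fix i assume i: "i \<in> ?J"
      have "g i \<in> h0 ` {0..<N}" unfolding h0 using i by (rule imageI)
      then obtain t where "t < N" "g i = h0 t" by auto
      thus "\<exists>t. t < r \<and> h t = g i" using card_le unfolding N_def[symmetric] by (intro exI[of _ t]) (auto simp: h_def)
    qed
    define \<tau> where "\<tau> i = (SOME t. t < r \<and> h t = g i)" for i
    have \<tau>: "\<tau> i < r" "h (\<tau> i) = g i" if "i \<in> ?J" for i
      using someI_ex[OF bspec[OF ex_t that]] unfolding \<tau>_def by auto
    have g_in: "g i \<in> ?B" if "i \<in> ?J" for i using PiE_mem[OF CollectD[OF g, THEN conjunct1] that] .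
    have h_B: "h t \<in> ?B" if "t < r" for t
    proof (cases "t < N")
      case True
      hence "h0 t \<in> g ` ?J" unfolding h0[symmetric] by auto
      then obtain i where "i \<in> ?J" "h0 t = g i" by (rule imageE)
      hence "h0 t \<in> ?B" using g_in[of i] by simp
      thus ?thesis using True that by (simp add: h_def)
    next
      case False
      thus ?thesis using that g_in[OF \<open>0 \<in> ?J\<close>] by (simp add: h_def)
    qed
    have "h \<in> PiE {..<r} (\<lambda>_. ?B)" using h_B by (intro PiE_I) (simp_all add: h_def)
    moreover have "restrict \<tau> ?J \<in> PiE ?J (\<lambda>_. {..<r})" using \<tau>(1) by (intro PiE_I) simp_all
    moreover have "g = F (h, restrict \<tau> ?J)"
    proof (rule extensionalityI[of _ ?J])
      show "g \<in> extensional ?J" using CollectD[OF g, THEN conjunct1] by (simp add: PiE_def)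
      show "F (h, restrict \<tau> ?J) \<in> extensional ?J" by (simp add: F_def)
      show "g i = F (h, restrict \<tau> ?J) i" if "i \<in> ?J" for i
        using that \<tau>(2)[OF that] by (simp add: F_def)
    qed
    ultimately show "g \<in> F ` (PiE {..<r} (\<lambda>_. ?B) \<times> PiE ?J (\<lambda>_. {..<r}))"
      by (intro image_eqI[of g F "(h, restrict \<tau> ?J)"] SigmaI)
  qed
  hence "card ?bad \<le> card (PiE {..<r} (\<lambda>_. ?B) \<times> PiE ?J (\<lambda>_. {..<r}))"
    by (intro surj_card_le finite_cartesian_product finite_PiE finite_lessThan finite_atLeastLessThan_int)
  also have "\<dots> = r ^ (2 * r) * B ^ r" by (simp add: card_cartesian_product card_PiE)
  finally show ?thesis .
qed

context np_character
begin

text \<open>Equal shifts are merged and their exponents added. The shift \<open>g i\<close> occurs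
  only once, so it keeps the exponent 1 that the Weil bound asks for.\<close>

lemma tuple_sum_bound_aux:
  assumes B: "B \<le> p" and g: "g \<in> {..<n} \<rightarrow> {0..<int B}"
    and i: "i < n" "k i = 1" "\<And>j. j < n \<Longrightarrow> j \<noteq> i \<Longrightarrow> g j \<noteq> g i" and k: "\<And>j. j < n \<Longrightarrow> 1 \<le> k j"
  shows "norm (\<Sum>x\<in>{0..<int p}. \<Prod>j<n. \<psi> (x + g j) ^ k j) \<le> real n * sqrt (real p)"
proof -
  define ex where "ex c = (\<Sum>j | j < n \<and> g j = c. k j)" for c
  have "(\<Prod>j<n. \<psi> (x + g j) ^ k j) = (\<Prod>c\<in>g ` {..<n}. \<psi> (x + c) ^ ex c)" for x
  proof -
    have "(\<Prod>j<n. \<psi> (x + g j) ^ k j) = (\<Prod>c\<in>g ` {..<n}. \<Prod>j | j \<in> {..<n} \<and> g j = c. \<psi> (x + g j) ^ k j)"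
      by (rule prod.image_gen) simp
    also have "\<dots> = (\<Prod>c\<in>g ` {..<n}. \<psi> (x + c) ^ ex c)"
      by (intro prod.cong refl) (simp add: ex_def power_sum)
    finally show ?thesis .
  qed
  hence "norm (\<Sum>x\<in>{0..<int p}. \<Prod>j<n. \<psi> (x + g j) ^ k j) =
    norm (\<Sum>x\<in>{0..<int p}. \<Prod>c\<in>g ` {..<n}. \<psi> (x + c) ^ ex c)" by simp
  also have "\<dots> \<le> real (card (g ` {..<n}) - 1) * sqrt (real p)"
  proof (rule weil_character_sum[OF prime_p p3 np])
    show "g ` {..<n} \<subseteq> {0..<int p}" using g B by fastforce
    show "g i \<in> g ` {..<n}" using i by simp
    have "{j. j < n \<and> g j = g i} = {i}" using i by auto
    thus "ex (g i) = 1" using i by (simp add: ex_def)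
    fix c assume "c \<in> g ` {..<n}"
    then obtain j where j: "j < n" "c = g j" by auto
    have "k j \<le> ex c" unfolding ex_def using j by (intro member_le_sum) auto
    thus "1 \<le> ex c" using k j(1) by (meson le_trans)
  qed
  also have "\<dots> \<le> real n * sqrt (real p)"
    using card_image_le[of "{..<n}" g] by (intro mult_right_mono) auto
  finally show ?thesis .
qed

lemma tuple_sum_bound:
  assumes B: "B \<le> p" and g: "g \<in> {..<2 * r} \<rightarrow> {0..<int B}"
    and i: "i < 2 * r" "\<And>j. j < 2 * r \<Longrightarrow> j \<noteq> i \<Longrightarrow> g j \<noteq> g i"
  shows "norm (\<Sum>x\<in>{0..<int p}. \<Prod>j<2 * r. if j < r then \<psi> (x + g j) else cnj (\<psi> (x + g j))) \<le> 2 * real r * sqrt (real p)"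
    (is "norm ?S \<le> _")
proof (cases "i < r")
  case True
  define k where "k j = (if j < r then 1 else p - 2)" for j
  have "?S = (\<Sum>x\<in>{0..<int p}. \<Prod>j<2 * r. \<psi> (x + g j) ^ k j)"
    by (intro sum.cong prod.cong refl) (simp add: k_def cnj_\<psi>)
  moreover have "norm (\<Sum>x\<in>{0..<int p}. \<Prod>j<2 * r. \<psi> (x + g j) ^ k j) \<le> real (2 * r) * sqrt (real p)"
    by (rule tuple_sum_bound_aux[OF B g i(1) _ i(2)]) (use True p3 in \<open>auto simp: k_def\<close>)
  ultimately show ?thesis by simp
next
  case False
  \<comment> \<open>The isolated shift sits in a conjugated factor, so the whole sum is conjugated
    to give it the exponent 1.\<close>
  define k where "k j = (if j < r then p - 2 else 1)" for j
  have "cnj ?S = (\<Sum>x\<in>{0..<int p}. \<Prod>j<2 * r. \<psi> (x + g j) ^ k j)"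
    unfolding cnj_sum cnj_prod by (intro sum.cong prod.cong refl) (simp add: k_def flip: cnj_\<psi>)
  moreover have "norm (\<Sum>x\<in>{0..<int p}. \<Prod>j<2 * r. \<psi> (x + g j) ^ k j) \<le> real (2 * r) * sqrt (real p)"
    by (rule tuple_sum_bound_aux[OF B g i(1) _ i(2)]) (use False p3 in \<open>auto simp: k_def\<close>)
  ultimately have "norm (cnj ?S) \<le> real (2 * r) * sqrt (real p)" by simp
  thus ?thesis unfolding complex_mod_cnj by simp
qed

text \<open>The power is expanded over tuples of \<open>2 * r\<close> shifts. Tuples with an
  isolated entry are estimated by the Weil bound, the few remaining ones trivially by
  \<open>p\<close>.\<close>

theorem moment_bound:
  assumes B: "B \<le> p" and r: "r > 0"
  shows "(\<Sum>x\<in>{0..<int p}. norm (\<Sum>b\<in>{0..<int B}. \<psi> (x + b)) ^ (2 * r)) \<le>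
     real (r ^ (2 * r)) * real B ^ r * real p + 2 * real r * real B ^ (2 * r) * sqrt (real p)"
proof -
  let ?B = "{0..<int B}" and ?J = "{..<2 * r}"
  let ?G = "PiE ?J (\<lambda>_. ?B)"
  let ?bad = "{g \<in> ?G. \<forall>i<2 * r. \<exists>j<2 * r. j \<noteq> i \<and> g j = g i}"
  define t where "t g x = (\<Prod>j<2 * r. if j < r then \<psi> (x + g j) else cnj (\<psi> (x + g j)))" for g :: "nat \<Rightarrow> int" and x
  have fin: "finite ?G" by (intro finite_PiE) auto
  have expand: "of_real (norm (\<Sum>b\<in>?B. \<psi> (x + b)) ^ (2 * r)) = (\<Sum>g\<in>?G. t g x)" for x
  proof -
    define Z where "Z = (\<Sum>b\<in>?B. \<psi> (x + b))"
    have "of_real (norm Z ^ (2 * r)) = (Z * cnj Z) ^ r"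
      by (simp add: power_mult complex_norm_square[symmetric])
    also have "\<dots> = (\<Prod>j<2 * r. if j < r then Z else cnj Z)"
    proof -
      have "{..<2 * r} \<inter> {j. j < r} = {..<r}" "{..<2 * r} \<inter> - {j. j < r} = {r..<2 * r}" by auto
      thus ?thesis by (subst prod.If_cases) (simp_all add: power_mult_distrib)
    qed
    also have "\<dots> = (\<Prod>j<2 * r. \<Sum>b\<in>?B. if j < r then \<psi> (x + b) else cnj (\<psi> (x + b)))"
      by (intro prod.cong refl) (simp add: Z_def)
    also have "\<dots> = (\<Sum>g\<in>?G. t g x)"
      unfolding t_def by (rule prod_sum_PiE) auto
    finally show ?thesis by (simp add: Z_def)
  qed
  have norm_t: "norm (t g x) \<le> 1" for g x
    unfolding t_def prod_norm[symmetric] by (intro prod_le_1) (auto simp: norm_\<psi>)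
  have "of_real (\<Sum>x\<in>{0..<int p}. norm (\<Sum>b\<in>?B. \<psi> (x + b)) ^ (2 * r)) = (\<Sum>x\<in>{0..<int p}. \<Sum>g\<in>?G. t g x)"
    unfolding of_real_sum expand ..
  also have "\<dots> = (\<Sum>g\<in>?G. \<Sum>x\<in>{0..<int p}. t g x)" by (rule sum.swap)
  finally have "norm (of_real (\<Sum>x\<in>{0..<int p}. norm (\<Sum>b\<in>?B. \<psi> (x + b)) ^ (2 * r)) :: complex)
      \<le> (\<Sum>g\<in>?G. norm (\<Sum>x\<in>{0..<int p}. t g x))" by (simp only: norm_sum)
  hence "(\<Sum>x\<in>{0..<int p}. norm (\<Sum>b\<in>?B. \<psi> (x + b)) ^ (2 * r)) \<le> (\<Sum>g\<in>?G. norm (\<Sum>x\<in>{0..<int p}. t g x))"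
    unfolding norm_of_real by linarith
  also have "\<dots> = (\<Sum>g\<in>?bad. norm (\<Sum>x\<in>{0..<int p}. t g x)) + (\<Sum>g\<in>?G - ?bad. norm (\<Sum>x\<in>{0..<int p}. t g x))"
    using sum.subset_diff[of ?bad ?G] fin by (simp add: add.commute)
  also have "\<dots> \<le> (\<Sum>g\<in>?bad. real p) + (\<Sum>g\<in>?G - ?bad. 2 * real r * sqrt (real p))"
  proof (intro add_mono sum_mono)
    fix g
    have "norm (\<Sum>x\<in>{0..<int p}. t g x) \<le> (\<Sum>x\<in>{0..<int p}. 1)"
      by (rule order_trans[OF norm_sum]) (intro sum_mono norm_t)
    thus "norm (\<Sum>x\<in>{0..<int p}. t g x) \<le> real p" by simp
  next
    fix g assume g: "g \<in> ?G - ?bad"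
    hence "\<exists>i<2 * r. \<forall>j<2 * r. j \<noteq> i \<longrightarrow> g j \<noteq> g i" by auto
    then obtain i where "i < 2 * r" "\<And>j. j < 2 * r \<Longrightarrow> j \<noteq> i \<Longrightarrow> g j \<noteq> g i" by auto
    thus "norm (\<Sum>x\<in>{0..<int p}. t g x) \<le> 2 * real r * sqrt (real p)"
      unfolding t_def using g by (intro tuple_sum_bound[OF B]) auto
  qed
  also have "\<dots> = real (card ?bad) * real p + real (card (?G - ?bad)) * (2 * real r * sqrt (real p))" by simp
  also have "\<dots> \<le> real (r ^ (2 * r) * B ^ r) * real p + real (B ^ (2 * r)) * (2 * real r * sqrt (real p))"
  proof (intro add_mono mult_right_mono of_nat_mono)
    show "card ?bad \<le> r ^ (2 * r) * B ^ r" by (rule card_repeating_tuples[OF r])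
    have "card (?G - ?bad) \<le> card ?G" by (intro card_mono fin) auto
    also have "\<dots> = B ^ (2 * r)" by (simp add: card_PiE)
    finally show "card (?G - ?bad) \<le> B ^ (2 * r)" .
  qed auto
  finally show ?thesis by (simp add: mult_ac)
qed

end

section \<open>The Polya--Vinogradov inequality\<close>

lemma ln_3_ge_1: "x \<ge> 3 \<Longrightarrow> ln (x :: real) \<ge> 1"
  using exp_le by (subst ln_ge_iff) auto

lemma ln_2_ge_half: "ln (2 :: real) \<ge> 1 / 2"
proof (subst ln_ge_iff)
  have "exp (1 / 2 :: real) ^ 2 = exp 1" by (simp add: power2_eq_square flip: exp_add)
  also have "\<dots> \<le> 2 ^ 2" using exp_le by simp
  finally show "exp (1 / 2 :: real) \<le> 2" by (rule power2_le_imp_le) simp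
qed simp

context np_character
begin

definition S :: "int \<Rightarrow> nat \<Rightarrow> complex" where
  "S M N = (\<Sum>b\<in>{0..<int N}. \<psi> (M + b))"

lemma S_0 [simp]: "S M 0 = 0" by (simp add: S_def)

lemma S_add: "S M (N + K) = S M N + S (M + int N) K"
proof -
  have "{0..<int (N + K)} = {0..<int N} \<union> {int N..<int N + int K}" by auto
  hence "S M (N + K) = S M N + (\<Sum>b\<in>{int N..<int N + int K}. \<psi> (M + b))"
    unfolding S_def by (simp only:) (rule sum.union_disjoint, auto)
  also have "(\<Sum>b\<in>{int N..<int N + int K}. \<psi> (M + b)) = S (M + int N) K"
    unfolding S_def by (rule sum.reindex_bij_witness[of _ "\<lambda>b. b + int N" "\<lambda>b. b - int N"]) (auto simp: algebra_simps)
  finally show ?thesis .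
qed

text \<open>Two splittings of the same interval of length \<open>N + H\<close> are compared. Shift
  and length exchange their roles, which replaces sums of length \<open>N\<close> by sums of length
  \<open>H\<close>.\<close>

lemma S_shift: "S (M + int H) N - S M N = S (M + int N) H - S M H"
  using S_add[of M N H] S_add[of M H N] by (simp add: add.commute algebra_simps)

lemma S_mod: "S (M mod int p) N = S M N"
  unfolding S_def by (intro sum.cong refl \<psi>_cong) (simp add: mod_add_left_eq)

lemma S_full: "S M p = 0"
proof -
  have "S M p = (\<Sum>b\<in>{0..<int p}. \<psi> (b + M))" by (simp add: S_def add.commute)
  also have "\<dots> = 0" by (subst sum_residues_shift) (use \<psi>_mod p_pos sum_\<psi> in auto)
  finally show ?thesis .
qed

lemma S_mod_length: "S M (N mod p) = S M N"
proof -
  have "S M (p * k + N mod p) = S M (N mod p)" for k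
  proof (induction k arbitrary: M)
    case (Suc k)
    have "S M (p * Suc k + N mod p) = S M p + S (M + int p) (p * k + N mod p)"
      using S_add[of M p "p * k + N mod p"] by (simp add: algebra_simps)
    also have "\<dots> = S (M + int p) (N mod p)" using Suc S_full by simp
    also have "\<dots> = S M (N mod p)" using S_mod[of "M + int p" "N mod p"] S_mod[of M "N mod p"] by simp
    finally show ?case .
  qed simp
  from this[of "N div p"] show ?thesis by simp
qed

lemma norm_S_le: "norm (S M N) \<le> real N"
proof -
  have "norm (S M N) \<le> (\<Sum>b\<in>{0..<int N}. 1)"
    unfolding S_def by (rule order_trans[OF norm_sum]) (intro sum_mono norm_\<psi>)
  thus ?thesis by simp
qed

text \<open>Cauchy-Schwarz over the starting points, which are then extended to all residues, where
  \<open>second_moment\<close> applies.\<close>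

lemma bilinear_bound:
  assumes "H \<le> p" "N \<le> p"
  shows "norm (\<Sum>h\<in>{0..<int H}. S (M + h) N) \<le> sqrt (real H * real N * real p)"
proof -
  have "norm (\<Sum>h\<in>{0..<int H}. S (M + h) N) \<le> (\<Sum>h\<in>{0..<int H}. 1 * norm (S (M + h) N))"
    by (simp add: norm_sum)
  also have "\<dots> \<le> sqrt (real H * real N * real p)"
  proof (rule real_le_rsqrt)
    have "(\<Sum>h\<in>{0..<int H}. (norm (S (M + h) N))\<^sup>2) \<le> (\<Sum>h\<in>{0..<int p}. (norm (S (h + M) N))\<^sup>2)"
      using assms(1) by (simp only: add.commute) (intro sum_mono2, auto)
    also have "\<dots> = (\<Sum>h\<in>{0..<int p}. (norm (S h N))\<^sup>2)"
      by (rule sum_residues_shift[where F = "\<lambda>h. (norm (S h N))\<^sup>2"]) (use S_mod p_pos in auto)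
    also have "\<dots> \<le> real p * real N" unfolding S_def by (rule second_moment[OF assms(2)])
    finally have "real H * (\<Sum>h\<in>{0..<int H}. (norm (S (M + h) N))\<^sup>2) \<le> real H * (real p * real N)"
      by (intro mult_left_mono) auto
    moreover have "(\<Sum>h\<in>{0..<int H}. 1 * norm (S (M + h) N))\<^sup>2 \<le>
        (\<Sum>h\<in>{0..<int H}. 1\<^sup>2) * (\<Sum>h\<in>{0..<int H}. (norm (S (M + h) N))\<^sup>2)"
      by (rule Cauchy_Schwarz_ineq_sum)
    ultimately show "(\<Sum>h\<in>{0..<int H}. 1 * norm (S (M + h) N))\<^sup>2 \<le> real H * real N * real p"
      by (simp add: mult_ac)
  qed
  finally show ?thesis .
qed

definition avg :: "int \<Rightarrow> nat \<Rightarrow> nat \<Rightarrow> complex" where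
  "avg M N k = (\<Sum>h\<in>{0..<int (2 ^ k)}. S (M + h) N) / 2 ^ k"

lemma avg_0: "avg M N 0 = S M N"
proof -
  have "{0..<int (2 ^ 0)} = {0}" by auto
  thus ?thesis by (simp add: avg_def)
qed

text \<open>Doubling the length of the average changes it by two sums of the shape of \<open>bilinear_bound\<close>
  with equal lengths, so all the steps cost the same.\<close>
lemma avg_step:
  assumes "2 ^ k \<le> p"
  shows "norm (avg M N (Suc k) - avg M N k) \<le> sqrt (real p)"
proof -
  define H where "H = (2 :: nat) ^ k"
  have H0: "H > 0" by (simp add: H_def)
  have "{0..<int (2 * H)} = {0..<int H} \<union> {int H..<int H + int H}" by auto
  hence "(\<Sum>h\<in>{0..<int (2 * H)}. S (M + h) N) =
      (\<Sum>h\<in>{0..<int H}. S (M + h) N) + (\<Sum>h\<in>{int H..<int H + int H}. S (M + h) N)"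
    by (simp only:) (rule sum.union_disjoint, auto)
  also have "(\<Sum>h\<in>{int H..<int H + int H}. S (M + h) N) = (\<Sum>h\<in>{0..<int H}. S (M + h + int H) N)"
    by (rule sum.reindex_bij_witness[of _ "\<lambda>b. b + int H" "\<lambda>b. b - int H"]) (auto simp: algebra_simps)
  finally have two: "(\<Sum>h\<in>{0..<int (2 * H)}. S (M + h) N) =
      (\<Sum>h\<in>{0..<int H}. S (M + h) N) + (\<Sum>h\<in>{0..<int H}. S (M + h + int H) N)" .
  have "avg M N (Suc k) - avg M N k =
    ((\<Sum>h\<in>{0..<int H}. S (M + h + int H) N) - (\<Sum>h\<in>{0..<int H}. S (M + h) N)) / (2 * of_nat H)"
    using H0 two by (simp add: avg_def H_def field_simps)
  also have "(\<Sum>h\<in>{0..<int H}. S (M + h + int H) N) - (\<Sum>h\<in>{0..<int H}. S (M + h) N) =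
      (\<Sum>h\<in>{0..<int H}. S (M + int N + h) H) - (\<Sum>h\<in>{0..<int H}. S (M + h) H)"
    unfolding sum_subtractf[symmetric]
  proof (rule sum.cong[OF refl])
    fix h show "S (M + h + int H) N - S (M + h) N = S (M + int N + h) H - S (M + h) H"
      using S_shift[of "M + h" H N] by (simp add: add_ac)
  qed
  also have "norm (\<dots> / (2 * of_nat H)) \<le> (sqrt (real H * real H * real p) + sqrt (real H * real H * real p)) / (2 * real H)"
  proof -
    have "H \<le> p" using assms by (simp add: H_def)
    hence "norm ((\<Sum>h\<in>{0..<int H}. S (M + int N + h) H) - (\<Sum>h\<in>{0..<int H}. S (M + h) H)) \<le>
      sqrt (real H * real H * real p) + sqrt (real H * real H * real p)"
      by (intro order_trans[OF norm_triangle_ineq4] add_mono bilinear_bound)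
    moreover have "norm (2 * of_nat H :: complex) = 2 * real H" by (simp add: norm_mult)
    ultimately show ?thesis unfolding norm_divide by (simp only:) (intro divide_right_mono, auto)
  qed
  also have "\<dots> = sqrt (real p)" using H0 by (simp add: real_sqrt_mult)
  finally show ?thesis .
qed

lemma avg_bound:
  assumes "2 ^ k \<le> p"
  shows "norm (S M N - avg M N k) \<le> real k * sqrt (real p)"
  using assms
proof (induction k)
  case (Suc k)
  hence "2 ^ k \<le> p" by simp
  have "norm (S M N - avg M N (Suc k)) \<le> norm (S M N - avg M N k) + norm (avg M N (Suc k) - avg M N k)"
    using norm_triangle_ineq4[of "S M N - avg M N k" "avg M N (Suc k) - avg M N k"] by simp
  also have "\<dots> \<le> real k * sqrt (real p) + sqrt (real p)"
    by (intro add_mono Suc.IH avg_step \<open>2 ^ k \<le> p\<close>)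
  finally show ?case by (simp add: algebra_simps)
qed (simp add: avg_0)

lemma ln_p: "ln (real p) \<ge> 1"
  using p3 by (intro ln_3_ge_1) simp

text \<open>Averaging over \<open>2^k\<close> starting points, with \<open>2^k\<close> of the size
  of \<open>N\<close>, lets \<open>bilinear_bound\<close> give \<open>O(sqrt p)\<close>. Undoing the
  average takes \<open>k\<close> steps at a cost of \<open>sqrt p\<close> each, and
  \<open>k \<le> 2 * ln p\<close>.\<close>

theorem polya_vinogradov: "norm (S M N) \<le> 4 * sqrt (real p) * ln (real p)"
proof -
  have main: "norm (S M N) \<le> 4 * sqrt (real p) * ln (real p)" if N: "0 < N" "N \<le> p" for N
  proof -
    obtain k where k: "2 ^ k \<le> N" "N < 2 ^ Suc k"
      using ex_power_ivl1[of 2 N] N by auto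
    have kp: "2 ^ k \<le> p" using k N by simp
    have "norm (avg M N k) \<le> sqrt (real (2 ^ k) * real N * real p) / 2 ^ k"
      unfolding avg_def norm_divide using bilinear_bound[OF kp N(2), of M]
      by (simp add: norm_power divide_right_mono)
    also have "\<dots> \<le> sqrt (2 ^ k * (2 * 2 ^ k) * real p) / 2 ^ k"
    proof -
      have "real N \<le> 2 * 2 ^ k" using of_nat_mono[OF less_imp_le[OF k(2)], where 'a = real] by simp
      thus ?thesis by (intro divide_right_mono real_sqrt_le_mono mult_mono) auto
    qed
    also have "\<dots> = sqrt 2 * sqrt (real p)"
    proof -
      have "(2 :: real) ^ k * (2 * 2 ^ k) * real p = (2 ^ k)\<^sup>2 * (2 * real p)" by (simp add: power2_eq_square)
      thus ?thesis by (simp only: real_sqrt_mult) simp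
    qed
    also have "\<dots> \<le> 2 * sqrt (real p)" by (intro mult_right_mono) (auto simp: sqrt2_less_2 less_imp_le)
    finally have 1: "norm (avg M N k) \<le> 2 * sqrt (real p)" .
    have "real k * (1 / 2) \<le> real k * ln 2" using ln_2_ge_half by (intro mult_left_mono) auto
    also have "\<dots> = ln (2 ^ k)" by (simp add: ln_realpow)
    also have "\<dots> \<le> ln (real p)" using of_nat_mono[OF kp, where 'a = real] p_pos by (subst ln_le_cancel_iff) auto
    finally have "real k + 2 \<le> 4 * ln (real p)" using ln_p by linarith
    have "norm (S M N) \<le> norm (S M N - avg M N k) + norm (avg M N k)"
      using norm_triangle_ineq[of "S M N - avg M N k" "avg M N k"] by simp
    also have "\<dots> \<le> real k * sqrt (real p) + 2 * sqrt (real p)"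
      by (intro add_mono avg_bound 1 kp)
    also have "\<dots> = (real k + 2) * sqrt (real p)" by (simp add: algebra_simps)
    also have "\<dots> \<le> (4 * ln (real p)) * sqrt (real p)"
      by (intro mult_right_mono) (use \<open>real k + 2 \<le> _\<close> in auto)
    finally show ?thesis by (simp add: mult_ac)
  qed
  \<comment> \<open>Complete periods sum to zero, so lengths up to \<open>p\<close> suffice.\<close>
  have "S M N = S M (N mod p)" by (simp add: S_mod_length)
  moreover have "norm (S M (N mod p)) \<le> 4 * sqrt (real p) * ln (real p)"
    using main[of "N mod p"] ln_p p_pos by (cases "N mod p = 0") (auto intro: less_imp_le)
  ultimately show ?thesis by simp
qed

end

section \<open>The Burgess bound\<close>

text \<open>Chebyshev's sum inequality: expand the double sum of
  \<open>v i * v j * (w i - w j) * (w i ^ n - w j ^ n)\<close>, whose terms are all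
  nonnegative.\<close>

lemma chebyshev_power_sum:
  fixes v w :: "'i \<Rightarrow> real"
  assumes "\<And>i. i \<in> I \<Longrightarrow> v i \<ge> 0" "\<And>i. i \<in> I \<Longrightarrow> w i \<ge> 0"
  shows "(\<Sum>i\<in>I. v i * w i) * (\<Sum>i\<in>I. v i * w i ^ n) \<le> (\<Sum>i\<in>I. v i) * (\<Sum>i\<in>I. v i * w i ^ Suc n)"
proof -
  have "(w i - w j) * (w i ^ n - w j ^ n) \<ge> 0" if ij: "i \<in> I" "j \<in> I" for i j
  proof (cases "w i \<le> w j")
    case True
    hence "w i ^ n \<le> w j ^ n" using assms ij by (intro power_mono) auto
    thus ?thesis using True by (intro mult_nonpos_nonpos) auto
  next
    case False
    hence "w j ^ n \<le> w i ^ n" using assms ij by (intro power_mono) auto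
    thus ?thesis using False by (intro mult_nonneg_nonneg) auto
  qed
  hence "0 \<le> (\<Sum>i\<in>I. \<Sum>j\<in>I. v i * v j * ((w i - w j) * (w i ^ n - w j ^ n)))"
    using assms by (intro sum_nonneg mult_nonneg_nonneg[OF mult_nonneg_nonneg]) auto
  also have "\<dots> = (\<Sum>i\<in>I. \<Sum>j\<in>I. v j * (v i * w i ^ Suc n)) + (\<Sum>i\<in>I. \<Sum>j\<in>I. v i * (v j * w j ^ Suc n))
      - (\<Sum>i\<in>I. \<Sum>j\<in>I. (v i * w i) * (v j * w j ^ n)) - (\<Sum>i\<in>I. \<Sum>j\<in>I. (v j * w j) * (v i * w i ^ n))"
    by (simp only: sum.distrib[symmetric] sum_subtractf[symmetric]) (intro sum.cong refl, simp add: algebra_simps)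
  also have "(\<Sum>i\<in>I. \<Sum>j\<in>I. v j * (v i * w i ^ Suc n)) = (\<Sum>i\<in>I. \<Sum>j\<in>I. v i * (v j * w j ^ Suc n))"
    by (rule sum.swap)
  also have "(\<Sum>i\<in>I. \<Sum>j\<in>I. (v j * w j) * (v i * w i ^ n)) = (\<Sum>i\<in>I. \<Sum>j\<in>I. (v i * w i) * (v j * w j ^ n))"
    by (rule sum.swap)
  finally show ?thesis by (simp add: sum_product)
qed

lemma weighted_power_mean:
  fixes v w :: "'i \<Rightarrow> real"
  assumes "\<And>i. i \<in> I \<Longrightarrow> v i \<ge> 0" "\<And>i. i \<in> I \<Longrightarrow> w i \<ge> 0"
  shows "(\<Sum>i\<in>I. v i * w i) ^ Suc k \<le> (\<Sum>i\<in>I. v i) ^ k * (\<Sum>i\<in>I. v i * w i ^ Suc k)"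
proof (induction k)
  case (Suc k)
  have nn: "0 \<le> (\<Sum>i\<in>I. v i)" "0 \<le> (\<Sum>i\<in>I. v i * w i)" using assms by (auto intro!: sum_nonneg)
  have "(\<Sum>i\<in>I. v i * w i) ^ Suc (Suc k) \<le> (\<Sum>i\<in>I. v i * w i) * ((\<Sum>i\<in>I. v i) ^ k * (\<Sum>i\<in>I. v i * w i ^ Suc k))"
    unfolding power_Suc[of _ "Suc k"] using Suc nn by (intro mult_left_mono) auto
  also have "\<dots> = (\<Sum>i\<in>I. v i) ^ k * ((\<Sum>i\<in>I. v i * w i) * (\<Sum>i\<in>I. v i * w i ^ Suc k))" by (simp add: mult_ac)
  also have "\<dots> \<le> (\<Sum>i\<in>I. v i) ^ k * ((\<Sum>i\<in>I. v i) * (\<Sum>i\<in>I. v i * w i ^ Suc (Suc k)))"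
    using nn assms by (intro mult_left_mono chebyshev_power_sum) auto
  finally show ?case by (simp add: mult_ac)
qed simp

text \<open>The form of Hoelder's inequality used by Burgess, as a power mean inequality of order
  \<open>r\<close> followed by Cauchy-Schwarz.\<close>

lemma holder_moments:
  fixes v w :: "'i \<Rightarrow> real"
  assumes "\<And>i. i \<in> I \<Longrightarrow> v i \<ge> 0" "\<And>i. i \<in> I \<Longrightarrow> w i \<ge> 0" "r > 0"
  shows "(\<Sum>i\<in>I. v i * w i) ^ (2 * r) \<le>
    (\<Sum>i\<in>I. v i) ^ (2 * r - 2) * (\<Sum>i\<in>I. (v i)\<^sup>2) * (\<Sum>i\<in>I. w i ^ (2 * r))"
proof -
  obtain k where k: "r = Suc k" using assms(3) by (cases r) auto
  have nn: "0 \<le> (\<Sum>i\<in>I. v i)" "0 \<le> (\<Sum>i\<in>I. v i * w i)" using assms by (auto intro!: sum_nonneg)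
  have "(\<Sum>i\<in>I. v i * w i) ^ (2 * r) = ((\<Sum>i\<in>I. v i * w i) ^ Suc k)\<^sup>2"
    unfolding k by (subst mult.commute) (rule power_mult)
  also have "\<dots> \<le> ((\<Sum>i\<in>I. v i) ^ k * (\<Sum>i\<in>I. v i * w i ^ Suc k))\<^sup>2"
    using nn by (intro power_mono weighted_power_mean zero_le_power assms)
  also have "\<dots> = (\<Sum>i\<in>I. v i) ^ (2 * r - 2) * (\<Sum>i\<in>I. v i * w i ^ Suc k)\<^sup>2"
    by (simp add: k power_mult_distrib mult.commute flip: power_mult)
  also have "\<dots> \<le> (\<Sum>i\<in>I. v i) ^ (2 * r - 2) * ((\<Sum>i\<in>I. (v i)\<^sup>2) * (\<Sum>i\<in>I. (w i ^ Suc k)\<^sup>2))"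
    using nn by (intro mult_left_mono Cauchy_Schwarz_ineq_sum) auto
  also have "(\<Sum>i\<in>I. (w i ^ Suc k)\<^sup>2) = (\<Sum>i\<in>I. w i ^ (2 * r))"
    by (intro sum.cong refl) (simp add: k mult.commute del: power_Suc flip: power_mult)
  finally show ?thesis by (simp only: mult.assoc)
qed

section \<open>Counting coincidences of fractions modulo a prime\<close>

lemma card_multiples:
  fixes d n :: nat
  assumes "d > 0"
  shows "card {k \<in> {1..n}. d dvd k} = n div d"
proof -
  have "{k \<in> {1..n}. d dvd k} = (\<lambda>j. d * j) ` {1..n div d}"
  proof (intro equalityI subsetI)
    fix k assume k: "k \<in> {k \<in> {1..n}. d dvd k}"
    then obtain j where j: "k = d * j" by auto
    have "j \<le> n div d" using k assms by (simp add: j less_eq_div_iff_mult_less_eq mult.commute)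
    moreover have "j \<ge> 1" using k by (cases j) (auto simp: j)
    ultimately show "k \<in> (\<lambda>j. d * j) ` {1..n div d}" using j by auto
  next
    fix k assume "k \<in> (\<lambda>j. d * j) ` {1..n div d}"
    then obtain j where "k = d * j" "j \<in> {1..n div d}" by (rule imageE)
    hence j: "k = d * j" "1 \<le> j" "j \<le> n div d" by auto
    have "d * j \<le> n" using j(3) assms by (simp add: less_eq_div_iff_mult_less_eq mult.commute)
    thus "k \<in> {k \<in> {1..n}. d dvd k}" using j assms by auto
  qed
  thus ?thesis using assms by (simp add: card_image inj_on_def)
qed

lemma sum_inverse_le_ln: "n \<ge> 1 \<Longrightarrow> (\<Sum>d\<in>{1..n}. 1 / real d) \<le> 1 + ln (real n)"
proof (induction n rule: nat_induct_at_least)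
  case (Suc n)
  have "ln (real n / real (Suc n)) \<le> real n / real (Suc n) - 1"
    using Suc by (intro ln_le_minus_one) auto
  also have "\<dots> = - 1 / real (Suc n)" by (simp add: field_simps)
  finally have "1 / real (Suc n) \<le> ln (real (Suc n)) - ln (real n)"
    using Suc by (simp add: ln_div)
  thus ?case using Suc by simp
qed simp

text \<open>\<open>gcd a b\<close> is at most the sum of all common divisors \<open>d\<close>. For a
  divisor \<open>d\<close> of \<open>a\<close> the terms \<open>d / a\<close> over the multiples
  \<open>b \<le> a\<close> of \<open>d\<close> add up to exactly 1, and a harmonic sum over
  \<open>d\<close> remains.\<close>

lemma sum_gcd_le:
  assumes "A \<ge> 1"
  shows "(\<Sum>a\<in>{1..A}. \<Sum>b\<in>{1..a}. real (gcd a b) / real a) \<le> real A * (1 + ln (real A))"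
proof -
  have "(\<Sum>a\<in>{1..A}. \<Sum>b\<in>{1..a}. real (gcd a b) / real a) \<le>
      (\<Sum>a\<in>{1..A}. \<Sum>b\<in>{1..a}. \<Sum>d\<in>{1..A}. if d dvd a \<and> d dvd b then real d / real a else 0)"
  proof (intro sum_mono)
    fix a b assume ab: "a \<in> {1..A}" "b \<in> {1..a}"
    have "gcd a b \<le> a" using ab by (intro gcd_le1_nat) auto
    also have "a \<le> A" using ab by simp
    finally have "gcd a b \<in> {1..A}" using ab by (auto simp: Suc_le_eq)
    thus "real (gcd a b) / real a \<le> (\<Sum>d\<in>{1..A}. if d dvd a \<and> d dvd b then real d / real a else 0)"
      using member_le_sum[of "gcd a b" "{1..A}" "\<lambda>d. if d dvd a \<and> d dvd b then real d / real a else 0"] by simp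
  qed
  also have "\<dots> = (\<Sum>a\<in>{1..A}. \<Sum>d\<in>{1..A}. \<Sum>b\<in>{1..a}. if d dvd a \<and> d dvd b then real d / real a else 0)"
    by (intro sum.cong refl sum.swap)
  also have "\<dots> = (\<Sum>a\<in>{1..A}. \<Sum>d\<in>{1..A}. if d dvd a then 1 else 0)"
  proof (intro sum.cong refl)
    fix a d assume ad: "a \<in> {1..A}" "d \<in> {1..A}"
    show "(\<Sum>b\<in>{1..a}. if d dvd a \<and> d dvd b then real d / real a else 0) = (if d dvd a then 1 else 0)"
    proof (cases "d dvd a")
      case True
      have "(\<Sum>b\<in>{1..a}. if d dvd b then real d / real a else 0) = (\<Sum>b\<in>{b \<in> {1..a}. d dvd b}. real d / real a)"
        by (rule sum.inter_filter[symmetric]) simp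
      also have "\<dots> = real (a div d) * (real d / real a)"
        using ad by (simp only: sum_constant) (subst card_multiples, auto)
      also have "\<dots> = 1" using True ad by (auto simp: real_of_nat_div)
      finally show ?thesis using True by simp
    qed simp
  qed
  also have "\<dots> = (\<Sum>d\<in>{1..A}. \<Sum>a\<in>{1..A}. if d dvd a then 1 else 0)" by (rule sum.swap)
  also have "\<dots> = (\<Sum>d\<in>{1..A}. real (A div d))"
  proof (rule sum.cong[OF refl])
    fix d assume "d \<in> {1..A}"
    hence "card {a \<in> {1..A}. d dvd a} = A div d" by (intro card_multiples) auto
    moreover have "(\<Sum>a\<in>{1..A}. if d dvd a then 1 else 0 :: real) = (\<Sum>a | a \<in> {1..A} \<and> d dvd a. 1)"
      by (simp only: sum.inter_filter finite_atLeastAtMost)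
    ultimately show "(\<Sum>a\<in>{1..A}. if d dvd a then 1 else 0) = real (A div d)" by simp
  qed
  also have "\<dots> \<le> (\<Sum>d\<in>{1..A}. real A * (1 / real d))"
    by (intro sum_mono) (simp add: of_nat_div_le_of_nat)
  also have "\<dots> = real A * (\<Sum>d\<in>{1..A}. 1 / real d)" by (simp add: sum_distrib_left)
  also have "\<dots> \<le> real A * (1 + ln (real A))" by (intro mult_left_mono sum_inverse_le_ln assms) auto
  finally show ?thesis .
qed

lemma sum_gcd_max_le:
  assumes "A \<ge> 1"
  shows "(\<Sum>a\<in>{1..A}. \<Sum>b\<in>{1..A}. real (gcd a b) / real (max a b)) \<le> 2 * (real A * (1 + ln (real A)))"
proof -
  let ?f = "\<lambda>a b. if b \<le> a then real (gcd a b) / real a else 0"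
  have "(\<Sum>a\<in>{1..A}. \<Sum>b\<in>{1..A}. real (gcd a b) / real (max a b)) \<le> (\<Sum>a\<in>{1..A}. \<Sum>b\<in>{1..A}. ?f a b + ?f b a)"
    by (intro sum_mono) (auto simp: max_def gcd.commute)
  also have "\<dots> = (\<Sum>a\<in>{1..A}. \<Sum>b\<in>{1..A}. ?f a b) + (\<Sum>a\<in>{1..A}. \<Sum>b\<in>{1..A}. ?f b a)"
    by (simp only: sum.distrib)
  also have "(\<Sum>a\<in>{1..A}. \<Sum>b\<in>{1..A}. ?f b a) = (\<Sum>a\<in>{1..A}. \<Sum>b\<in>{1..A}. ?f a b)"
    by (rule sum.swap)
  also have "(\<Sum>a\<in>{1..A}. \<Sum>b\<in>{1..A}. ?f a b) = (\<Sum>a\<in>{1..A}. \<Sum>b\<in>{1..a}. real (gcd a b) / real a)"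
    by (intro sum.cong refl sum.mono_neutral_cong_right) auto
  finally show ?thesis using sum_gcd_le[OF assms] by linarith
qed

lemma card_int_between:
  fixes x y :: real
  assumes "x \<le> y"
  shows "real (card {v :: int. x \<le> of_int v \<and> of_int v \<le> y}) \<le> y - x + 1"
proof -
  have "{v :: int. x \<le> of_int v \<and> of_int v \<le> y} = {\<lceil>x\<rceil>..\<lfloor>y\<rfloor>}" by (auto simp: ceiling_le_iff le_floor_iff)
  moreover have "real (nat (\<lfloor>y\<rfloor> + 1 - \<lceil>x\<rceil>)) \<le> y - x + 1" using assms by linarith
  ultimately show ?thesis by simp
qed

lemma finite_int_between: "finite {v :: int. (x :: real) \<le> of_int v \<and> of_int v \<le> (y :: real)}"
proof -
  have "{v :: int. x \<le> of_int v \<and> of_int v \<le> y} = {\<lceil>x\<rceil>..\<lfloor>y\<rfloor>}" by (auto simp: ceiling_le_iff le_floor_iff)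
  thus ?thesis by simp
qed

text \<open>A solution is determined by the quotient \<open>v\<close> of \<open>a n2 - b n1\<close>
  by \<open>p\<close> and by the block of length \<open>a\<close> that contains \<open>n1\<close>:
  \<open>v\<close> fixes \<open>n1\<close> modulo \<open>a\<close>, by coprimality, and then
  \<open>n2\<close>. The possible \<open>v\<close> lie in an interval of length at most
  \<open>2 a N / p\<close>.\<close>

lemma count_coprime_pairs:
  fixes a b p N :: nat and M :: int
  assumes ab: "1 \<le> b" "b \<le> a" "coprime a b" and p: "p > 0"
  shows "real (card {(n1, n2). n1 \<in> {M..<M + int N} \<and> n2 \<in> {M..<M + int N} \<and> int p dvd int a * n2 - int b * n1})
     \<le> (2 * real a * real N / real p + 1) * (real N / real a + 1)"
proof -
  let ?X = "{(n1, n2). n1 \<in> {M..<M + int N} \<and> n2 \<in> {M..<M + int N} \<and> int p dvd int a * n2 - int b * n1}"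
  define lo where "lo = (real a * of_int M - real b * of_int (M + int N)) / real p"
  define hi where "hi = (real a * of_int (M + int N) - real b * of_int M) / real p"
  let ?V = "{v :: int. lo \<le> of_int v \<and> of_int v \<le> hi}" and ?W = "{v :: int. 0 \<le> (of_int v :: real) \<and> of_int v \<le> real N / real a}"
  define F where "F z = ((int a * snd z - int b * fst z) div int p, (fst z - M) div int a)" for z :: "int \<times> int"
  have hl: "hi - lo = real (a + b) * real N / real p"
    by (simp add: hi_def lo_def diff_divide_distrib[symmetric] algebra_simps)
  have "inj_on F ?X"
  proof (rule inj_onI)
    fix z z' assume z: "z \<in> ?X" "z' \<in> ?X" "F z = F z'"
    obtain n1 n2 m1 m2 where zz: "z = (n1, n2)" "z' = (m1, m2)" by (cases z, cases z')
    have "int p dvd int a * n2 - int b * n1" "int p dvd int a * m2 - int b * m1"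
      and "(int a * n2 - int b * n1) div int p = (int a * m2 - int b * m1) div int p"
      using z by (simp_all add: zz F_def)
    hence "int a * n2 - int b * n1 = int a * m2 - int b * m1"
      by (metis dvd_mult_div_cancel)
    hence eq: "int a * (n2 - m2) = int b * (n1 - m1)" by (simp add: algebra_simps)
    hence "int a dvd int b * (n1 - m1)" by (metis dvd_triv_left)
    hence "int a dvd n1 - m1" using ab by (simp add: coprime_dvd_mult_right_iff)
    hence "(n1 - M) mod int a = (m1 - M) mod int a" by (simp add: mod_eq_dvd_iff)
    moreover have "(n1 - M) div int a = (m1 - M) div int a" using z(3) by (simp add: zz F_def)
    ultimately have "n1 - M = m1 - M" by (metis mult_div_mod_eq)
    thus "z = z'" using eq ab by (simp add: zz)
  qed
  moreover have "F ` ?X \<subseteq> ?V \<times> ?W"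
  proof
    fix w assume "w \<in> F ` ?X"
    then obtain n1 n2 where n: "w = F (n1, n2)" "n1 \<in> {M..<M + int N}" "n2 \<in> {M..<M + int N}" "int p dvd int a * n2 - int b * n1"
      by auto
    define v where "v = (int a * n2 - int b * n1) div int p"
    have v: "int p * v = int a * n2 - int b * n1" using n(4) by (simp add: v_def)
    hence "real_of_int (int p * v) = real_of_int (int a * n2 - int b * n1)" by (rule arg_cong)
    hence v': "real p * of_int v = real a * of_int n2 - real b * of_int n1" by simp
    have r: "of_int M \<le> real_of_int n1" "real_of_int n1 \<le> of_int (M + int N)"
      "of_int M \<le> real_of_int n2" "real_of_int n2 \<le> of_int (M + int N)" using n by (auto simp del: of_int_add)
    have "real a * of_int M - real b * of_int (M + int N) \<le> real p * of_int v"
      unfolding v' by (intro diff_mono mult_left_mono r) auto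
    hence "lo \<le> of_int v" using p by (simp add: lo_def field_simps)
    moreover have "real p * of_int v \<le> real a * of_int (M + int N) - real b * of_int M"
      unfolding v' by (intro diff_mono mult_left_mono r) auto
    hence "of_int v \<le> hi" using p by (simp add: hi_def field_simps)
    moreover have "0 \<le> (n1 - M) div int a" using n ab by (simp add: pos_imp_zdiv_nonneg_iff)
    moreover have "real_of_int ((n1 - M) div int a) \<le> real N / real a"
    proof -
      have "real_of_int ((n1 - M) div int a) \<le> real_of_int (n1 - M) / real_of_int (int a)"
        by (rule real_of_int_div4)
      also have "\<dots> \<le> real N / real a" using n ab by (auto intro!: divide_right_mono)
      finally show ?thesis .
    qed
    ultimately show "w \<in> ?V \<times> ?W" by (simp add: n(1) F_def v_def)
  qed
  ultimately have "card ?X \<le> card (?V \<times> ?W)"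
    by (intro card_inj_on_le[of F] finite_cartesian_product finite_int_between)
  hence "real (card ?X) \<le> real (card ?V) * real (card ?W)"
    by (simp only: card_cartesian_product of_nat_le_iff flip: of_nat_mult)
  also have "\<dots> \<le> (hi - lo + 1) * (real N / real a - 0 + 1)"
  proof (intro mult_mono card_int_between)
    have "hi - lo \<ge> 0" unfolding hl by simp
    thus "lo \<le> hi" "0 \<le> hi - lo + 1" by auto
  qed auto
  also have "\<dots> \<le> (2 * real a * real N / real p + 1) * (real N / real a + 1)"
  proof (intro mult_mono add_mono order_refl)
    show "hi - lo \<le> 2 * real a * real N / real p"
      unfolding hl using ab by (intro divide_right_mono mult_right_mono) auto
  qed auto
  finally show ?thesis .
qed

text \<open>Dividing by the gcd, which is coprime to \<open>p\<close>, leads to coprime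
  coefficients, and exchanging the variables leads to \<open>a2 \<le> a1\<close>.\<close>

lemma count_pairs:
  fixes a1 a2 p N :: nat and M :: int
  assumes a: "1 \<le> a1" "a1 < p" "1 \<le> a2" "a2 < p" and p: "prime p"
  shows "real (card {(n1, n2). n1 \<in> {M..<M + int N} \<and> n2 \<in> {M..<M + int N} \<and> int p dvd int a1 * n2 - int a2 * n1})
     \<le> 2 * (real N)\<^sup>2 / real p + 2 * real (max a1 a2) * real N / real p + real N * (real (gcd a1 a2) / real (max a1 a2)) + 1"
    (is "real (card (?X a1 a2)) \<le> ?R a1 a2")
proof -
  have main: "real (card (?X a1 a2)) \<le> ?R a1 a2" if a: "1 \<le> a1" "a1 < p" "1 \<le> a2" "a2 \<le> a1" for a1 a2
  proof -
    define g where "g = gcd a1 a2"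
    have g0: "g > 0" using a by (simp add: g_def)
    obtain x y where xy: "a1 = x * g" "a2 = y * g" "coprime x y"
      using gcd_coprime_exists[of a1 a2] g0 unfolding g_def by blast
    have xy1: "1 \<le> y" "y \<le> x" "1 \<le> x" using a xy g0 by (auto simp: Suc_le_eq intro: Nat.gr0I)
    have "g \<le> a1" unfolding g_def using a by (intro gcd_le1_nat) auto
    hence "\<not> p dvd g" using g0 a by (intro nat_dvd_not_less) auto
    hence "coprime (int p) (int g)" using p prime_imp_coprime[of p g] by (simp add: coprime_int_iff)
    have X: "?X a1 a2 = ?X x y"
    proof -
      have "int p dvd int a1 * n2 - int a2 * n1 \<longleftrightarrow> int p dvd int x * n2 - int y * n1" for n1 n2
      proof -
        have "int a1 * n2 - int a2 * n1 = int g * (int x * n2 - int y * n1)" by (simp add: xy algebra_simps)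
        thus ?thesis using \<open>coprime (int p) (int g)\<close> by (simp add: coprime_dvd_mult_right_iff)
      qed
      thus ?thesis by simp
    qed
    have p0: "real p > 0" and x0: "real x > 0" using a xy1 by auto
    have "real (card (?X x y)) \<le> (2 * real x * real N / real p + 1) * (real N / real x + 1)"
      using xy xy1 a by (intro count_coprime_pairs) auto
    also have "\<dots> = 2 * (real N)\<^sup>2 / real p + 2 * real x * real N / real p + real N / real x + 1"
      using p0 x0 by (simp add: field_simps power2_eq_square)
    also have "\<dots> \<le> ?R a1 a2"
    proof -
      have "max a1 a2 = a1" using a by simp
      moreover have "real N / real x = real N * (real (gcd a1 a2) / real a1)"
      proof -
        have "real a1 = real x * real g" by (simp add: xy(1))
        thus ?thesis using g0 by (simp only: g_def[symmetric]) simp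
      qed
      moreover have "2 * real x * real N / real p \<le> 2 * real a1 * real N / real p"
      proof -
        have "x \<le> a1" using g0 by (simp add: xy(1))
        thus ?thesis by (intro divide_right_mono mult_right_mono mult_left_mono) auto
      qed
      ultimately show ?thesis by simp
    qed
    finally show ?thesis unfolding X .
  qed
  show ?thesis
  proof (cases "a2 \<le> a1")
    case True
    thus ?thesis using main[of a1 a2] a by simp
  next
    case False
    have dvd_swap: "int p dvd int a1 * n2 - int a2 * n1 \<longleftrightarrow> int p dvd int a2 * n1 - int a1 * n2" for n1 n2
      using dvd_minus_iff[of "int p" "int a1 * n2 - int a2 * n1"] by simp
    have "bij_betw prod.swap (?X a1 a2) (?X a2 a1)"
      by (rule bij_betwI[of _ _ _ prod.swap]) (auto simp: dvd_swap)
    hence "card (?X a1 a2) = card (?X a2 a1)" by (rule bij_betw_same_card)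
    moreover have "max a1 a2 = max a2 a1" "gcd a1 a2 = gcd a2 a1" by (simp_all add: max.commute gcd.commute)
    moreover have "real (card (?X a2 a1)) \<le> ?R a2 a1" using a False by (intro main) auto
    ultimately show ?thesis by (simp only:)
  qed
qed

text \<open>The congruence says that \<open>n1/a1\<close> and \<open>n2/a2\<close> coincide modulo
  \<open>p\<close>, so the sum is the second moment of the number of representations of a residue as
  \<open>n/a\<close>. The logarithm stems from the gcd term.\<close>

lemma sum_count_pairs:
  fixes A p N :: nat and M :: int
  assumes A: "1 \<le> A" "A < p" "A \<le> N" and p: "prime p"
  shows "(\<Sum>a1\<in>{1..A}. \<Sum>a2\<in>{1..A}. real (card {(n1, n2). n1 \<in> {M..<M + int N} \<and> n2 \<in> {M..<M + int N} \<and> int p dvd int a1 * n2 - int a2 * n1}))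
     \<le> 4 * (real A * real N)\<^sup>2 / real p + real A * real N * (3 + 2 * ln (real A))"
proof -
  have p0: "real p > 0" using A by simp
  have "(\<Sum>a1\<in>{1..A}. \<Sum>a2\<in>{1..A}. real (card {(n1, n2). n1 \<in> {M..<M + int N} \<and> n2 \<in> {M..<M + int N} \<and> int p dvd int a1 * n2 - int a2 * n1}))
    \<le> (\<Sum>a1\<in>{1..A}. \<Sum>a2\<in>{1..A}. (2 * (real N)\<^sup>2 / real p + 2 * real A * real N / real p + 1) + real N * (real (gcd a1 a2) / real (max a1 a2)))"
  proof (intro sum_mono)
    fix a1 a2 assume a: "a1 \<in> {1..A}" "a2 \<in> {1..A}"
    have "2 * real (max a1 a2) * real N / real p \<le> 2 * real A * real N / real p"
      using a by (intro divide_right_mono mult_right_mono mult_left_mono) auto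
    thus "real (card {(n1, n2). n1 \<in> {M..<M + int N} \<and> n2 \<in> {M..<M + int N} \<and> int p dvd int a1 * n2 - int a2 * n1})
      \<le> (2 * (real N)\<^sup>2 / real p + 2 * real A * real N / real p + 1) + real N * (real (gcd a1 a2) / real (max a1 a2))"
    proof -
      have "1 \<le> a1" "a1 < p" "1 \<le> a2" "a2 < p" using a A by auto
      from count_pairs[OF this p, of M N] \<open>_ \<le> 2 * real A * real N / real p\<close> show ?thesis by linarith
    qed
  qed
  also have "\<dots> = (real A)\<^sup>2 * (2 * (real N)\<^sup>2 / real p + 2 * real A * real N / real p + 1)
      + real N * (\<Sum>a1\<in>{1..A}. \<Sum>a2\<in>{1..A}. real (gcd a1 a2) / real (max a1 a2))"
    by (simp only: sum.distrib sum_distrib_left sum_constant card_atLeastAtMost power2_eq_square) (simp add: algebra_simps)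
  also have "\<dots> \<le> (real A)\<^sup>2 * (2 * (real N)\<^sup>2 / real p + 2 * real N * real N / real p + 1)
      + real N * (2 * (real A * (1 + ln (real A))))"
    using A by (intro add_mono mult_left_mono sum_gcd_max_le divide_right_mono mult_right_mono) auto
  also have "\<dots> = 4 * (real A * real N)\<^sup>2 / real p + real A * real A + real N * (2 * (real A * (1 + ln (real A))))"
    by (simp add: power2_eq_square algebra_simps)
  also have "\<dots> \<le> 4 * (real A * real N)\<^sup>2 / real p + real A * real N + real N * (2 * (real A * (1 + ln (real A))))"
    using A by (intro add_mono mult_left_mono order_refl) auto
  also have "\<dots> = 4 * (real A * real N)\<^sup>2 / real p + real A * real N * (3 + 2 * ln (real A))"
    by (simp add: algebra_simps)
  finally show ?thesis .
qed

section \<open>Burgess's shift argument and the induction on the length\<close>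

context np_character
begin

text \<open>Shifting the interval by \<open>a * b\<close> changes the sum by two sums of length at
  most \<open>A * B\<close>, each bounded by \<open>E\<close>. Averaging over \<open>a\<close> and
  \<open>b\<close> and writing \<open>\<psi>(n + a b) = \<psi>(a) \<psi>(n/a + b)\<close> leaves
  short sums over \<open>b\<close> at the residues \<open>n/a\<close>, weighted by their number of
  representations; \<open>holder_moments\<close> separates the weights from the moments.\<close>

lemma burgess_step:
  assumes A: "1 \<le> A" "A < p" "A \<le> N" and B: "1 \<le> B" "B \<le> p" and r: "r > 0"
    and E: "\<And>M h. h \<le> A * B \<Longrightarrow> norm (S M h) \<le> E"
  shows "\<exists>V\<ge>0. norm (S M N) \<le> V / (real A * real B) + 2 * E \<and>
    V ^ (2 * r) \<le> (real A * real N) ^ (2 * r - 2) * (4 * (real A * real N)\<^sup>2 / real p + real A * real N * (3 + 2 * ln (real A)))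
      * (real (r ^ (2 * r)) * real B ^ r * real p + 2 * real r * real B ^ (2 * r) * sqrt (real p))"
proof -
  define W where "W x = norm (\<Sum>b\<in>{0..<int B}. \<psi> (x + b))" for x
  have W_mod: "W (x mod int p) = W x" for x
    unfolding W_def by (intro arg_cong[where f = norm] sum.cong refl \<psi>_cong) (simp add: mod_add_left_eq)
  let ?I = "{M..<M + int N}" and ?X = "{0..<int p}"
  let ?D = "{1..A} \<times> ?I"
  have cop: "coprime (int a) (int p)" if "a \<in> {1..A}" for a
    using that A coprime_residue[of "int a"] by auto
  have "\<forall>a\<in>{1..A}. \<exists>v. [int a * v = 1] (mod int p)" using cop cong_solve_coprime_int by blast
  hence "\<exists>iv. \<forall>a\<in>{1..A}. [int a * iv a = 1] (mod int p)" by (rule bchoice)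
  then obtain iv where iv0: "\<forall>a\<in>{1..A}. [int a * iv a = 1] (mod int p)" ..
  have iv: "[int a * iv a = 1] (mod int p)" if "a \<in> {1..A}" for a using iv0 that by (rule bspec)
  \<comment> \<open>\<open>\<phi> (a, n)\<close> is the residue of \<open>n/a\<close>;
    \<open>\<nu>\<close> below counts its representations.\<close>
  define \<phi> where "\<phi> d = (iv (fst d) * snd d) mod int p" for d
  have \<phi>X: "\<phi> d \<in> ?X" for d using p_pos by (simp add: \<phi>_def)
  have W\<phi>: "norm (\<Sum>b\<in>{0..<int B}. \<psi> (n + int a * b)) = W (\<phi> (a, n))" if a: "a \<in> {1..A}" for a n
  proof -
    have "(\<Sum>b\<in>{0..<int B}. \<psi> (n + int a * b)) = (\<Sum>b\<in>{0..<int B}. \<psi> (int a) * \<psi> (iv a * n + b))"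
    proof (rule sum.cong[OF refl])
      fix b
      have "[int a * (iv a * n + b) = n + int a * b] (mod int p)"
        using cong_add[OF cong_scalar_right[OF iv[OF a], of n] cong_refl[of "int a * b"]] by (simp add: algebra_simps)
      hence "\<psi> (n + int a * b) = \<psi> (int a * (iv a * n + b))"
        by (intro \<psi>_cong) (simp add: unique_euclidean_semiring_class.cong_def)
      thus "\<psi> (n + int a * b) = \<psi> (int a) * \<psi> (iv a * n + b)" by (simp add: \<psi>_mult)
    qed
    also have "norm \<dots> = W (iv a * n)"
      using norm_\<psi>_coprime[OF cop[OF a]] by (simp add: W_def norm_mult flip: sum_distrib_left)
    also have "\<dots> = W (\<phi> (a, n))" by (simp add: \<phi>_def W_mod)
    finally show ?thesis .
  qed
  define \<nu> where "\<nu> x = real (card {d \<in> ?D. \<phi> d = x})" for x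
  define V where "V = (\<Sum>x\<in>?X. \<nu> x * W x)"
  have V_eq: "V = (\<Sum>d\<in>?D. W (\<phi> d))"
  proof -
    have "(\<Sum>d\<in>?D. W (\<phi> d)) = (\<Sum>x\<in>?X. \<Sum>d | d \<in> ?D \<and> \<phi> d = x. W (\<phi> d))"
      using \<phi>X by (intro sum.group[symmetric]) auto
    also have "\<dots> = V" unfolding V_def \<nu>_def by (intro sum.cong refl) simp
    finally show ?thesis ..
  qed
  have W0: "W x \<ge> 0" for x by (simp add: W_def)
  have \<nu>0: "\<nu> x \<ge> 0" for x by (simp add: \<nu>_def)
  have V0: "V \<ge> 0" unfolding V_def by (intro sum_nonneg mult_nonneg_nonneg W0 \<nu>0)
  have sum_\<nu>: "(\<Sum>x\<in>?X. \<nu> x) = real A * real N"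
  proof -
    have "(\<Sum>x\<in>?X. \<nu> x) = (\<Sum>x\<in>?X. \<Sum>d | d \<in> ?D \<and> \<phi> d = x. 1)" by (simp add: \<nu>_def)
    also have "\<dots> = (\<Sum>d\<in>?D. 1)" using \<phi>X by (intro sum.group) auto
    finally show ?thesis by (simp add: card_cartesian_product)
  qed
  have sum_\<nu>2: "(\<Sum>x\<in>?X. (\<nu> x)\<^sup>2) \<le> 4 * (real A * real N)\<^sup>2 / real p + real A * real N * (3 + 2 * ln (real A))"
  proof -
    have "(\<Sum>x\<in>?X. (\<nu> x)\<^sup>2) = (\<Sum>x\<in>?X. \<Sum>d | d \<in> ?D \<and> \<phi> d = x. \<nu> (\<phi> d))"
      by (intro sum.cong refl) (simp add: \<nu>_def power2_eq_square)
    also have "\<dots> = (\<Sum>d\<in>?D. \<nu> (\<phi> d))" using \<phi>X by (intro sum.group) auto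
    also have "\<dots> = (\<Sum>d\<in>?D. \<Sum>d'\<in>?D. if \<phi> d' = \<phi> d then 1 else 0)"
    proof (rule sum.cong[OF refl])
      fix d
      have "\<nu> (\<phi> d) = (\<Sum>d' | d' \<in> ?D \<and> \<phi> d' = \<phi> d. 1)" by (simp add: \<nu>_def)
      also have "\<dots> = (\<Sum>d'\<in>?D. if \<phi> d' = \<phi> d then 1 else 0)" by (rule sum.inter_filter) auto
      finally show "\<nu> (\<phi> d) = (\<Sum>d'\<in>?D. if \<phi> d' = \<phi> d then 1 else 0)" .
    qed
    also have "\<dots> = (\<Sum>a1\<in>{1..A}. \<Sum>n1\<in>?I. \<Sum>a2\<in>{1..A}. \<Sum>n2\<in>?I. if \<phi> (a2, n2) = \<phi> (a1, n1) then 1 else 0)"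
    proof -
      have "(\<Sum>d\<in>?D. g d) = (\<Sum>a\<in>{1..A}. \<Sum>n\<in>?I. g (a, n))" for g :: "nat \<times> int \<Rightarrow> real"
        by (simp add: sum.cartesian_product)
      thus ?thesis by (simp only:)
    qed
    also have "\<dots> = (\<Sum>a1\<in>{1..A}. \<Sum>a2\<in>{1..A}. \<Sum>n1\<in>?I. \<Sum>n2\<in>?I. if \<phi> (a2, n2) = \<phi> (a1, n1) then 1 else 0)"
      by (intro sum.cong refl sum.swap)
    also have "\<dots> \<le> (\<Sum>a1\<in>{1..A}. \<Sum>a2\<in>{1..A}. real (card {(n1, n2). n1 \<in> ?I \<and> n2 \<in> ?I \<and> int p dvd int a1 * n2 - int a2 * n1}))"
    proof (intro sum_mono)
      fix a1 a2 assume a: "a1 \<in> {1..A}" "a2 \<in> {1..A}"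
      let ?Y = "{(n1, n2). n1 \<in> ?I \<and> n2 \<in> ?I \<and> int p dvd int a1 * n2 - int a2 * n1}"
      have "(\<Sum>n1\<in>?I. \<Sum>n2\<in>?I. if \<phi> (a2, n2) = \<phi> (a1, n1) then 1 else 0 :: real) =
        (\<Sum>z\<in>?I \<times> ?I. if \<phi> (a2, snd z) = \<phi> (a1, fst z) then 1 else 0)"
        by (simp add: sum.cartesian_product case_prod_beta)
      also have "\<dots> = real (card {z \<in> ?I \<times> ?I. \<phi> (a2, snd z) = \<phi> (a1, fst z)})"
        by (subst sum.inter_filter[symmetric]) auto
      also have "\<dots> \<le> real (card ?Y)"
      proof (intro of_nat_mono card_mono)
        show "finite ?Y" by (rule finite_subset[of _ "?I \<times> ?I"]) auto
        show "{z \<in> ?I \<times> ?I. \<phi> (a2, snd z) = \<phi> (a1, fst z)} \<subseteq> ?Y"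
        proof
          fix z assume z: "z \<in> {z \<in> ?I \<times> ?I. \<phi> (a2, snd z) = \<phi> (a1, fst z)}"
          obtain n1 n2 where zz: "z = (n1, n2)" by (cases z)
          have eq: "[iv a2 * n2 = iv a1 * n1] (mod int p)"
            using z by (simp add: zz \<phi>_def unique_euclidean_semiring_class.cong_def)
          have "[int a1 * n2 = (int a2 * iv a2) * (int a1 * n2)] (mod int p)"
            using cong_scalar_right[OF iv[OF a(2)], of "int a1 * n2"] by (simp add: cong_sym)
          also have "(int a2 * iv a2) * (int a1 * n2) = (int a1 * int a2) * (iv a2 * n2)" by (simp add: mult_ac)
          also have "[\<dots> = (int a1 * int a2) * (iv a1 * n1)] (mod int p)" using eq by (rule cong_scalar_left)
          also have "(int a1 * int a2) * (iv a1 * n1) = (int a1 * iv a1) * (int a2 * n1)" by (simp add: mult_ac)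
          also have "[\<dots> = int a2 * n1] (mod int p)"
            using cong_scalar_right[OF iv[OF a(1)], of "int a2 * n1"] by simp
          finally have "int p dvd int a1 * n2 - int a2 * n1" by (simp add: cong_iff_dvd_diff)
          thus "z \<in> ?Y" using z by (simp add: zz)
        qed
      qed
      finally show "(\<Sum>n1\<in>?I. \<Sum>n2\<in>?I. if \<phi> (a2, n2) = \<phi> (a1, n1) then 1 else 0) \<le> real (card ?Y)" .
    qed
    also have "\<dots> \<le> 4 * (real A * real N)\<^sup>2 / real p + real A * real N * (3 + 2 * ln (real A))"
      by (rule sum_count_pairs[OF A prime_p])
    finally show ?thesis .
  qed
  have power_V: "V ^ (2 * r) \<le> (real A * real N) ^ (2 * r - 2) * (4 * (real A * real N)\<^sup>2 / real p + real A * real N * (3 + 2 * ln (real A)))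
      * (real (r ^ (2 * r)) * real B ^ r * real p + 2 * real r * real B ^ (2 * r) * sqrt (real p))"
  proof -
    have "V ^ (2 * r) \<le> (\<Sum>x\<in>?X. \<nu> x) ^ (2 * r - 2) * (\<Sum>x\<in>?X. (\<nu> x)\<^sup>2) * (\<Sum>x\<in>?X. W x ^ (2 * r))"
      unfolding V_def by (intro holder_moments \<nu>0 W0 r)
    also have "\<dots> \<le> (\<Sum>x\<in>?X. \<nu> x) ^ (2 * r - 2) * (4 * (real A * real N)\<^sup>2 / real p + real A * real N * (3 + 2 * ln (real A)))
      * (real (r ^ (2 * r)) * real B ^ r * real p + 2 * real r * real B ^ (2 * r) * sqrt (real p))"
    proof (rule mult_mono)
      show "(\<Sum>x\<in>?X. \<nu> x) ^ (2 * r - 2) * (\<Sum>x\<in>?X. (\<nu> x)\<^sup>2) \<le>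
        (\<Sum>x\<in>?X. \<nu> x) ^ (2 * r - 2) * (4 * (real A * real N)\<^sup>2 / real p + real A * real N * (3 + 2 * ln (real A)))"
        unfolding sum_\<nu> by (intro mult_left_mono sum_\<nu>2) auto
      show "(\<Sum>x\<in>?X. W x ^ (2 * r)) \<le> real (r ^ (2 * r)) * real B ^ r * real p + 2 * real r * real B ^ (2 * r) * sqrt (real p)"
        unfolding W_def by (rule moment_bound[OF B(2) r])
      have "0 \<le> (\<Sum>x\<in>?X. (\<nu> x)\<^sup>2)" by (intro sum_nonneg) auto
      thus "0 \<le> (\<Sum>x\<in>?X. \<nu> x) ^ (2 * r - 2) * (4 * (real A * real N)\<^sup>2 / real p + real A * real N * (3 + 2 * ln (real A)))"
        using sum_\<nu>2 unfolding sum_\<nu> by (intro mult_nonneg_nonneg) auto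
      show "0 \<le> (\<Sum>x\<in>?X. W x ^ (2 * r))" by (intro sum_nonneg zero_le_power W0)
    qed
    finally show ?thesis unfolding sum_\<nu> .
  qed
  have sumS: "norm (\<Sum>a\<in>{1..A}. \<Sum>b\<in>{0..<int B}. S (M + int a * b) N) \<le> V"
  proof -
    have "(\<Sum>a\<in>{1..A}. \<Sum>b\<in>{0..<int B}. S (M + int a * b) N) = (\<Sum>a\<in>{1..A}. \<Sum>n\<in>?I. \<Sum>b\<in>{0..<int B}. \<psi> (n + int a * b))"
    proof (rule sum.cong[OF refl])
      fix a
      have "S (M + int a * b) N = (\<Sum>n\<in>?I. \<psi> (n + int a * b))" for b
        unfolding S_def by (rule sum.reindex_bij_witness[of _ "\<lambda>n. n - M" "\<lambda>n. n + M"]) (auto simp: algebra_simps)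
      thus "(\<Sum>b\<in>{0..<int B}. S (M + int a * b) N) = (\<Sum>n\<in>?I. \<Sum>b\<in>{0..<int B}. \<psi> (n + int a * b))"
        by (simp only:) (rule sum.swap)
    qed
    also have "norm \<dots> \<le> (\<Sum>a\<in>{1..A}. \<Sum>n\<in>?I. norm (\<Sum>b\<in>{0..<int B}. \<psi> (n + int a * b)))"
      by (intro order_trans[OF norm_sum] sum_mono order_refl)
    also have "\<dots> = (\<Sum>a\<in>{1..A}. \<Sum>n\<in>?I. W (\<phi> (a, n)))" by (intro sum.cong refl W\<phi>)
    also have "\<dots> = V" by (simp add: V_eq sum.cartesian_product case_prod_beta)
    finally show ?thesis .
  qed
  have diff: "norm (S (M + int a * b) N - S M N) \<le> 2 * E" if "a \<in> {1..A}" "b \<in> {0..<int B}" for a b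
  proof -
    define h where "h = a * nat b"
    have h: "int a * b = int h" using that by (simp add: h_def)
    have "h \<le> A * B" unfolding h_def using that by (intro mult_le_mono) auto
    hence "norm (S (M + int N) h - S M h) \<le> E + E"
      by (intro order_trans[OF norm_triangle_ineq4] add_mono E)
    thus ?thesis unfolding h S_shift by simp
  qed
  have "real A * real B * norm (S M N) = norm (\<Sum>a\<in>{1..A}. \<Sum>b\<in>{0..<int B}. S M N)"
    by (simp add: norm_mult)
  also have "\<dots> = norm ((\<Sum>a\<in>{1..A}. \<Sum>b\<in>{0..<int B}. S (M + int a * b) N)
      - (\<Sum>a\<in>{1..A}. \<Sum>b\<in>{0..<int B}. S (M + int a * b) N - S M N))"
    by (simp add: sum_subtractf)
  also have "\<dots> \<le> V + (\<Sum>a\<in>{1..A}. \<Sum>b\<in>{0..<int B}. 2 * E)"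
    by (intro order_trans[OF norm_triangle_ineq4] add_mono sumS order_trans[OF norm_sum] sum_mono diff)
  also have "\<dots> = V + real A * real B * (2 * E)" by simp
  finally have "norm (S M N) \<le> V / (real A * real B) + 2 * E"
    using A B by (simp add: field_simps)
  with V0 power_V show ?thesis by blast
qed

end

text \<open>A third of the constant absorbs the main term, which comes out as 94 times the bracket,
  whence \<open>282 = 3 * 94\<close>; two thirds carry the induction hypothesis. The summand 9
  ensures \<open>c ^ r \<ge> 9\<close>, which guarantees \<open>A \<ge> 1\<close> in the induction
  step.\<close>

definition burgess_const :: "nat \<Rightarrow> real" where
  "burgess_const r = 282 * (real (r ^ (2 * r)) * 2 ^ r + 2 * real r) + 9"

lemma burgess_const_ge: "burgess_const r \<ge> 9"
proof -
  have "0 \<le> 282 * (real (r ^ (2 * r)) * 2 ^ r + 2 * real r)"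
    by (intro add_nonneg_nonneg mult_nonneg_nonneg) auto
  thus ?thesis by (simp only: burgess_const_def le_add_same_cancel2)
qed

lemma floor_ge_half:
  fixes x :: real
  assumes "x \<ge> 1"
  shows "real (nat \<lfloor>x\<rfloor>) \<ge> x / 2" "real (nat \<lfloor>x\<rfloor>) \<le> x" "nat \<lfloor>x\<rfloor> \<ge> 1"
proof -
  have f1: "1 \<le> \<lfloor>x\<rfloor>" using assms by simp
  hence eq: "real (nat \<lfloor>x\<rfloor>) = real_of_int \<lfloor>x\<rfloor>" by simp
  have "1 \<le> real_of_int \<lfloor>x\<rfloor>" using f1 by simp
  moreover have "x < real_of_int \<lfloor>x\<rfloor> + 1" by linarith
  ultimately show "real (nat \<lfloor>x\<rfloor>) \<ge> x / 2" unfolding eq by linarith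
  show "real (nat \<lfloor>x\<rfloor>) \<le> x" unfolding eq by simp
  show "nat \<lfloor>x\<rfloor> \<ge> 1" using f1 by linarith
qed

lemma powr_pow: "x > 0 \<Longrightarrow> (x powr a) ^ k = x powr (a * real k)"
  by (simp add: powr_powr flip: powr_realpow)

context np_character
begin

definition Q :: "nat \<Rightarrow> real" where
  "Q r = real p powr ((real r + 1) / (4 * (real r)\<^sup>2)) * ln (real p) powr (1 / real r)"

lemma Q_pos: "Q r > 0"
  unfolding Q_def using p3 by (intro mult_pos_pos) simp_all

lemma bound_power:
  assumes r: "r \<ge> 2" and n: "n > 0"
  shows "(n powr (1 - 1 / real r) * Q r) ^ (2 * r) = n ^ (2 * r - 2) * real p powr (1 / 2 + 1 / (2 * real r)) * (ln (real p))\<^sup>2"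
proof -
  have L: "ln (real p) > 0" using ln_p by linarith
  have P: "real p > 0" using p_pos by simp
  have r0: "real r > 0" using r by simp
  have e1: "(1 - 1 / real r) * real (2 * r) = real (2 * r - 2)" using r by (simp add: field_simps of_nat_diff)
  have e2: "(real r + 1) / (4 * (real r)\<^sup>2) * real (2 * r) = 1 / 2 + 1 / (2 * real r)"
    using r0 by (simp add: field_simps power2_eq_square)
  have e3: "1 / real r * real (2 * r) = real 2" using r0 by simp
  show ?thesis
    unfolding Q_def power_mult_distrib powr_pow[OF n] powr_pow[OF P] powr_pow[OF L] e1 e2 e3
    using n L by (simp add: powr_realpow)
qed

text \<open>The trivial bound \<open>N = N powr (1 - 1/r) * N powr (1/r)\<close> is enough here,
  because the \<open>r\<close>-th root of the assumed bound on \<open>N\<close> is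
  \<open>c * Q r\<close>.\<close>

lemma burgess_small:
  assumes r: "r \<ge> 2" and c: "c \<ge> 0" and N: "real N \<le> c ^ r * (real p powr ((real r + 1) / (4 * real r)) * ln (real p))"
  shows "norm (S M N) \<le> c * (real N powr (1 - 1 / real r) * Q r)"
proof (cases "N = 0")
  case False
  have L: "ln (real p) > 0" using ln_p by linarith
  have r0: "real r > 0" using r by simp
  have "real N powr (1 / real r) \<le> (c ^ r * (real p powr ((real r + 1) / (4 * real r)) * ln (real p))) powr (1 / real r)"
    using N by (intro powr_mono2) auto
  also have "\<dots> = c * Q r"
  proof -
    have "(c ^ r) powr (1 / real r) = c"
    proof (cases "c = 0")
      case False
      thus ?thesis using c r by (simp add: powr_powr flip: powr_realpow)
    qed (use r in auto)
    moreover have "(real p powr ((real r + 1) / (4 * real r))) powr (1 / real r) = real p powr ((real r + 1) / (4 * (real r)\<^sup>2))"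
      by (simp add: powr_powr power2_eq_square mult.assoc)
    ultimately show ?thesis using c L by (simp add: powr_mult Q_def)
  qed
  finally have *: "real N powr (1 / real r) \<le> c * Q r" .
  have "norm (S M N) \<le> real N powr ((1 - 1 / real r) + 1 / real r)" using norm_S_le[of M N] False by simp
  also have "\<dots> = real N powr (1 - 1 / real r) * real N powr (1 / real r)" by (rule powr_add)
  also have "\<dots> \<le> real N powr (1 - 1 / real r) * (c * Q r)" using * by (intro mult_left_mono) auto
  finally show ?thesis by (simp add: mult_ac)
qed simp

text \<open>At the lower end of this range \<open>N powr (1 - 1/r) * Q r\<close> equals
  \<open>sqrt p * ln p\<close>, so \<open>polya_vinogradov\<close> is enough from there on.\<close>

lemma burgess_large:
  assumes r: "r \<ge> 2" and N: "real N \<ge> real p powr (1 / 2 + 1 / (4 * real r)) * ln (real p)"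
  shows "norm (S M N) \<le> 4 * (real N powr (1 - 1 / real r) * Q r)"
proof -
  have L: "ln (real p) > 0" using ln_p by linarith
  have P: "real p > 0" using p_pos by simp
  have r0: "real r > 0" using r by simp
  have "(1 / 2 + 1 / (4 * real r)) * (1 - 1 / real r) + (real r + 1) / (4 * (real r)\<^sup>2) = 1 / 2"
    using r0 by (simp add: field_simps power2_eq_square)
  hence "sqrt (real p) * ln (real p) =
      real p powr ((1 / 2 + 1 / (4 * real r)) * (1 - 1 / real r) + (real r + 1) / (4 * (real r)\<^sup>2)) * ln (real p) powr ((1 - 1 / real r) + 1 / real r)"
    using P L by (simp only:) (simp add: powr_half_sqrt)
  also have "\<dots> = (real p powr (1 / 2 + 1 / (4 * real r)) * ln (real p)) powr (1 - 1 / real r) * Q r"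
  proof -
    have "(real p powr (1 / 2 + 1 / (4 * real r)) * ln (real p)) powr (1 - 1 / real r) =
      real p powr ((1 / 2 + 1 / (4 * real r)) * (1 - 1 / real r)) * ln (real p) powr (1 - 1 / real r)"
      using P L by (subst powr_mult) (auto simp only: powr_powr less_imp_le powr_ge_zero)
    thus ?thesis unfolding powr_add[of _ "_ * _"] powr_add[of "ln _"] Q_def by (simp only: mult_ac)
  qed
  also have "\<dots> \<le> real N powr (1 - 1 / real r) * Q r"
    using N Q_pos[of r] r L by (intro mult_right_mono powr_mono2) auto
  finally show ?thesis using polya_vinogradov[of M N] by linarith
qed

text \<open>\<open>B\<close> of size \<open>p powr (1/(2 r))\<close> balances the two terms
  \<open>B^r * p\<close> and \<open>B^(2 r) * sqrt p\<close> of the moment bound. Since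
  \<open>A * B\<close> has the order of \<open>N\<close>, and \<open>N\<close> is below the range of
  \<open>burgess_large\<close>, both terms for the representations are
  \<open>O(p powr (1/(2 r)) * (ln p)^2)\<close> after division by \<open>A^2\<close>. The root of
  order \<open>2 r\<close> of \<open>(ln p)^2\<close> is the logarithmic factor of
  \<open>Q r\<close>.\<close>

lemma burgess_main_term:
  assumes r: "r \<ge> 2" and A: "A \<ge> 1" "A < p" "real A \<ge> real N / (18 * real B)"
    and B: "B \<ge> 1" "real B \<ge> real p powr (1 / (2 * real r)) / 2" "real B \<le> real p powr (1 / (2 * real r))"
    and N: "N > 0" "real N < real p powr (1 / 2 + 1 / (4 * real r)) * ln (real p)"
    and V: "V \<ge> 0" "V ^ (2 * r) \<le> (real A * real N) ^ (2 * r - 2) * (4 * (real A * real N)\<^sup>2 / real p + real A * real N * (3 + 2 * ln (real A)))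
      * (real (r ^ (2 * r)) * real B ^ r * real p + 2 * real r * real B ^ (2 * r) * sqrt (real p))"
  shows "V / (real A * real B) \<le> burgess_const r / 3 * (real N powr (1 - 1 / real r) * Q r)"
proof -
  define k where "k = real (r ^ (2 * r)) * 2 ^ r + 2 * real r"
  define a b n P L where "a = real A" and "b = real B" and "n = real N" and "P = real p" and "L = ln P"
  have "0 \<le> real (r ^ (2 * r)) * 2 ^ r" by (intro mult_nonneg_nonneg) auto
  moreover have "1 \<le> 2 * real r" using r by simp
  ultimately have "0 + 1 \<le> real (r ^ (2 * r)) * 2 ^ r + 2 * real r" by (rule add_mono)
  hence k1: "k \<ge> 1" by (simp only: k_def add_0_left)
  have const: "burgess_const r = 282 * k + 9" by (simp only: burgess_const_def k_def)
  have pos: "a > 0" "b > 0" "n > 0" "P > 0" "L \<ge> 1" using A B N p_pos ln_p by (auto simp: a_def b_def n_def P_def L_def)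
  have r0: "real r > 0" using r by simp
  have root: "(P powr (1 / (2 * real r))) ^ r = sqrt P"
    using pos r0 by (simp add: powr_pow powr_half_sqrt)
  have "sqrt P \<le> (2 * b) ^ r"
    unfolding root[symmetric] using B(2) by (intro power_mono) (auto simp: b_def P_def)
  hence "sqrt P * sqrt P \<le> 2 ^ r * b ^ r * sqrt P" using pos by (intro mult_right_mono) (auto simp: power_mult_distrib)
  hence "P \<le> 2 ^ r * b ^ r * sqrt P" using pos by simp
  hence "real (r ^ (2 * r)) * b ^ r * P \<le> real (r ^ (2 * r)) * b ^ r * (2 ^ r * b ^ r * sqrt P)"
    using pos by (intro mult_left_mono) auto
  hence third: "real (r ^ (2 * r)) * b ^ r * P + 2 * real r * b ^ (2 * r) * sqrt P \<le> k * b ^ (2 * r) * sqrt P"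
  proof -
    have "b ^ (2 * r) = b ^ r * b ^ r" by (metis mult_2 power_add)
    hence "k * b ^ (2 * r) * sqrt P = real (r ^ (2 * r)) * b ^ r * (2 ^ r * b ^ r * sqrt P) + 2 * real r * b ^ (2 * r) * sqrt P"
      by (simp only: k_def) (simp only: algebra_simps)
    with \<open>_ \<le> real (r ^ (2 * r)) * b ^ r * (2 ^ r * b ^ r * sqrt P)\<close> show ?thesis by linarith
  qed
  have "ln a \<le> L" using A by (simp add: a_def L_def P_def)
  hence "3 + 2 * ln a \<le> 5 * L" using pos by linarith
  hence second: "4 * (a * n)\<^sup>2 / P + a * n * (3 + 2 * ln a) \<le> 4 * (a * n)\<^sup>2 / P + a * n * (5 * L)"
    using pos by (intro add_left_mono mult_left_mono) auto
  have "V ^ (2 * r) \<le> (a * n) ^ (2 * r - 2) * (4 * (a * n)\<^sup>2 / P + a * n * (3 + 2 * ln a)) * (real (r ^ (2 * r)) * b ^ r * P + 2 * real r * b ^ (2 * r) * sqrt P)"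
    using V(2) by (simp only: a_def b_def n_def P_def)
  also have "\<dots> \<le> (a * n) ^ (2 * r - 2) * (4 * (a * n)\<^sup>2 / P + a * n * (5 * L)) * (k * b ^ (2 * r) * sqrt P)"
    using pos by (intro mult_mono[OF mult_left_mono[OF second] third]) auto
  finally have V2: "V ^ (2 * r) \<le> (a * n) ^ (2 * r - 2) * (4 * (a * n)\<^sup>2 / P + a * n * (5 * L)) * (k * b ^ (2 * r) * sqrt P)" .
  have r2: "2 * r = (2 * r - 2) + 2" using r by simp
  have "(V / (a * b)) ^ (2 * r) = V ^ (2 * r) / (a ^ (2 * r) * b ^ (2 * r))" by (simp add: power_divide power_mult_distrib)
  also have "\<dots> \<le> (a * n) ^ (2 * r - 2) * (4 * (a * n)\<^sup>2 / P + a * n * (5 * L)) * (k * b ^ (2 * r) * sqrt P) / (a ^ (2 * r) * b ^ (2 * r))"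
    using V2 pos by (intro divide_right_mono) auto
  also have "\<dots> = n ^ (2 * r - 2) * (4 * n\<^sup>2 / P + n * (5 * L) / a) * (k * sqrt P)"
  proof -
    have "a ^ (2 * r) = a ^ (2 * r - 2) * a\<^sup>2" by (subst r2, subst power_add) simp
    have gen: "u * y * (4 * (a * n)\<^sup>2 / P + a * n * (5 * L)) * (k * w * z) / (u * a\<^sup>2 * w)
        = y * (4 * n\<^sup>2 / P + n * (5 * L) / a) * (k * z)" if "u \<noteq> 0" "w \<noteq> 0" for u y w z
    proof -
      have eq: "4 * (a * n)\<^sup>2 / P + a * n * (5 * L) = a\<^sup>2 * (4 * n\<^sup>2 / P + n * (5 * L) / a)"
        using pos by (simp add: power_mult_distrib distrib_left power2_eq_square)
      have "u * y * (a\<^sup>2 * t) * (k * w * z) / (u * a\<^sup>2 * w) = y * t * (k * z)" for t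
        using pos that by simp
      thus ?thesis unfolding eq .
    qed
    show ?thesis
      unfolding power_mult_distrib[of a n "2 * r - 2"] \<open>a ^ (2 * r) = _\<close> by (rule gen) (use pos in auto)
  qed
  \<comment> \<open>\<open>94 = 4 + 18 * 5\<close>: the 4 belongs to the diagonal term, 18 to
    \<open>n / a \<le> 18 * b\<close> and 5 to the logarithm.\<close>
  also have "\<dots> \<le> n ^ (2 * r - 2) * (94 * (P powr (1 / (2 * real r)) * L\<^sup>2)) * (k * sqrt P)"
  proof (intro mult_right_mono mult_left_mono)
    have "n\<^sup>2 \<le> (P powr (1 / 2 + 1 / (4 * real r)) * L)\<^sup>2" using N pos by (intro power_mono) (auto simp: n_def P_def L_def)
    also have "\<dots> = P powr (1 + 1 / (2 * real r)) * L\<^sup>2"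
    proof -
      have "(1 / 2 + 1 / (4 * real r)) * real 2 = 1 + 1 / (2 * real r)" using r0 by (simp add: field_simps)
      thus ?thesis unfolding power_mult_distrib powr_pow[OF pos(4)] by (simp only:)
    qed
    also have "\<dots> = P * (P powr (1 / (2 * real r)) * L\<^sup>2)" using pos by (simp add: powr_add)
    finally have 1: "n\<^sup>2 / P \<le> P powr (1 / (2 * real r)) * L\<^sup>2" using pos by (simp add: field_simps)
    have "n / a \<le> 18 * b" using A(3) pos by (simp add: a_def b_def n_def field_simps)
    also have "\<dots> \<le> 18 * P powr (1 / (2 * real r))" using B(3) by (simp add: b_def P_def)
    finally have "n / a * (5 * L) \<le> 18 * P powr (1 / (2 * real r)) * (5 * L)" using pos by (intro mult_right_mono) auto
    also have "\<dots> \<le> 18 * P powr (1 / (2 * real r)) * (5 * L\<^sup>2)"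
      using pos by (intro mult_left_mono) (auto simp: power2_eq_square)
    finally show "4 * n\<^sup>2 / P + n * (5 * L) / a \<le> 94 * (P powr (1 / (2 * real r)) * L\<^sup>2)" using 1 by simp
  qed (use pos k1 in auto)
  also have "\<dots> = 94 * k * (n ^ (2 * r - 2) * P powr (1 / 2 + 1 / (2 * real r)) * L\<^sup>2)"
    using pos by (simp add: powr_add powr_half_sqrt)
  also have "\<dots> = 94 * k * (n powr (1 - 1 / real r) * Q r) ^ (2 * r)"
    using bound_power[OF r, of n] pos by (simp add: P_def L_def)
  \<comment> \<open>The constant is wastefully raised to the power \<open>2 * r\<close>, so that the
    root can be taken on both sides.\<close>
  also have "\<dots> \<le> (94 * k) ^ (2 * r) * (n powr (1 - 1 / real r) * Q r) ^ (2 * r)"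
    using k1 r Q_pos[of r] self_le_power[of "94 * k" "2 * r"] by (intro mult_right_mono) auto
  finally have "(V / (a * b)) ^ (2 * r) \<le> (94 * k * (n powr (1 - 1 / real r) * Q r)) ^ (2 * r)"
    by (simp add: power_mult_distrib)
  hence "V / (a * b) \<le> 94 * k * (n powr (1 - 1 / real r) * Q r)"
    using r k1 Q_pos[of r] by (subst (asm) power_mono_iff) (use V(1) pos in auto)
  also have "\<dots> \<le> burgess_const r / 3 * (n powr (1 - 1 / real r) * Q r)"
    unfolding const using Q_pos[of r] k1 by (intro mult_right_mono) auto
  finally show ?thesis by (simp add: a_def b_def n_def)
qed


end

context np_character
begin
text \<open>The shifts satisfy \<open>A * B \<le> N / 9\<close>, so the induction hypothesis for
  them gains the factor \<open>9 powr (1 - 1/r) \<ge> 3\<close>. Hence \<open>2 * E\<close> takes at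
  most two thirds of the claimed bound, and the main term takes the remaining third.\<close>

theorem burgess:
  assumes r: "r \<ge> 2"
  shows "norm (S M N) \<le> burgess_const r * (real N powr (1 - 1 / real r) * Q r)"
proof (induction N arbitrary: M rule: less_induct)
  case (less N)
  define c where "c = burgess_const r"
  have c9: "c \<ge> 9" unfolding c_def by (rule burgess_const_ge)
  define P L where "P = real p" and "L = ln P"
  have pos: "P \<ge> 3" "L \<ge> 1" using p3 ln_p by (auto simp: P_def L_def)
  have r0: "real r \<ge> 2" using r by simp
  consider "real N \<le> c ^ r * (P powr ((real r + 1) / (4 * real r)) * L)"
    | "real N \<ge> P powr (1 / 2 + 1 / (4 * real r)) * L"
    | "real N > c ^ r * (P powr ((real r + 1) / (4 * real r)) * L)" "real N < P powr (1 / 2 + 1 / (4 * real r)) * L"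
    by linarith
  thus ?case
  proof cases
    case 1
    thus ?thesis using burgess_small[OF r, of c N M] c9 by (simp add: c_def P_def L_def)
  next
    case 2
    have "norm (S M N) \<le> 4 * (real N powr (1 - 1 / real r) * Q r)"
      using 2 by (intro burgess_large r) (simp add: P_def L_def)
    also have "\<dots> \<le> c * (real N powr (1 - 1 / real r) * Q r)"
      using c9 Q_pos[of r] by (intro mult_right_mono) auto
    finally show ?thesis by (simp add: c_def)
  next
    case 3
    define B where "B = nat \<lfloor>P powr (1 / (2 * real r))\<rfloor>"
    define A where "A = nat \<lfloor>real N / (9 * real B)\<rfloor>"
    have "P powr (1 / (2 * real r)) \<ge> 1" using pos by (intro ge_one_powr_ge_zero) auto
    note B = floor_ge_half[OF this, folded B_def]
    have "9 * (P powr (1 / (2 * real r)) * 1) \<le> c ^ r * (P powr ((real r + 1) / (4 * real r)) * L)"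
    proof (intro mult_mono powr_mono)
      have "9 \<le> c ^ 1" using c9 by simp
      also have "\<dots> \<le> c ^ r" using c9 r by (intro power_increasing) auto
      finally show "9 \<le> c ^ r" .
      show "1 / (2 * real r) \<le> (real r + 1) / (4 * real r)" using r0 by (simp add: field_simps)
    qed (use pos c9 in auto)
    hence NP: "real N \<ge> 9 * P powr (1 / (2 * real r))" using 3 by linarith
    have Bpos: "real B > 0" using B(3) by simp
    have "real N / (9 * real B) \<ge> 1" using NP B(2) Bpos by (simp add: field_simps)
    note A = floor_ge_half[OF this, folded A_def]
    have N0: "N > 0" using NP pos by (auto intro!: Nat.gr0I)
    have AB: "real A * real B \<le> real N / 9" using A(2) Bpos by (simp add: field_simps)
    \<comment> \<open>The exponent 3/8 complements 5/8, the largest value of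
      \<open>1/2 + 1/(4 r)\<close> for \<open>r \<ge> 2\<close>. This yields
      \<open>N < (8/3) p\<close>, so that \<open>A \<le> N / 9\<close> lies below
      \<open>p\<close>.\<close>
    have "L \<le> (8 / 3) * P powr (3 / 8)"
    proof -
      have "(3 / 8) * L = ln (P powr (3 / 8))" using pos by (simp add: L_def ln_powr)
      also have "\<dots> \<le> P powr (3 / 8) - 1" using pos by (intro ln_le_minus_one) auto
      finally show ?thesis by simp
    qed
    hence "P powr (1 / 2 + 1 / (4 * real r)) * L \<le> P powr (5 / 8) * ((8 / 3) * P powr (3 / 8))"
      using pos r0 by (intro mult_mono powr_mono) (auto simp: field_simps)
    also have "\<dots> = (8 / 3) * P" using pos by (simp flip: powr_add)
    finally have N_P: "real N < (8 / 3) * P" using 3 by linarith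
    have "real A \<le> real A * real B" using B(3) by (simp add: mult_le_cancel_left1)
    hence A_N: "real A \<le> real N / 9" using AB by linarith
    hence "real A < P" using N_P by linarith
    hence A_p: "A < p" by (simp add: P_def)
    have "A \<le> N" using A_N by simp
    have "P powr (1 / (2 * real r)) \<le> P powr 1" using pos r0 by (intro powr_mono) (auto simp: field_simps)
    hence "B \<le> p" using B(2) pos by (simp add: P_def)
    define Y where "Y = real N powr (1 - 1 / real r) * Q r"
    define E where "E = c * ((real N / 9) powr (1 - 1 / real r) * Q r)"
    have small: "norm (S M' h) \<le> E" if "h \<le> A * B" for M' h
    proof -
      have "real h \<le> real A * real B" using that by (simp flip: of_nat_mult)
      hence h: "real h \<le> real N / 9" using AB by linarith
      hence "h < N" using N0 by simp
      hence "norm (S M' h) \<le> c * (real h powr (1 - 1 / real r) * Q r)" unfolding c_def by (rule less.IH)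
      also have "\<dots> \<le> E" unfolding E_def using h c9 Q_pos[of r] r0
        by (intro mult_left_mono mult_right_mono powr_mono2) auto
      finally show ?thesis .
    qed
    have "2 * E \<le> (2 / 3) * c * Y"
    proof -
      have "3 = (9 :: real) powr (1 / 2)" by (simp add: powr_half_sqrt)
      also have "\<dots> \<le> 9 powr (1 - 1 / real r)" using r0 by (intro powr_mono) (auto simp: field_simps)
      finally have "3 * (real N / 9) powr (1 - 1 / real r) \<le> 9 powr (1 - 1 / real r) * (real N / 9) powr (1 - 1 / real r)"
        by (intro mult_right_mono) auto
      also have "\<dots> = real N powr (1 - 1 / real r)" by (simp flip: powr_mult)
      finally have "(c * Q r) * (3 * (real N / 9) powr (1 - 1 / real r)) \<le> (c * Q r) * real N powr (1 - 1 / real r)"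
        using c9 Q_pos[of r] by (intro mult_left_mono) auto
      thus ?thesis by (simp add: E_def Y_def mult_ac)
    qed
    moreover have "\<exists>V\<ge>0. norm (S M N) \<le> V / (real A * real B) + 2 * E \<and>
      V ^ (2 * r) \<le> (real A * real N) ^ (2 * r - 2) * (4 * (real A * real N)\<^sup>2 / real p + real A * real N * (3 + 2 * ln (real A)))
      * (real (r ^ (2 * r)) * real B ^ r * real p + 2 * real r * real B ^ (2 * r) * sqrt (real p))"
    proof (rule burgess_step[OF A(3) A_p \<open>A \<le> N\<close> B(3) \<open>B \<le> p\<close>])
      show "r > 0" using r by simp
    qed (rule small)
    then obtain V where V: "V \<ge> 0" "norm (S M N) \<le> V / (real A * real B) + 2 * E"
      "V ^ (2 * r) \<le> (real A * real N) ^ (2 * r - 2) * (4 * (real A * real N)\<^sup>2 / real p + real A * real N * (3 + 2 * ln (real A)))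
      * (real (r ^ (2 * r)) * real B ^ r * real p + 2 * real r * real B ^ (2 * r) * sqrt (real p))"
      by (elim exE conjE)
    moreover have "V / (real A * real B) \<le> c / 3 * Y"
      unfolding c_def Y_def
    proof (rule burgess_main_term[OF r A(3) A_p _ B(3) _ _ N0 _ V(1,3)])
      show "real A \<ge> real N / (18 * real B)" using A(1) by simp
      show "real B \<ge> real p powr (1 / (2 * real r)) / 2" "real B \<le> real p powr (1 / (2 * real r))"
        using B(1,2) by (simp_all only: P_def)
      show "real N < real p powr (1 / 2 + 1 / (4 * real r)) * ln (real p)" using 3(2) by (simp only: P_def L_def)
    qed
    ultimately have "norm (S M N) \<le> c * Y" using V(2) by linarith
    thus ?thesis by (simp add: c_def Y_def)
  qed
qed

end

section \<open>Sums over the hyperbola region\<close>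

definition isum :: "(int \<Rightarrow> complex) \<Rightarrow> int \<Rightarrow> complex" where
  "isum f n = (\<Sum>x\<in>{1..n}. f x)"

lemma isum_diff: "a \<le> b \<Longrightarrow> 0 \<le> a \<Longrightarrow> isum f b - isum f a = (\<Sum>x\<in>{a + 1..<a + 1 + int (nat (b - a))}. f x)"
proof -
  assume ab: "a \<le> b" "0 \<le> a"
  have "{1..b} = {1..a} \<union> {a + 1..b}" using ab by auto
  hence "isum f b = isum f a + (\<Sum>x\<in>{a + 1..b}. f x)"
    unfolding isum_def by (simp only:) (rule sum.union_disjoint, auto)
  moreover have "{a + 1..b} = {a + 1..<a + 1 + int (nat (b - a))}" using ab by auto
  ultimately show ?thesis by simp
qed

definition hyp_region :: "real \<Rightarrow> (int \<times> int) set" where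
  "hyp_region T = {(x, y). 0 < x \<and> 0 < y \<and> real_of_int (x * y) \<le> T}"

lemma hyperbola_left:
  assumes "T \<ge> 1" "1 \<le> R"
  shows "(\<Sum>(x, y)\<in>{z \<in> hyp_region T. fst z \<le> R}. f x * g y) = (\<Sum>x\<in>{1..R}. f x * isum g \<lfloor>T / of_int x\<rfloor>)"
    and "finite {z \<in> hyp_region T. fst z \<le> R}"
proof -
  have eq: "{z \<in> hyp_region T. fst z \<le> R} = (SIGMA x:{1..R}. {1..\<lfloor>T / of_int x\<rfloor>})"
    by (auto simp: hyp_region_def le_floor_iff field_simps)
  show "finite {z \<in> hyp_region T. fst z \<le> R}" unfolding eq by auto
  show "(\<Sum>(x, y)\<in>{z \<in> hyp_region T. fst z \<le> R}. f x * g y) = (\<Sum>x\<in>{1..R}. f x * isum g \<lfloor>T / of_int x\<rfloor>)"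
    unfolding eq isum_def sum_distrib_left by (rule sum.Sigma[symmetric]) auto
qed

text \<open>Dirichlet's hyperbola method: \<open>x\<close> or \<open>y\<close> is at most
  \<open>sqrt T\<close>, and the square where both are is counted twice.\<close>

lemma hyperbola_split:
  fixes f g :: "int \<Rightarrow> complex"
  assumes T: "T \<ge> 1"
  defines "R \<equiv> \<lfloor>sqrt T\<rfloor>"
  shows "(\<Sum>(x, y)\<in>hyp_region T. f x * g y) =
    (\<Sum>x\<in>{1..R}. f x * isum g \<lfloor>T / of_int x\<rfloor>) + (\<Sum>y\<in>{1..R}. g y * isum f \<lfloor>T / of_int y\<rfloor>) - isum f R * isum g R"
proof -
  let ?D1 = "{z \<in> hyp_region T. fst z \<le> R}" and ?D2 = "{z \<in> hyp_region T. snd z \<le> R}"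
  have R1: "1 \<le> R" using T by (simp add: R_def)
  have sqR: "of_int R \<le> sqrt T" "sqrt T < of_int R + 1" unfolding R_def by linarith+
  have union: "hyp_region T = ?D1 \<union> ?D2"
  proof -
    have "fst z \<le> R \<or> snd z \<le> R" if "z \<in> hyp_region T" for z
    proof (rule ccontr)
      assume "\<not> (fst z \<le> R \<or> snd z \<le> R)"
      hence "R + 1 \<le> fst z" "R + 1 \<le> snd z" by auto
      hence "real_of_int (R + 1) \<le> of_int (fst z)" "real_of_int (R + 1) \<le> of_int (snd z)" by (simp_all only: of_int_le_iff)
      hence "sqrt T < of_int (fst z)" "sqrt T < of_int (snd z)" using sqR by auto
      hence "sqrt T * sqrt T < of_int (fst z) * of_int (snd z)" using T by (intro mult_strict_mono') auto
      thus False using that T by (cases z) (auto simp: hyp_region_def)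
    qed
    thus ?thesis by auto
  qed
  have inter: "?D1 \<inter> ?D2 = {1..R} \<times> {1..R}"
  proof -
    have "real_of_int (x * y) \<le> T" if "0 < x" "x \<le> R" "0 < y" "y \<le> R" for x y
    proof -
      have "real_of_int x * real_of_int y \<le> sqrt T * sqrt T"
        using that sqR T by (intro mult_mono) (auto intro: order_trans[OF of_int_le_iff[THEN iffD2] sqR(1)])
      thus ?thesis using T by simp
    qed
    thus ?thesis by (auto simp: hyp_region_def)
  qed
  have swap: "?D2 = prod.swap ` ?D1"
    by (auto simp: hyp_region_def image_iff mult.commute)
  have fin1: "finite ?D1" using hyperbola_left(2)[OF T R1] .
  hence fin2: "finite ?D2" unfolding swap by (rule finite_imageI)
  have "(\<Sum>(x, y)\<in>hyp_region T. f x * g y) = (\<Sum>(x, y)\<in>?D1. f x * g y) + (\<Sum>(x, y)\<in>?D2. f x * g y) - (\<Sum>(x, y)\<in>?D1 \<inter> ?D2. f x * g y)"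
    by (subst union) (rule sum_Un[OF fin1 fin2])
  also have "(\<Sum>(x, y)\<in>?D1. f x * g y) = (\<Sum>x\<in>{1..R}. f x * isum g \<lfloor>T / of_int x\<rfloor>)"
    by (rule hyperbola_left(1)[OF T R1])
  also have "(\<Sum>(x, y)\<in>?D2. f x * g y) = (\<Sum>(y, x)\<in>?D1. g y * f x)"
    unfolding swap by (subst sum.reindex) (auto simp: case_prod_beta mult.commute)
  also have "\<dots> = (\<Sum>y\<in>{1..R}. g y * isum f \<lfloor>T / of_int y\<rfloor>)"
    by (rule hyperbola_left(1)[OF T R1])
  also have "(\<Sum>(x, y)\<in>?D1 \<inter> ?D2. f x * g y) = isum f R * isum g R"
    unfolding inter isum_def by (simp add: sum_product sum.cartesian_product)
  finally show ?thesis .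
qed

text \<open>\<open>f\<close> and \<open>g\<close> enter only through their bounds on intervals. The
  sequence \<open>e\<close> majorises the cost of \<open>k\<close> bisections; it is kept abstract
  because its recurrence has a solution of another shape when
  \<open>4 powr \<theta> = 2\<close>.\<close>

locale hyperbola_sum =
  fixes f g :: "int \<Rightarrow> complex" and \<alpha> \<beta> \<theta> T :: real and e :: "nat \<Rightarrow> real"
  assumes \<theta>: "1 / 2 \<le> \<theta>" "\<theta> \<le> 1" and \<alpha>: "\<alpha> \<ge> 0" and \<beta>: "\<beta> \<ge> 0" and T: "T \<ge> 1"
    and f: "\<And>M N. norm (\<Sum>x\<in>{M..<M + int N}. f x) \<le> \<alpha> * real N powr \<theta>"
    and g: "\<And>M N. norm (\<Sum>x\<in>{M..<M + int N}. g x) \<le> \<beta> * real N powr \<theta>"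
    and e_0: "e 0 \<ge> 1" and e_Suc: "\<And>k. e (Suc k) \<ge> 2 * e k + (4 powr \<theta>) ^ k"
begin

definition m :: "int \<Rightarrow> int" where "m x = \<lfloor>T / of_int x\<rfloor>"

text \<open>The range of \<open>y\<close> between the two ends has length at most
  \<open>T h / 4^i + 1\<close>, as \<open>u v \<ge> 4^i\<close>. The 1 comes from rounding and is
  absorbed because \<open>4^i \<le> T\<close> and \<open>h \<ge> 1\<close>.\<close>

lemma isum_m_diff:
  assumes uw: "2 ^ i \<le> u" "u \<le> v" and v: "v \<le> u + h" and h: "1 \<le> h" and T4: "4 ^ i \<le> T"
  shows "norm (isum g (m u) - isum g (m v)) \<le> \<beta> * (2 * T * of_int h / 4 ^ i) powr \<theta>"
proof -
  have u0: "0 < u" using uw(1) by (rule less_le_trans[rotated]) simp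
  have v0: "0 < v" using u0 uw by simp
  have ru: "(2 :: real) ^ i \<le> of_int u"
  proof -
    have "real_of_int (2 ^ i) \<le> of_int u" using uw(1) by (simp only: of_int_le_iff)
    thus ?thesis by simp
  qed
  have rv: "(2 :: real) ^ i \<le> of_int v" using ru uw(2) by (meson of_int_le_iff order_trans)
  have "T / of_int v \<le> T / of_int u" using T u0 uw by (intro divide_left_mono) auto
  hence mm: "m v \<le> m u" unfolding m_def by (rule floor_mono)
  have m0: "0 \<le> m v" using T v0 by (simp add: m_def)
  have "real_of_int (m u) \<le> T / of_int u" "T / of_int v < real_of_int (m v) + 1" unfolding m_def by linarith+
  hence "real_of_int (m u - m v) \<le> T / of_int u - T / of_int v + 1" by simp
  also have "T / of_int u - T / of_int v = T * (of_int v - of_int u) / (of_int u * of_int v)"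
    using u0 v0 by (simp add: field_simps)
  also have "\<dots> \<le> T * of_int h / (2 ^ i * 2 ^ i)"
  proof (intro frac_le mult_left_mono mult_mono)
    have "real_of_int v \<le> of_int (u + h)" using v by (simp only: of_int_le_iff)
    thus "real_of_int v - real_of_int u \<le> of_int h" by simp
  qed (use T h ru rv uw u0 in auto)
  also have "(2 :: real) ^ i * 2 ^ i = 4 ^ i" by (simp flip: power_mult_distrib)
  also have "T * of_int h / 4 ^ i + 1 \<le> 2 * T * of_int h / 4 ^ i"
  proof -
    have "1 * 4 ^ i \<le> T * of_int h"
    proof -
      have "T * 1 \<le> T * of_int h" using T h by (intro mult_left_mono) auto
      thus ?thesis using T4 by simp
    qed
    hence "1 \<le> T * of_int h / 4 ^ i" by (simp add: pos_le_divide_eq)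
    moreover have "2 * T * of_int h / 4 ^ i = T * of_int h / 4 ^ i + T * of_int h / 4 ^ i" by simp
    ultimately show ?thesis by linarith
  qed
  finally have len: "real (nat (m u - m v)) \<le> 2 * T * of_int h / 4 ^ i" using mm by simp
  have "norm (isum g (m u) - isum g (m v)) \<le> \<beta> * real (nat (m u - m v)) powr \<theta>"
    unfolding isum_diff[OF mm m0] by (rule g)
  also have "\<dots> \<le> \<beta> * (2 * T * of_int h / 4 ^ i) powr \<theta>"
    using len \<theta> \<beta> by (intro mult_left_mono powr_mono2) auto
  finally show ?thesis .
qed

text \<open>The last dyadic block may reach beyond the end of the summation. Cutting an interval at
  \<open>R\<close> leaves a shorter interval, so the bound persists.\<close>

lemma f_truncated:
  "norm (\<Sum>x\<in>{u..<u + int h} \<inter> {..R}. f x) \<le> \<alpha> * real h powr \<theta>"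
proof -
  define k where "k = min h (nat (R + 1 - u))"
  have "{u..<u + int h} \<inter> {..R} = {u..<u + int k}" by (auto simp: k_def min_def)
  hence "norm (\<Sum>x\<in>{u..<u + int h} \<inter> {..R}. f x) \<le> \<alpha> * real k powr \<theta>" by (simp only: f)
  also have "\<dots> \<le> \<alpha> * real h powr \<theta>"
    using \<alpha> \<theta> by (intro mult_left_mono powr_mono2) (auto simp: k_def)
  finally show ?thesis .
qed

text \<open>The part of the hyperbola region above a block of length \<open>2 ^ k\<close> and beyond the box below its
  right end is bisected recursively: the left half contributes one more box, and both halves leave a
  region of the same kind.\<close>
lemma block_bound:
  assumes "2 ^ i \<le> u" and T4: "4 ^ i \<le> T"
  shows "norm (\<Sum>x\<in>{u..<u + int (2 ^ k)} \<inter> {..R}. f x * (isum g (m x) - isum g (m (u + int (2 ^ k)))))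
     \<le> \<alpha> * \<beta> * (2 * T / 4 ^ i) powr \<theta> * e k"
  using assms(1)
proof (induction k arbitrary: u)
  case 0
  define Y where "Y = (2 * T / 4 ^ i) powr \<theta>"
  have Y0: "Y \<ge> 0" by (simp add: Y_def)
  have "norm (\<Sum>x\<in>{u..<u + int (2 ^ 0)} \<inter> {..R}. f x * (isum g (m x) - isum g (m (u + int (2 ^ 0)))))
     = norm ((\<Sum>x\<in>{u..<u + int 1} \<inter> {..R}. f x) * (isum g (m u) - isum g (m (u + 1))))"
  proof -
    have "{u..<u + int (2 ^ 0)} = {u}" "{u..<u + int 1} = {u}" by auto
    thus ?thesis by (cases "u \<le> R") auto
  qed
  also have "\<dots> \<le> (\<alpha> * real 1 powr \<theta>) * (\<beta> * (2 * T * of_int 1 / 4 ^ i) powr \<theta>)"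
    unfolding norm_mult using 0 T4 \<alpha> by (intro mult_mono f_truncated isum_m_diff) auto
  also have "\<dots> = \<alpha> * \<beta> * Y * 1" by (simp add: Y_def)
  also have "\<dots> \<le> \<alpha> * \<beta> * Y * e 0" using \<alpha> \<beta> Y0 e_0 by (intro mult_left_mono) auto
  finally show ?case by (simp add: Y_def)
next
  case (Suc k)
  define h where "h = (2 :: nat) ^ k"
  define Y where "Y = (2 * T / 4 ^ i) powr \<theta>"
  have Y0: "Y \<ge> 0" by (simp add: Y_def)
  define w v where "w = u + int h" and "v = w + int h"
  have v: "u + int (2 ^ Suc k) = v" by (simp add: v_def w_def h_def)
  have h1: "h \<ge> 1" by (simp add: h_def)
  let ?A = "{u..<w} \<inter> {..R}" and ?B = "{w..<v} \<inter> {..R}"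
  have w2: "2 ^ i \<le> w" using Suc.prems by (simp add: w_def)
  have "{u..<v} \<inter> {..R} = ?A \<union> ?B" by (auto simp: w_def v_def)
  hence "(\<Sum>x\<in>{u..<v} \<inter> {..R}. f x * (isum g (m x) - isum g (m v))) =
     (\<Sum>x\<in>?A. f x * (isum g (m x) - isum g (m v))) + (\<Sum>x\<in>?B. f x * (isum g (m x) - isum g (m v)))"
    by (simp only:) (rule sum.union_disjoint, auto)
  also have "(\<Sum>x\<in>?A. f x * (isum g (m x) - isum g (m v))) =
     (\<Sum>x\<in>?A. f x * (isum g (m x) - isum g (m w))) + (\<Sum>x\<in>?A. f x) * (isum g (m w) - isum g (m v))"
    unfolding sum_distrib_right sum.distrib[symmetric] by (intro sum.cong refl) (simp add: algebra_simps)
  finally have eq: "(\<Sum>x\<in>{u..<v} \<inter> {..R}. f x * (isum g (m x) - isum g (m v))) =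
     (\<Sum>x\<in>?A. f x * (isum g (m x) - isum g (m w))) + (\<Sum>x\<in>?A. f x) * (isum g (m w) - isum g (m v))
     + (\<Sum>x\<in>?B. f x * (isum g (m x) - isum g (m v)))" .
  have 1: "norm (\<Sum>x\<in>?A. f x * (isum g (m x) - isum g (m w))) \<le> \<alpha> * \<beta> * Y * e k"
    unfolding w_def h_def Y_def by (rule Suc.IH[OF Suc.prems])
  have 3: "norm (\<Sum>x\<in>?B. f x * (isum g (m x) - isum g (m v))) \<le> \<alpha> * \<beta> * Y * e k"
    unfolding v_def h_def Y_def by (rule Suc.IH[OF w2])
  have 2: "norm ((\<Sum>x\<in>?A. f x) * (isum g (m w) - isum g (m v))) \<le> \<alpha> * \<beta> * Y * (4 powr \<theta>) ^ k"
  proof -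
    have "norm ((\<Sum>x\<in>?A. f x) * (isum g (m w) - isum g (m v))) \<le> (\<alpha> * real h powr \<theta>) * (\<beta> * (2 * T * of_int (int h) / 4 ^ i) powr \<theta>)"
      unfolding norm_mult w_def using w2 h1 T4 \<alpha>
      by (intro mult_mono f_truncated isum_m_diff) (auto simp: v_def w_def)
    also have "2 * T * of_int (int h) / 4 ^ i = (2 * T / 4 ^ i) * real h" by simp
    also have "\<alpha> * real h powr \<theta> * (\<beta> * ((2 * T / 4 ^ i) * real h) powr \<theta>) = \<alpha> * \<beta> * Y * (real h powr \<theta> * real h powr \<theta>)"
      using T by (subst powr_mult) (auto simp: Y_def)
    also have "real h powr \<theta> * real h powr \<theta> = (4 powr \<theta>) ^ k"
    proof -
      have "real h * real h = 4 ^ k" by (simp add: h_def flip: power_mult_distrib)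
      hence "real h powr \<theta> * real h powr \<theta> = (4 ^ k) powr \<theta>" by (simp flip: powr_mult)
      also have "\<dots> = (4 powr \<theta>) ^ k" by (simp add: powr_powr mult.commute flip: powr_realpow)
      finally show ?thesis .
    qed
    finally show ?thesis .
  qed
  have "norm (\<Sum>x\<in>{u..<v} \<inter> {..R}. f x * (isum g (m x) - isum g (m v))) \<le>
      \<alpha> * \<beta> * Y * e k + \<alpha> * \<beta> * Y * (4 powr \<theta>) ^ k + \<alpha> * \<beta> * Y * e k"
    unfolding eq by (intro norm_triangle_le add_mono 1 2 3)
  also have "\<dots> = \<alpha> * \<beta> * Y * (2 * e k + (4 powr \<theta>) ^ k)" by (simp add: algebra_simps)
  also have "\<dots> \<le> \<alpha> * \<beta> * Y * e (Suc k)" using \<alpha> \<beta> Y0 e_Suc[of k] by (intro mult_left_mono) auto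
  finally show ?case unfolding v Y_def .
qed

lemma T_powr: "T powr \<theta> \<ge> 0" "(2 * T) powr \<theta> \<le> 2 * T powr \<theta>"
proof -
  have "(2 :: real) powr \<theta> \<le> 2 powr 1" using \<theta> by (intro powr_mono) auto
  thus "(2 * T) powr \<theta> \<le> 2 * T powr \<theta>" using T by (simp add: powr_mult mult_right_mono)
qed simp

text \<open>The block has length \<open>2^i\<close>, so it is bisected \<open>i\<close> times, down
  to single points. The factor \<open>(4 powr \<theta>)^i\<close> in the bound for
  \<open>e i\<close> cancels the \<open>4^i\<close> in \<open>block_bound\<close>, and the box below
  the right end adds at most one further \<open>T powr \<theta>\<close>.\<close>

lemma dyadic_block_bound:
  assumes T4: "4 ^ i \<le> T" and eE: "e i \<le> (4 powr \<theta>) ^ i * E" and E: "E \<ge> 1"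
  shows "norm (\<Sum>x\<in>{2 ^ i..<2 ^ Suc i} \<inter> {..R}. f x * isum g (m x)) \<le> 3 * E * (\<alpha> * \<beta> * T powr \<theta>)"
proof -
  let ?I = "{2 ^ i..<2 ^ Suc i} \<inter> {..R}"
  define v :: int where "v = 2 ^ Suc i"
  have I: "{2 ^ i..<2 ^ Suc i} = {2 ^ i..<2 ^ i + int (2 ^ i)}" by simp
  have v: "2 ^ i + int (2 ^ i) = v" by (simp add: v_def)
  have "(\<Sum>x\<in>?I. f x * isum g (m x)) = (\<Sum>x\<in>?I. f x * (isum g (m x) - isum g (m v))) + (\<Sum>x\<in>?I. f x) * isum g (m v)"
    unfolding sum_distrib_right sum.distrib[symmetric] by (intro sum.cong refl) (simp add: algebra_simps)
  moreover have "norm (\<Sum>x\<in>?I. f x * (isum g (m x) - isum g (m v))) \<le> 2 * E * (\<alpha> * \<beta> * T powr \<theta>)"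
  proof -
    have "norm (\<Sum>x\<in>?I. f x * (isum g (m x) - isum g (m v))) \<le> \<alpha> * \<beta> * (2 * T / 4 ^ i) powr \<theta> * e i"
      using block_bound[of i "2 ^ i" i R] T4 unfolding I v by simp
    also have "\<dots> \<le> \<alpha> * \<beta> * (2 * T / 4 ^ i) powr \<theta> * ((4 powr \<theta>) ^ i * E)"
      using eE \<alpha> \<beta> by (intro mult_left_mono) auto
    also have "(4 powr \<theta>) ^ i = (4 ^ i) powr \<theta>" by (simp add: powr_powr mult.commute flip: powr_realpow)
    also have "\<alpha> * \<beta> * (2 * T / 4 ^ i) powr \<theta> * ((4 ^ i) powr \<theta> * E) = \<alpha> * \<beta> * E * (2 * T) powr \<theta>"
      using T by (simp add: powr_divide)
    also have "\<dots> \<le> \<alpha> * \<beta> * E * (2 * T powr \<theta>)" using \<alpha> \<beta> E T_powr by (intro mult_left_mono) auto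
    finally show ?thesis by (simp add: mult_ac)
  qed
  moreover have "norm ((\<Sum>x\<in>?I. f x) * isum g (m v)) \<le> \<alpha> * \<beta> * T powr \<theta>"
  proof -
    have v0: "v > 0" by (simp add: v_def)
    have mv: "0 \<le> m v" "real_of_int (m v) \<le> T / of_int v" using T v0 by (auto simp: m_def)
    have "norm (isum g (m v)) \<le> \<beta> * real (nat (m v)) powr \<theta>"
      using g[of 1 "nat (m v)"] isum_diff[of 0 "m v" g] mv(1) by (simp add: isum_def)
    also have "\<dots> \<le> \<beta> * (T / of_int v) powr \<theta>" using mv \<theta> \<beta> by (intro mult_left_mono powr_mono2) auto
    finally have "norm ((\<Sum>x\<in>?I. f x) * isum g (m v)) \<le> (\<alpha> * real (2 ^ i) powr \<theta>) * (\<beta> * (T / of_int v) powr \<theta>)"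
      unfolding norm_mult I using \<alpha> by (intro mult_mono f_truncated) auto
    also have "\<dots> = \<alpha> * \<beta> * (real (2 ^ i) * (T / of_int v)) powr \<theta>"
      using T v0 by (subst powr_mult) auto
    also have "real (2 ^ i) * (T / of_int v) = T / 2" by (simp add: v_def)
    also have "\<alpha> * \<beta> * (T / 2) powr \<theta> \<le> \<alpha> * \<beta> * T powr \<theta>"
      using T \<theta> \<alpha> \<beta> by (intro mult_left_mono powr_mono2) auto
    finally show ?thesis .
  qed
  ultimately have "norm (\<Sum>x\<in>?I. f x * isum g (m x)) \<le> 2 * E * (\<alpha> * \<beta> * T powr \<theta>) + 1 * (\<alpha> * \<beta> * T powr \<theta>)"
    by (simp only: mult_1) (intro norm_triangle_le add_mono)
  also have "\<dots> \<le> 2 * E * (\<alpha> * \<beta> * T powr \<theta>) + E * (\<alpha> * \<beta> * T powr \<theta>)"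
    using E \<alpha> \<beta> by (intro add_left_mono mult_right_mono) auto
  finally show ?thesis by (simp add: algebra_simps)
qed

text \<open>The dyadic blocks that meet the range up to \<open>sqrt T\<close> cost one logarithm:
  their number is at most \<open>1 + ln T\<close>, by \<open>2^J \<le> sqrt T\<close> and
  \<open>ln 2 \<ge> 1/2\<close>.\<close>

lemma half_sum_bound:
  assumes eE: "\<And>i. real i \<le> ln T \<Longrightarrow> e i \<le> (4 powr \<theta>) ^ i * E" and E: "E \<ge> 1"
  shows "norm (\<Sum>x\<in>{1..\<lfloor>sqrt T\<rfloor>}. f x * isum g (m x)) \<le> 3 * E * (1 + ln T) * (\<alpha> * \<beta> * T powr \<theta>)"
proof -
  define R where "R = \<lfloor>sqrt T\<rfloor>"
  have R1: "1 \<le> R" using T by (simp add: R_def)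
  have "1 \<le> nat R" using R1 by simp
  then obtain J where J: "2 ^ J \<le> nat R" "nat R < 2 ^ Suc J" using ex_power_ivl1[of 2 "nat R"] by auto
  have J': "(2 :: int) ^ J \<le> R" "R < 2 ^ Suc J"
  proof -
    have "int (2 ^ J) \<le> int (nat R)" "int (nat R) < int (2 ^ Suc J)" using J by (simp_all only: of_nat_le_iff of_nat_less_iff)
    thus "(2 :: int) ^ J \<le> R" "R < 2 ^ Suc J" using R1 by simp_all
  qed
  have "real_of_int (2 ^ J) \<le> real_of_int R" using J'(1) by (simp only: of_int_le_iff)
  also have "\<dots> \<le> sqrt T" unfolding R_def by linarith
  finally have J2: "(2 :: real) ^ J \<le> sqrt T" by simp
  hence "((2 :: real) ^ J)\<^sup>2 \<le> (sqrt T)\<^sup>2" by (intro power_mono) auto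
  moreover have "((2 :: real) ^ J)\<^sup>2 = 4 ^ J" by (simp add: power2_eq_square flip: power_mult_distrib)
  ultimately have "(4 :: real) ^ J \<le> T" using T by simp
  have T4: "(4 :: real) ^ i \<le> T" if "i \<le> J" for i
    using power_increasing[OF that, of "4 :: real"] \<open>4 ^ J \<le> T\<close> by linarith
  have "real J * ln 2 = ln (2 ^ J)" by (simp add: ln_realpow)
  also have "\<dots> \<le> ln (sqrt T)" using J2 T by (subst ln_le_cancel_iff) auto
  also have "\<dots> = ln T / 2" using T by (simp add: ln_sqrt)
  finally have "real J * (1 / 2) \<le> ln T / 2" using mult_left_mono[OF ln_2_ge_half, of "real J"] by simp
  hence Jln: "real J \<le> ln T" by simp
  \<comment> \<open>The remainder \<open>{2 ^ Suc n..R}\<close> makes the covering provable by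
    induction; it is empty for \<open>n = J\<close>.\<close>
  have cover: "{1..R} = (\<Union>i\<le>n. {2 ^ i..<2 ^ Suc i} \<inter> {..R}) \<union> ({2 ^ Suc n..R})" for n
  proof (induction n)
    case 0 show ?case by auto
  next
    case (Suc n)
    have "{(2 :: int) ^ Suc n..R} = ({2 ^ Suc n..<2 ^ Suc (Suc n)} \<inter> {..R}) \<union> {2 ^ Suc (Suc n)..R}"
    proof -
      have "(2 :: int) ^ Suc n \<le> 2 ^ Suc (Suc n)" by (intro power_increasing) auto
      from order_trans[OF this] show ?thesis by (auto simp del: power_Suc)
    qed
    with Suc show ?case by (auto simp: atMost_Suc simp del: power_Suc)
  qed
  have "{1..R} = (\<Union>i\<le>J. {2 ^ i..<2 ^ Suc i} \<inter> {..R})" using cover[of J] J'(2) by auto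
  also have "(\<Sum>x\<in>\<dots>. f x * isum g (m x)) = (\<Sum>i\<le>J. \<Sum>x\<in>{2 ^ i..<2 ^ Suc i} \<inter> {..R}. f x * isum g (m x))"
  proof (rule sum.UNION_disjoint)
    show "\<forall>i\<in>{..J}. \<forall>j\<in>{..J}. i \<noteq> j \<longrightarrow> ({2 ^ i..<2 ^ Suc i} \<inter> {..R}) \<inter> ({2 ^ j..<2 ^ Suc j} \<inter> {..R}) = {}"
    proof (intro ballI impI)
      fix i j :: nat assume ij: "i \<noteq> j"
      have disj: False if "a < b" "x < (2 :: int) ^ Suc a" "2 ^ b \<le> x" for a b :: nat and x
      proof -
        have "(2 :: int) ^ Suc a \<le> 2 ^ b" using that(1) by (intro power_increasing) auto
        thus ?thesis using that(2,3) by linarith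
      qed
      show "({2 ^ i..<2 ^ Suc i} \<inter> {..R}) \<inter> ({2 ^ j..<2 ^ Suc j} \<inter> {..R}) = {}"
      proof (rule equals0I)
        fix x assume "x \<in> ({2 ^ i..<2 ^ Suc i} \<inter> {..R}) \<inter> ({2 ^ j..<2 ^ Suc j} \<inter> {..R})"
        hence x: "2 ^ i \<le> x" "x < 2 ^ Suc i" "2 ^ j \<le> x" "x < 2 ^ Suc j" by (simp_all del: power_Suc)
        from ij show False
        proof (rule linorder_neqE_nat)
          show "i < j \<Longrightarrow> False" using disj x by blast
          show "j < i \<Longrightarrow> False" using disj x by blast
        qed
      qed
    qed
  qed auto
  also have "norm \<dots> \<le> (\<Sum>i\<le>J. 3 * E * (\<alpha> * \<beta> * T powr \<theta>))"
    using T4 Jln E by (intro order_trans[OF norm_sum] sum_mono dyadic_block_bound eE) auto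
  also have "\<dots> = 3 * E * (\<alpha> * \<beta> * T powr \<theta>) * (1 + real J)" by (simp add: algebra_simps)
  also have "\<dots> \<le> 3 * E * (\<alpha> * \<beta> * T powr \<theta>) * (1 + ln T)"
    using Jln E \<alpha> \<beta> by (intro mult_left_mono) auto
  finally show ?thesis by (simp only: R_def mult_ac)
qed

end

text \<open>The hypotheses are symmetric in \<open>f\<close> and \<open>g\<close>, so the locale
  serves both halves. The constant is \<open>7 = 3 + 3 + 1\<close>, with 1 for the square.\<close>

theorem hyperbola_bound:
  fixes f g :: "int \<Rightarrow> complex"
  assumes \<theta>: "1 / 2 \<le> \<theta>" "\<theta> \<le> 1" and \<alpha>: "\<alpha> \<ge> 0" and \<beta>: "\<beta> \<ge> 0" and T: "T \<ge> 1"
    and f: "\<And>M N. norm (\<Sum>x\<in>{M..<M + int N}. f x) \<le> \<alpha> * real N powr \<theta>"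
    and g: "\<And>M N. norm (\<Sum>x\<in>{M..<M + int N}. g x) \<le> \<beta> * real N powr \<theta>"
    and e: "e 0 \<ge> 1" "\<And>k. e (Suc k) \<ge> 2 * e k + (4 powr \<theta>) ^ k"
    and eE: "\<And>i. real i \<le> ln T \<Longrightarrow> e i \<le> (4 powr \<theta>) ^ i * E" and E: "E \<ge> 1"
  shows "norm (\<Sum>(x, y)\<in>hyp_region T. f x * g y) \<le> 7 * E * (1 + ln T) * (\<alpha> * \<beta> * T powr \<theta>)"
proof -
  interpret fg: hyperbola_sum f g \<alpha> \<beta> \<theta> T e by unfold_locales (fact assms)+
  interpret gf: hyperbola_sum g f \<beta> \<alpha> \<theta> T e by unfold_locales (fact assms)+
  define R where "R = \<lfloor>sqrt T\<rfloor>"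
  define Y where "Y = \<alpha> * \<beta> * T powr \<theta>"
  have Y0: "Y \<ge> 0" using \<alpha> \<beta> by (simp add: Y_def)
  have R0: "R \<ge> 0" "of_int R \<le> sqrt T" using T unfolding R_def by (auto simp: linorder_not_le)
  have 1: "norm (\<Sum>x\<in>{1..R}. f x * isum g \<lfloor>T / of_int x\<rfloor>) \<le> 3 * E * (1 + ln T) * Y"
    using fg.half_sum_bound[OF eE E] by (simp add: fg.m_def R_def Y_def)
  have 2: "norm (\<Sum>x\<in>{1..R}. g x * isum f \<lfloor>T / of_int x\<rfloor>) \<le> 3 * E * (1 + ln T) * Y"
    using gf.half_sum_bound[OF eE E] by (simp add: gf.m_def R_def Y_def mult.commute[of \<beta>])
  have 3: "norm (isum f R * isum g R) \<le> 1 * Y"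
  proof -
    have RT: "real (nat R) \<le> sqrt T" using R0 by simp
    have "norm (isum f R) \<le> \<alpha> * real (nat R) powr \<theta>"
      using f[of 1 "nat R"] isum_diff[of 0 R f] R0 by (simp add: isum_def)
    moreover have "norm (isum g R) \<le> \<beta> * real (nat R) powr \<theta>"
      using g[of 1 "nat R"] isum_diff[of 0 R g] R0 by (simp add: isum_def)
    moreover have "real (nat R) powr \<theta> \<le> sqrt T powr \<theta>" using RT \<theta> by (intro powr_mono2) auto
    ultimately have "norm (isum f R) \<le> \<alpha> * sqrt T powr \<theta>" "norm (isum g R) \<le> \<beta> * sqrt T powr \<theta>"
      using \<alpha> \<beta> by (meson mult_left_mono order_trans)+
    hence "norm (isum f R * isum g R) \<le> (\<alpha> * sqrt T powr \<theta>) * (\<beta> * sqrt T powr \<theta>)"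
      unfolding norm_mult using \<alpha> by (intro mult_mono) auto
    also have "\<dots> = \<alpha> * \<beta> * (sqrt T powr \<theta> * sqrt T powr \<theta>)" by simp
    also have "sqrt T powr \<theta> * sqrt T powr \<theta> = T powr \<theta>" using T by (simp flip: powr_mult)
    finally show ?thesis by (simp add: Y_def)
  qed
  have "norm (\<Sum>(x, y)\<in>hyp_region T. f x * g y) \<le> 3 * E * (1 + ln T) * Y + 3 * E * (1 + ln T) * Y + 1 * Y"
    unfolding hyperbola_split[OF T] R_def[symmetric]
    by (intro order_trans[OF norm_triangle_ineq4] add_mono 3 norm_triangle_le 1 2)
  also have "1 * Y \<le> (E * (1 + ln T)) * Y"
  proof (intro mult_right_mono Y0)
    have "1 * 1 \<le> E * (1 + ln T)" using E T by (intro mult_mono) auto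
    thus "1 \<le> E * (1 + ln T)" by simp
  qed
  finally show ?thesis by (simp add: Y_def algebra_simps)
qed

section \<open>Proof of the theorem\<close>

text \<open>A principal character is induced from the modulus 1, so its conductor is not
  \<open>q\<close>. Modulo 2 every character is principal, which gives
  \<open>q \<ge> 3\<close>.\<close>

lemma primitive_imp_np_character:
  assumes q: "prime q" and prim: "primitive_character q \<psi>"
  shows "np_character q \<psi>"
proof -
  have dir: "dirichlet_character q \<psi>" and cond: "conductor q \<psi> = q"
    using prim by (auto simp: primitive_character_def)
  have q1: "q > 1" using q by (rule prime_gt_1_nat)
  have ex: "\<exists>a. coprime a (int q) \<and> \<psi> a \<noteq> 1"
  proof (rule ccontr)
    assume "\<not> ?thesis"
    hence one: "\<psi> a = 1" if "coprime a (int q)" for a using that by blast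
    have "dirichlet_character 1 (\<lambda>_. 1)" by (simp add: dirichlet_character_def)
    hence "induced_from q \<psi> 1"
      unfolding induced_from_def using one by (intro conjI exI[of _ "\<lambda>_. 1"]) auto
    hence "conductor q \<psi> \<le> 1" unfolding conductor_def by (rule Least_le)
    thus False using cond q1 by simp
  qed
  hence np: "nonprincipal q \<psi>" using dir by (simp add: nonprincipal_def)
  have "q \<noteq> 2"
  proof
    assume q2: "q = 2"
    obtain a where a: "coprime a (int q)" "\<psi> a \<noteq> 1" using ex by blast
    have "a mod int q = 1 mod int q" using a(1) q2 by (simp add: coprime_right_2_iff_odd odd_iff_mod_2_eq_one)
    hence "\<psi> a = \<psi> 1" by (rule dirichlet_character_cong[OF dir])
    thus False using a dirichlet_character_1[OF dir] by simp
  qed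
  thus ?thesis using q q1 np by unfold_locales auto
qed

context np_character
begin

lemma interval_sum_eq: "(\<Sum>x\<in>{M..<M + int N}. \<psi> x) = S M N"
  unfolding S_def by (rule sum.reindex_bij_witness[of _ "\<lambda>b. b + M" "\<lambda>b. b - M"]) (auto simp: algebra_simps)

lemma interval_sum_burgess:
  assumes "r \<ge> 2"
  shows "norm (\<Sum>x\<in>{M..<M + int N}. \<psi> x) \<le> (burgess_const r * Q r) * real N powr (1 - 1 / real r)"
  using burgess[OF assms, of M N] by (simp add: interval_sum_eq mult_ac)

text \<open>Complete periods sum to zero, so fewer than \<open>p\<close> terms remain.\<close>

lemma norm_isum_le: "norm (isum \<psi> n) \<le> real p"
proof (cases "n \<ge> 0")
  case True
  have "isum \<psi> n = S 1 (nat n)"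
    using isum_diff[of 0 n \<psi>] True interval_sum_eq[of 1 "nat n"] by (simp add: isum_def)
  also have "\<dots> = S 1 (nat n mod p)" by (simp add: S_mod_length)
  finally have "norm (isum \<psi> n) \<le> real (nat n mod p)" by (simp add: norm_S_le)
  also have "\<dots> \<le> real p" using p_pos by (simp add: less_imp_le)
  finally show ?thesis .
qed (simp add: isum_def)

end

text \<open>A solution of \<open>e (k + 1) \<ge> 2 * e k + c^k\<close> with
  \<open>c = 4 powr (1 - 1/r)\<close>. For \<open>r = 2\<close> the base \<open>c\<close> equals the
  factor 2 of the recurrence, and this resonance brings in \<open>1 + k\<close>; for
  \<open>r \<ge> 3\<close> a geometric sequence suffices.\<close>

definition level_const :: "nat \<Rightarrow> nat \<Rightarrow> real" where
  "level_const r k = (if r = 2 then (1 + real k) * 2 ^ k else 2 * (4 powr (1 - 1 / real r)) ^ k)"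

lemma four_powr_half: "4 powr (1 - 1 / real 2) = 2"
  by (simp add: powr_half_sqrt)

lemma level_const_rec:
  assumes "r \<ge> 2"
  shows "level_const r 0 \<ge> 1" "level_const r (Suc k) \<ge> 2 * level_const r k + (4 powr (1 - 1 / real r)) ^ k"
proof -
  show "level_const r 0 \<ge> 1" by (simp add: level_const_def)
  show "level_const r (Suc k) \<ge> 2 * level_const r k + (4 powr (1 - 1 / real r)) ^ k"
  proof (cases "r = 2")
    case True
    have "4 powr (1 - 1 / real r) = 2" unfolding True by (rule four_powr_half)
    thus ?thesis using True by (simp add: level_const_def algebra_simps)
  next
    case False
    define c where "c = 4 powr (1 - 1 / real r)"
    have r3: "real r \<ge> 3" using assms False by simp
    \<comment> \<open>\<open>(5/2)^3\<close> is just below \<open>4^2\<close>, and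
      \<open>c \<ge> 5/2\<close> is what the recurrence \<open>2 * c \<ge> 4 + 1\<close>
      requires.\<close>
    have "(5 / 2 :: real) ^ 3 \<le> (4 powr (2 / 3)) ^ 3"
      by (simp add: powr_pow) (simp add: power_divide)
    hence "(5 / 2 :: real) \<le> 4 powr (2 / 3)" by (subst (asm) power_mono_iff) auto
    also have "\<dots> \<le> c" unfolding c_def using r3 by (intro powr_mono) (auto simp: field_simps)
    finally have c: "c \<ge> 5 / 2" .
    have "5 * c ^ k \<le> (2 * c) * c ^ k" using c by (intro mult_right_mono) auto
    thus ?thesis using False by (simp add: level_const_def flip: c_def)
  qed
qed

lemma level_const_le:
  assumes r: "r \<ge> 2" and T: "T \<ge> 1" and i: "real i \<le> ln T"
  shows "level_const r i \<le> (4 powr (1 - 1 / real r)) ^ i * (2 * (1 + ln T) ^ nu r)"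
proof (cases "r = 2")
  case True
  have "4 powr (1 - 1 / real r) = 2" unfolding True by (rule four_powr_half)
  moreover have "(1 + real i) * 2 ^ i \<le> (1 + ln T) * 2 ^ i" using i by (intro mult_right_mono) auto
  moreover have "(1 + ln T) * 2 ^ i \<le> 2 * ((1 + ln T) * 2 ^ i)" using T by simp
  ultimately show ?thesis using True by (simp add: level_const_def nu_def mult_ac)
next
  case False
  thus ?thesis by (simp add: level_const_def nu_def)
qed

text \<open>Beyond the logarithms of Burgess's bound, one counts the dyadic blocks and
  \<open>nu r\<close> of them the levels of bisection. All of these are \<open>1 + ln T\<close>,
  converted to \<open>ln q2\<close> at the price of a factor \<open>1 + D\<close> each.\<close>

lemma double_sum_bound:
  assumes r: "r \<ge> 2" and c1: "np_character q1 \<psi>1" and c2: "np_character q2 \<psi>2" and T: "T \<ge> 1"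
    and lnT: "ln T \<le> D * ln (real q2)" and D: "D \<ge> 0"
  shows "norm (\<Sum>(x, y)\<in>hyp_region T. \<psi>1 x * \<psi>2 y) \<le>
    14 * (burgess_const r)\<^sup>2 * (1 + D) ^ (nu r + 1) * (T powr (1 - 1 / real r) *
      real (q1 * q2) powr ((real r + 1) / (4 * (real r)\<^sup>2)) * ln (real q1) powr (1 / real r) *
      ln (real q2) powr (1 / real r + real (nu r) + 1))"
proof -
  interpret c1: np_character q1 \<psi>1 by (rule c1)
  interpret c2: np_character q2 \<psi>2 by (rule c2)
  define c where "c = burgess_const r"
  have c0: "c \<ge> 0" unfolding c_def using burgess_const_ge[of r] by linarith
  define L where "L = ln (real q2)"
  have L: "L \<ge> 1" using c2.ln_p by (simp add: L_def)
  have lT: "1 + ln T \<le> (1 + D) * L" using lnT L by (simp add: L_def algebra_simps)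
  have E1: "2 * (1 + ln T) ^ nu r \<ge> 1"
  proof -
    have "(1 + ln T) ^ nu r \<ge> 1" using T by (intro one_le_power) auto
    thus ?thesis by linarith
  qed
  have "norm (\<Sum>(x, y)\<in>hyp_region T. \<psi>1 x * \<psi>2 y) \<le> 7 * (2 * (1 + ln T) ^ nu r) * (1 + ln T) *
      ((c * c1.Q r) * (c * c2.Q r) * T powr (1 - 1 / real r))"
  proof (rule hyperbola_bound[where e = "level_const r"])
    show "1 / 2 \<le> 1 - 1 / real r" "1 - 1 / real r \<le> 1" using r by (auto simp: field_simps)
    show "c * c1.Q r \<ge> 0" "c * c2.Q r \<ge> 0" using c0 c1.Q_pos[of r] c2.Q_pos[of r] by auto
    show "norm (\<Sum>x\<in>{M..<M + int N}. \<psi>1 x) \<le> c * c1.Q r * real N powr (1 - 1 / real r)" for M N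
      unfolding c_def by (rule c1.interval_sum_burgess[OF r])
    show "norm (\<Sum>x\<in>{M..<M + int N}. \<psi>2 x) \<le> c * c2.Q r * real N powr (1 - 1 / real r)" for M N
      unfolding c_def by (rule c2.interval_sum_burgess[OF r])
  qed (use T E1 level_const_rec[OF r] level_const_le[OF r T] in auto)
  also have "\<dots> = 14 * (c\<^sup>2 * (c1.Q r * c2.Q r * T powr (1 - 1 / real r))) * (1 + ln T) ^ (nu r + 1)"
    by (simp add: power2_eq_square)
  also have "\<dots> \<le> 14 * (c\<^sup>2 * (c1.Q r * c2.Q r * T powr (1 - 1 / real r))) * ((1 + D) * L) ^ (nu r + 1)"
    using lT T c0 c1.Q_pos[of r] c2.Q_pos[of r] by (intro mult_left_mono power_mono) auto
  also have "\<dots> = 14 * c\<^sup>2 * (1 + D) ^ (nu r + 1) * (T powr (1 - 1 / real r) *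
      real (q1 * q2) powr ((real r + 1) / (4 * (real r)\<^sup>2)) * ln (real q1) powr (1 / real r) *
      ln (real q2) powr (1 / real r + real (nu r) + 1))"
  proof -
    have "L ^ (nu r + 1) = L powr (real (nu r) + 1)"
      using L powr_realpow[of L "nu r + 1"] by (simp only: of_nat_add of_nat_1)
    moreover have "L powr (1 / real r + real (nu r) + 1) = L powr (1 / real r) * L powr (real (nu r) + 1)"
      by (simp add: add.assoc flip: powr_add)
    moreover have "real (q1 * q2) powr ((real r + 1) / (4 * (real r)\<^sup>2)) =
        real q1 powr ((real r + 1) / (4 * (real r)\<^sup>2)) * real q2 powr ((real r + 1) / (4 * (real r)\<^sup>2))"
      by (simp add: powr_mult)
    ultimately show ?thesis
      unfolding c1.Q_def c2.Q_def power_mult_distrib L_def[symmetric] by (simp only: mult_ac)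
  qed
  finally show ?thesis by (simp only: c_def)
qed

text \<open>Incomplete sums are at most \<open>q2 \<le> T powr (1/6)\<close>, so either half is at
  most \<open>sqrt T * q2 \<le> T powr (2/3)\<close>. The sixth power is chosen for this exponent,
  which is the value of \<open>r / (r + 1)\<close> at \<open>r = 2\<close> and hence its least
  value.\<close>

lemma double_sum_trivial_bound:
  assumes c1: "np_character q1 \<psi>1" and c2: "np_character q2 \<psi>2" and q: "q1 \<le> q2" and T: "T \<ge> real q2 ^ 6"
  shows "norm (\<Sum>(x, y)\<in>hyp_region T. \<psi>1 x * \<psi>2 y) \<le> 3 * T powr (2 / 3)"
proof -
  interpret c1: np_character q1 \<psi>1 by (rule c1)
  interpret c2: np_character q2 \<psi>2 by (rule c2)
  have q2: "real q2 \<ge> 1" using c2.p3 by simp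
  have T1: "T \<ge> 1" using T one_le_power[OF q2, of 6] by linarith
  define R where "R = \<lfloor>sqrt T\<rfloor>"
  have R: "R \<ge> 0" "of_int R \<le> sqrt T" using T1 unfolding R_def by (auto simp: linorder_not_le)
  have q2T: "real q2 \<le> T powr (1 / 6)"
  proof -
    have "(real q2 ^ 6) powr (1 / 6) = (real q2 powr real 6) powr (1 / 6)"
      using q2 by (subst powr_realpow) auto
    hence "real q2 = (real q2 ^ 6) powr (1 / 6)" using q2 by (simp only: powr_powr) simp
    also have "\<dots> \<le> T powr (1 / 6)" using T by (intro powr_mono2) auto
    finally show ?thesis .
  qed
  have part: "norm (\<Sum>x\<in>{1..R}. f x * isum g \<lfloor>T / of_int x\<rfloor>) \<le> sqrt T * real q2"
    if f: "\<And>x. norm (f x) \<le> 1" and g: "\<And>n. norm (isum g n) \<le> real q2" for f g :: "int \<Rightarrow> complex"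
  proof -
    have "norm (\<Sum>x\<in>{1..R}. f x * isum g \<lfloor>T / of_int x\<rfloor>) \<le> (\<Sum>x\<in>{1..R}. 1 * real q2)"
      by (intro order_trans[OF norm_sum] sum_mono) (unfold norm_mult, intro mult_mono f g, auto)
    also have "\<dots> = real (nat R) * real q2" by simp
    also have "\<dots> \<le> sqrt T * real q2" using R by (intro mult_right_mono) auto
    finally show ?thesis .
  qed
  have b1: "norm (isum \<psi>1 n) \<le> real q2" for n using c1.norm_isum_le[of n] q by simp
  have "norm (isum \<psi>1 R * isum \<psi>2 R) \<le> T powr (1 / 6) * (T powr (1 / 6) * 1)"
    unfolding norm_mult using b1[of R] c2.norm_isum_le[of R] q2T by (intro mult_mono) auto
  also have "\<dots> = T powr (1 / 3)" by (simp flip: powr_add)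
  also have "\<dots> \<le> T powr (2 / 3)" using T1 by (intro powr_mono) auto
  finally have 3: "norm (isum \<psi>1 R * isum \<psi>2 R) \<le> T powr (2 / 3)" .
  have "sqrt T * real q2 \<le> T powr (1 / 2) * T powr (1 / 6)"
    using q2T T1 by (intro mult_mono) (auto simp: powr_half_sqrt)
  also have "\<dots> = T powr (2 / 3)" by (simp flip: powr_add)
  finally have sq: "sqrt T * real q2 \<le> T powr (2 / 3)" .
  have 1: "norm (\<Sum>x\<in>{1..R}. \<psi>1 x * isum \<psi>2 \<lfloor>T / of_int x\<rfloor>) \<le> T powr (2 / 3)"
    by (rule order_trans[OF part[OF c1.norm_\<psi> c2.norm_isum_le] sq])
  have 2: "norm (\<Sum>x\<in>{1..R}. \<psi>2 x * isum \<psi>1 \<lfloor>T / of_int x\<rfloor>) \<le> T powr (2 / 3)"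
    by (rule order_trans[OF part[OF c2.norm_\<psi> b1] sq])
  have "norm (\<Sum>(x, y)\<in>hyp_region T. \<psi>1 x * \<psi>2 y) \<le> T powr (2 / 3) + T powr (2 / 3) + T powr (2 / 3)"
    unfolding hyperbola_split[OF T1] R_def[symmetric]
    by (intro order_trans[OF norm_triangle_ineq4] add_mono 3 norm_triangle_le 1 2)
  thus ?thesis by simp
qed

text \<open>The sum of the exponents in \<open>T_threshold\<close>: each of its four bases is at
  most \<open>q2\<close>, since \<open>ln x \<le> x\<close>.\<close>

definition threshold_exp :: "nat \<Rightarrow> real" where
  "threshold_exp r = (real r + 1)\<^sup>2 / (4 * real r) + (real r + 1) / (4 * real r) + real (r + 1)
     + real (nu r * r * (r + 1) + r\<^sup>2 + 1)"

lemma ln_T_threshold_le: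
  assumes q: "3 \<le> q1" "q1 \<le> q2"
  shows "T_threshold r q1 q2 > 0" "ln (T_threshold r q1 q2) \<le> threshold_exp r * ln (real q2)"
proof -
  define a b k where "a = (real r + 1)\<^sup>2 / (4 * real r)" and "b = (real r + 1) / (4 * real r)"
    and "k = nu r * r * (r + 1) + r\<^sup>2 + 1"
  have nn: "a \<ge> 0" "b \<ge> 0" by (auto simp: a_def b_def)
  define l1 l2 where "l1 = ln (real q1)" and "l2 = ln (real q2)"
  have l: "1 \<le> l1" "l1 \<le> l2" unfolding l1_def l2_def using q by (auto intro: ln_3_ge_1)
  have ll: "ln l1 \<le> l2" "ln l2 \<le> l2" using l ln_le_minus_one[of l1] ln_le_minus_one[of l2] by linarith+
  have eq: "T_threshold r q1 q2 = real q1 powr a * real q2 powr b * l1 ^ (r + 1) * l2 ^ k"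
    by (simp add: T_threshold_def a_def b_def k_def l1_def l2_def)
  show "T_threshold r q1 q2 > 0" unfolding eq using q l by (intro mult_pos_pos zero_less_power) auto
  have "ln (T_threshold r q1 q2) = a * l1 + b * l2 + real (r + 1) * ln l1 + real k * ln l2"
    unfolding eq using q l by (simp add: ln_mult ln_powr ln_realpow l1_def l2_def algebra_simps)
  also have "\<dots> \<le> a * l2 + b * l2 + real (r + 1) * l2 + real k * l2"
    using nn l ll by (intro add_mono mult_left_mono) auto
  also have "\<dots> = threshold_exp r * l2" by (simp only: threshold_exp_def a_def b_def k_def distrib_right)
  finally show "ln (T_threshold r q1 q2) \<le> threshold_exp r * ln (real q2)" by (simp only: l2_def)
qed

text \<open>\<open>T_threshold\<close> is the exact point at which the two bounds of the theorem cross.\<close>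
lemma bounds_cross:
  assumes r: "r \<ge> 2" and q: "3 \<le> q1" "q1 \<le> q2" and T: "T_threshold r q1 q2 \<le> T"
  shows "T powr (1 - 1 / real r) * real (q1 * q2) powr ((real r + 1) / (4 * (real r)\<^sup>2)) *
      ln (real q1) powr (1 / real r) * ln (real q2) powr (1 / real r + real (nu r) + 1) \<le>
    T powr (real r / (real r + 1)) * real q2 powr (1 / (4 * real r)) * ln (real q2) powr (2 / (real r + 1))"
proof -
  define R where "R = real r"
  define n where "n = real (nu r)"
  have R: "R \<ge> 2" using r by (simp add: R_def)
  define l1 l2 where "l1 = ln (real q1)" and "l2 = ln (real q2)"
  have l: "1 \<le> l1" "l1 \<le> l2" unfolding l1_def l2_def using q by (auto intro: ln_3_ge_1)
  \<comment> \<open>The difference of the exponents of \<open>T\<close> in the two bounds, see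
    \<open>f1\<close>. Raising \<open>T_threshold \<le> T\<close> to the power \<open>t\<close>
    gives exactly the factor by which the remaining parts differ.\<close>
  define t where "t = 1 / (R * (R + 1))"
  have t0: "t \<ge> 0" using R by (simp add: t_def)
  have Tpos: "T > 0" using ln_T_threshold_le(1)[OF q, of r] T by linarith
  have thr: "T_threshold r q1 q2 = real q1 powr ((R + 1)\<^sup>2 / (4 * R)) * real q2 powr ((R + 1) / (4 * R)) * l1 powr (R + 1) * l2 powr (n * R * (R + 1) + R\<^sup>2 + 1)"
  proof -
    have "l1 ^ (r + 1) = l1 powr (R + 1)"
      using l powr_realpow[of l1 "r + 1"] by (simp only: R_def of_nat_add of_nat_1)
    moreover have "l2 ^ (nu r * r * (r + 1) + r\<^sup>2 + 1) = l2 powr (n * R * (R + 1) + R\<^sup>2 + 1)"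
    proof -
      have "n * R * (R + 1) + R\<^sup>2 + 1 = real (nu r * r * (r + 1) + r\<^sup>2 + 1)" by (simp add: n_def R_def algebra_simps)
      thus ?thesis using l by (simp only: powr_realpow)
    qed
    ultimately show ?thesis by (simp add: T_threshold_def R_def l1_def l2_def)
  qed
  have "real q1 powr ((R + 1) / (4 * R\<^sup>2)) * real q2 powr (1 / (4 * R\<^sup>2)) * l1 powr (1 / R) * l2 powr ((n * R * (R + 1) + R\<^sup>2 + 1) * t)
      = T_threshold r q1 q2 powr t"
  proof -
    define s where "s = R + 1"
    have s0: "s \<noteq> 0" "R \<noteq> 0" using R by (auto simp: s_def)
    have e1: "s\<^sup>2 / (4 * R) * t = s / (4 * R\<^sup>2)" and e2: "s / (4 * R) * t = 1 / (4 * R\<^sup>2)" and e3: "s * t = 1 / R"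
      using s0 by (simp_all add: t_def power2_eq_square flip: s_def)
    note e1 = e1[unfolded s_def] and e2 = e2[unfolded s_def] and e3 = e3[unfolded s_def]
    show ?thesis unfolding thr using l q
      by (simp only: powr_mult powr_powr e1 e2 e3 mult_nonneg_nonneg powr_ge_zero)
  qed
  also have "\<dots> \<le> T powr t" using T t0 ln_T_threshold_le(1)[OF q, of r] by (intro powr_mono2) auto
  finally have key: "real q1 powr ((R + 1) / (4 * R\<^sup>2)) * real q2 powr (1 / (4 * R\<^sup>2)) * l1 powr (1 / R) * l2 powr ((n * R * (R + 1) + R\<^sup>2 + 1) * t) \<le> T powr t" .
  have "R + R * R > 0" using R by (intro add_pos_pos mult_pos_pos) auto
  hence f1: "R / (R + 1) = (1 - 1 / R) + t" using R by (simp add: t_def field_simps)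
  have f2: "(R + 1) / (4 * R\<^sup>2) = 1 / (4 * R\<^sup>2) + 1 / (4 * R)" using R by (simp add: field_simps power2_eq_square)
  have f3: "1 / R + n + 1 = (n * R * (R + 1) + R\<^sup>2 + 1) * t + 2 / (R + 1)"
  proof -
    have s0: "R + 1 \<noteq> 0" "R \<noteq> 0" using R by auto
    have "(n * R * (R + 1) + R\<^sup>2 + 1) * t + 2 / (R + 1) = (n * R * (R + 1) + (R\<^sup>2 + 1 + 2 * R)) * t"
    proof -
      have "2 / (R + 1) = 2 * R * t" using s0 by (simp add: t_def)
      thus ?thesis by (simp only:) (simp only: algebra_simps)
    qed
    also have "R\<^sup>2 + 1 + 2 * R = (R + 1) * (R + 1)" by (simp add: power2_eq_square algebra_simps)
    also have "n * R * (R + 1) + (R + 1) * (R + 1) = (n * R + R + 1) * (R + 1)" by (simp only: algebra_simps)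
    also have "\<dots> * t = (n * R + R + 1) / R" using s0 by (simp add: t_def)
    also have "\<dots> = 1 / R + n + 1" using s0 by (simp add: add_divide_distrib)
    finally show ?thesis ..
  qed
  have "T powr (1 - 1 / R) * real (q1 * q2) powr ((R + 1) / (4 * R\<^sup>2)) * l1 powr (1 / R) * l2 powr (1 / R + n + 1)
      = T powr (1 - 1 / R) * (real q2 powr (1 / (4 * R)) * l2 powr (2 / (R + 1))) *
        (real q1 powr ((R + 1) / (4 * R\<^sup>2)) * real q2 powr (1 / (4 * R\<^sup>2)) * l1 powr (1 / R) * l2 powr ((n * R * (R + 1) + R\<^sup>2 + 1) * t))"
  proof -
    have "real (q1 * q2) powr ((R + 1) / (4 * R\<^sup>2)) = real q1 powr ((R + 1) / (4 * R\<^sup>2)) * (real q2 powr (1 / (4 * R\<^sup>2)) * real q2 powr (1 / (4 * R)))"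
      by (simp add: powr_mult f2 flip: powr_add)
    thus ?thesis unfolding f3 powr_add by (simp only: mult_ac)
  qed
  also have "\<dots> \<le> T powr (1 - 1 / R) * (real q2 powr (1 / (4 * R)) * l2 powr (2 / (R + 1))) * T powr t"
    by (intro mult_left_mono key) auto
  also have "\<dots> = T powr (R / (R + 1)) * real q2 powr (1 / (4 * R)) * l2 powr (2 / (R + 1))"
    unfolding f1 powr_add by (simp only: mult_ac)
  finally show ?thesis by (simp only: R_def n_def l1_def l2_def)
qed

theorem theorem2:
  fixes r :: nat
  assumes "r \<ge> 2"
  shows "\<exists>C::real. C > 0 \<and>
    (\<forall>(q\<^sub>1::nat) (q\<^sub>2::nat) (\<chi>\<^sub>1 :: int \<Rightarrow> complex) (\<chi>\<^sub>2 :: int \<Rightarrow> complex) (T::real).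
       prime q\<^sub>1 \<longrightarrow> prime q\<^sub>2 \<longrightarrow> q\<^sub>1 \<le> q\<^sub>2 \<longrightarrow>
       primitive_character q\<^sub>1 \<chi>\<^sub>1 \<longrightarrow> primitive_character q\<^sub>2 \<chi>\<^sub>2 \<longrightarrow> T > 1 \<longrightarrow>
       (real (q\<^sub>1 * q\<^sub>2) powr ((real r + 1) / (4 * real r)) \<le> T \<and> T \<le> T_threshold r q\<^sub>1 q\<^sub>2 \<longrightarrow>
          norm (\<Sum>(x, y) \<in> {(x::int, y::int). 0 < x \<and> 0 < y \<and> real_of_int (x * y) \<le> T}. \<chi>\<^sub>1 x * \<chi>\<^sub>2 y)
            \<le> C * (T powr (1 - 1 / real r) *
                   real (q\<^sub>1 * q\<^sub>2) powr ((real r + 1) / (4 * (real r)\<^sup>2)) *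
                   ln (real q\<^sub>1) powr (1 / real r) *
                   ln (real q\<^sub>2) powr (1 / real r + real (nu r) + 1))) \<and>
       (T_threshold r q\<^sub>1 q\<^sub>2 \<le> T \<longrightarrow>
          norm (\<Sum>(x, y) \<in> {(x::int, y::int). 0 < x \<and> 0 < y \<and> real_of_int (x * y) \<le> T}. \<chi>\<^sub>1 x * \<chi>\<^sub>2 y)
            \<le> C * (T powr (real r / (real r + 1)) *
                   real q\<^sub>2 powr (1 / (4 * real r)) *
                   ln (real q\<^sub>2) powr (2 / (real r + 1)))))"
proof -
  \<comment> \<open>\<open>double_sum_bound\<close> is applied in two ranges: up to
    \<open>T_threshold\<close>, where \<open>ln T \<le> threshold_exp r * ln q2\<close>, and below
    \<open>q2^6\<close>.\<close>
  define D where "D = max 6 (threshold_exp r)"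
  have D: "D \<ge> 6" "D \<ge> threshold_exp r" by (auto simp: D_def)
  \<comment> \<open>The 3 belongs to \<open>double_sum_trivial_bound\<close>, the rest to
    \<open>double_sum_bound\<close>.\<close>
  define C where "C = 3 + 14 * (burgess_const r)\<^sup>2 * (1 + D) ^ (nu r + 1)"
  have C3: "C \<ge> 3" and Cge: "14 * (burgess_const r)\<^sup>2 * (1 + D) ^ (nu r + 1) \<le> C" using D by (auto simp: C_def)
  show ?thesis
  proof (intro exI[of _ C] conjI allI impI)
    show "C > 0" using C3 by simp
  next
    fix q1 q2 :: nat and \<psi>1 \<psi>2 :: "int \<Rightarrow> complex" and T :: real
    assume q: "prime q1" "prime q2" "q1 \<le> q2" and prim: "primitive_character q1 \<psi>1" "primitive_character q2 \<psi>2"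
      and T: "T > 1" and TT: "real (q1 * q2) powr ((real r + 1) / (4 * real r)) \<le> T \<and> T \<le> T_threshold r q1 q2"
    have c: "np_character q1 \<psi>1" "np_character q2 \<psi>2" using q prim by (auto intro: primitive_imp_np_character)
    have q3: "3 \<le> q1" using np_character.p3[OF c(1)] .
    have l2: "ln (real q2) \<ge> 0" using np_character.ln_p[OF c(2)] by linarith
    have "ln T \<le> ln (T_threshold r q1 q2)" using TT T ln_T_threshold_le(1)[OF q3 q(3)] by (subst ln_le_cancel_iff) auto
    also have "\<dots> \<le> threshold_exp r * ln (real q2)" by (rule ln_T_threshold_le(2)[OF q3 q(3)])
    also have "\<dots> \<le> D * ln (real q2)" using D l2 by (intro mult_right_mono) auto
    finally have lnT: "ln T \<le> D * ln (real q2)" .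
    have "norm (\<Sum>(x, y)\<in>hyp_region T. \<psi>1 x * \<psi>2 y) \<le> 14 * (burgess_const r)\<^sup>2 * (1 + D) ^ (nu r + 1) *
      (T powr (1 - 1 / real r) * real (q1 * q2) powr ((real r + 1) / (4 * (real r)\<^sup>2)) * ln (real q1) powr (1 / real r) *
      ln (real q2) powr (1 / real r + real (nu r) + 1))"
      using T D by (intro double_sum_bound assms c lnT) auto
    also have "\<dots> \<le> C * (T powr (1 - 1 / real r) * real (q1 * q2) powr ((real r + 1) / (4 * (real r)\<^sup>2)) * ln (real q1) powr (1 / real r) *
      ln (real q2) powr (1 / real r + real (nu r) + 1))"
      by (intro mult_right_mono Cge) auto
    finally show "norm (\<Sum>(x, y) \<in> {(x::int, y::int). 0 < x \<and> 0 < y \<and> real_of_int (x * y) \<le> T}. \<psi>1 x * \<psi>2 y)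
      \<le> C * (T powr (1 - 1 / real r) * real (q1 * q2) powr ((real r + 1) / (4 * (real r)\<^sup>2)) * ln (real q1) powr (1 / real r) *
      ln (real q2) powr (1 / real r + real (nu r) + 1))"
      by (simp only: hyp_region_def)
  next
    fix q1 q2 :: nat and \<psi>1 \<psi>2 :: "int \<Rightarrow> complex" and T :: real
    assume q: "prime q1" "prime q2" "q1 \<le> q2" and prim: "primitive_character q1 \<psi>1" "primitive_character q2 \<psi>2"
      and T: "T > 1" and TT: "T_threshold r q1 q2 \<le> T"
    have c: "np_character q1 \<psi>1" "np_character q2 \<psi>2" using q prim by (auto intro: primitive_imp_np_character)
    have q3: "3 \<le> q1" using np_character.p3[OF c(1)] .
    have l2: "ln (real q2) \<ge> 1" using np_character.ln_p[OF c(2)] .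
    define Y where "Y = T powr (real r / (real r + 1)) * real q2 powr (1 / (4 * real r)) * ln (real q2) powr (2 / (real r + 1))"
    have Y0: "Y \<ge> 0" by (simp add: Y_def)
    have "norm (\<Sum>(x, y)\<in>hyp_region T. \<psi>1 x * \<psi>2 y) \<le> C * Y"
    proof (cases "T \<ge> real q2 ^ 6")
      case True
      have "norm (\<Sum>(x, y)\<in>hyp_region T. \<psi>1 x * \<psi>2 y) \<le> 3 * T powr (2 / 3)"
        by (rule double_sum_trivial_bound[OF c q(3) True])
      \<comment> \<open>Here \<open>2/3 \<le> r / (r + 1)\<close>; the factors with
        \<open>q2\<close> that are inserted next are at least 1.\<close>
      also have "\<dots> \<le> C * (T powr (real r / (real r + 1)) * 1 * 1)"
        using T C3 assms by (intro mult_mono) (auto simp: field_simps intro!: powr_mono)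
      also have "\<dots> \<le> C * Y"
        unfolding Y_def using C3 l2 q3 q(3)
        by (intro mult_left_mono mult_mono ge_one_powr_ge_zero) auto
      finally show ?thesis .
    next
      case False
      have q2: "real q2 > 0" using q3 q(3) by simp
      have "ln T \<le> ln (real q2 ^ 6)" using False T q2 by (subst ln_le_cancel_iff) auto
      also have "\<dots> = 6 * ln (real q2)" using q2 by (simp add: ln_realpow)
      also have "\<dots> \<le> D * ln (real q2)" using D l2 by (intro mult_right_mono) auto
      finally have lnT: "ln T \<le> D * ln (real q2)" .
      have "norm (\<Sum>(x, y)\<in>hyp_region T. \<psi>1 x * \<psi>2 y) \<le> 14 * (burgess_const r)\<^sup>2 * (1 + D) ^ (nu r + 1) *
        (T powr (1 - 1 / real r) * real (q1 * q2) powr ((real r + 1) / (4 * (real r)\<^sup>2)) * ln (real q1) powr (1 / real r) *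
        ln (real q2) powr (1 / real r + real (nu r) + 1))"
        using T D by (intro double_sum_bound assms c lnT) auto
      also have "\<dots> \<le> C * Y"
        unfolding Y_def using D by (intro mult_mono Cge bounds_cross assms q3 q(3) TT) (use C3 in auto)
      finally show ?thesis .
    qed
    thus "norm (\<Sum>(x, y) \<in> {(x::int, y::int). 0 < x \<and> 0 < y \<and> real_of_int (x * y) \<le> T}. \<psi>1 x * \<psi>2 y)
      \<le> C * (T powr (real r / (real r + 1)) * real q2 powr (1 / (4 * real r)) * ln (real q2) powr (2 / (real r + 1)))"
      by (simp only: hyp_region_def Y_def)
  qed
qed

end
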